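(* Let $\kappa\ge 0$, let $\mu$ be a measure on $(0,\infty)$ with $\mu(0,\infty)=\infty$ and $\int_0^\infty (1\wedge x)\,\mu(dx)<\infty$, and set $w(x)=\mu(x,\infty)$ for $x>0$ (an unbounded right-continuous non-increasing function on $(0,\infty)$). Let $S=\{S_t;t\ge 0\}$ be the subordinator with drift $\kappa$ and Lévy measure $\mu$, and let $E_t=\inf\{s>0:S_s>t\}$, $t\ge 0$, be the inverse subordinator. Let $X=\{X_t,t\ge 0;\mathbb P_x,x\in E\}$ be a strong Markov process on a separable locally compact Hausdorff space $E$, independent of $S$, whose transition semigroup $\{P_t;t\ge 0\}$, $P_tf(x)=\mathbb E_x[f(X_t)]$, is a uniformly bounded strongly continuous semigroup in some Banach space $(\mathbb B,\|\cdot\|)$ of functions on $E$, with infinitesimal generator $(\mathcal L,\mathcal D(\mathcal L))$ in $\mathbb B$. Then for every $f\in\mathcal D(\mathcal L)$ the function $u(t,x):=\mathbb E_x[f(X_{E_t})]$ is the unique solution in $\mathbb B$ to the time fractional equation $$\left(\kappa\,\partial_t+\partial_t^w\right)u=\mathcal L u\quad\text{with } u(0,x)=f(x)$$ in the strong sense. Here $u$ being a solution in the strong sense means that $u(0,\cdot)=f$ and: (i) $\sup_{t>0}\|u(t,\cdot)\|<\infty$; $u(t,\cdot)\in\mathcal D(\mathcal L)$ for each $t\ge 0$ with $\sup_{t\ge 0}\|\mathcal L u(t,\cdot)\|<\infty$; and both $t\mapsto u(t,\cdot)$ and $t\mapsto\mathcal L u(t,\cdot)$ are continuous in $(\mathbb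 B,\|\cdot\|)$; (ii) for every $t>0$, the integral $I_t^w(u):=\int_0^t w(t-s)\,(u(s,\cdot)-f)\,ds$ is absolutely convergent in $(\mathbb B,\|\cdot\|)$ and $$\lim_{\delta\to 0}\frac1\delta\Big(\kappa\,(u(t+\delta,\cdot)-u(t,\cdot))+I_{t+\delta}^w(u)-I_t^w(u)\Big)=\mathcal L u(t,\cdot)\quad\text{in }(\mathbb B,\|\cdot\|).$$
   Context: A subordinator is a non-negative valued Lévy process $\{S_t;t\ge0\}$ with $S_0=0$. The subordinator with drift $\kappa$ and Lévy measure $\mu$ is characterized by $\mathbb E[e^{-\lambda S_t}]=e^{-t\phi(\lambda)}$, $\lambda>0$, with $\phi(\lambda)=\kappa\lambda+\int_0^\infty(1-e^{-\lambda x})\,\mu(dx)$. "Uniformly bounded" means $\sup_{t>0}\|P_t\|<\infty$ (operator norm on $\mathbb B$). Typical choices are $\mathbb B=L^p(E;m)$ for some measure $m$ on $E$ and $p\ge1$, or $\mathbb B=C_\infty(E)$, the continuous functions on $E$ vanishing at infinity with the uniform norm. As an element of $\mathbb B$, $u(t,\cdot)=\mathbb E[P_{E_t}f]=\int_{[0,\infty)}P_sf\;\mathbb P(E_t\in ds)$ (a Bochner integral). The generalized fractional-time derivative is $\partial_t^w g(t)=\frac{d}{dt}\int_0^t w(t-s)(g(s)-g(0))\,ds$, whenever it is well defined; $\partial_t=\partial/\partial t$. *)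

theory Defs
  imports "HOL-Probability.Probability"
begin

section \<open>Bochner integrals in arbitrary Banach spaces\<close>

text \<open>The library's \<open>has_bochner_integral\<close> is restricted to second countable (hence separable)
  spaces.  The following is the same definition without that restriction.\<close>

definition has_banach_integral ::
    "'a measure \<Rightarrow> ('a \<Rightarrow> 'b::real_normed_vector) \<Rightarrow> 'b \<Rightarrow> bool" where
  "has_banach_integral M f y \<longleftrightarrow>
     f \<in> borel_measurable M \<and>
     (\<exists>s. (\<forall>i. Bochner_Integration.simple_bochner_integrable M (s i)) \<and>
          (\<lambda>i. \<integral>\<^sup>+x. ennreal (norm (f x - s i x)) \<partial>M) \<longlonglongrightarrow> 0 \<and>
          (\<lambda>i. Bochner_Integration.simple_bochner_integral M (s i)) \<longlonglongrightarrow> y)"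

definition banach_integrable :: "'a measure \<Rightarrow> ('a \<Rightarrow> 'b::real_normed_vector) \<Rightarrow> bool" where
  "banach_integrable M f \<longleftrightarrow> (\<exists>y. has_banach_integral M f y)"

definition banach_integral :: "'a measure \<Rightarrow> ('a \<Rightarrow> 'b::real_normed_vector) \<Rightarrow> 'b" where
  "banach_integral M f = (THE y. has_banach_integral M f y)"

lemma has_banach_integral_iff_has_bochner_integral:
  fixes f :: "'a \<Rightarrow> 'b::{real_normed_vector, second_countable_topology}"
  shows "has_banach_integral M f y \<longleftrightarrow> has_bochner_integral M f y"
  unfolding has_banach_integral_def has_bochner_integral.simps by blast


section \<open>Strongly continuous semigroups\<close>

definition strongly_continuous_semigroup :: "(real \<Rightarrow> 'b \<Rightarrow>\<^sub>L 'b::banach) \<Rightarrow> bool" where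
  "strongly_continuous_semigroup P \<longleftrightarrow>
     P 0 = id_blinfun \<and>
     (\<forall>s\<ge>0. \<forall>t\<ge>0. P (s + t) = P s o\<^sub>L P t) \<and>
     (\<forall>f. ((\<lambda>t. P t f) \<longlongrightarrow> f) (at_right 0))"

definition uniformly_bounded :: "(real \<Rightarrow> 'b \<Rightarrow>\<^sub>L 'b::banach) \<Rightarrow> bool" where
  "uniformly_bounded P \<longleftrightarrow> bdd_above ((\<lambda>t. norm (P t)) ` {0<..})"

definition generator_domain :: "(real \<Rightarrow> 'b \<Rightarrow>\<^sub>L 'b::banach) \<Rightarrow> 'b set" where
  "generator_domain P = {f. \<exists>g. ((\<lambda>h. (P h f - f) /\<^sub>R h) \<longlongrightarrow> g) (at_right 0)}"

definition generator :: "(real \<Rightarrow> 'b \<Rightarrow>\<^sub>L 'b::banach) \<Rightarrow> 'b \<Rightarrow> 'b" where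
  "generator P f = Lim (at_right 0) (\<lambda>h. (P h f - f) /\<^sub>R h)"


section \<open>Subordinators\<close>

definition laplace_exponent :: "real \<Rightarrow> real measure \<Rightarrow> real \<Rightarrow> real" where
  "laplace_exponent \<kappa> \<mu> l = \<kappa> * l + (\<integral>x. (1 - exp (- l * x)) \<partial>\<mu>)"

definition subordinator :: "'w measure \<Rightarrow> real \<Rightarrow> real measure \<Rightarrow> (real \<Rightarrow> 'w \<Rightarrow> real) \<Rightarrow> bool" where
  "subordinator N \<kappa> \<mu> S \<longleftrightarrow>
     prob_space N \<and>
     (\<forall>t\<ge>0. S t \<in> borel_measurable N) \<and>
     (\<forall>\<omega>\<in>space N. S 0 \<omega> = 0 \<and>
        (\<forall>t\<ge>0. 0 \<le> S t \<omega>) \<and>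
        (\<forall>t\<ge>0. continuous (at_right t) (\<lambda>s. S s \<omega>)) \<and>
        (\<forall>t>0. \<exists>l. ((\<lambda>s. S s \<omega>) \<longlongrightarrow> l) (at_left t))) \<and>
     (\<forall>n. \<forall>\<tau>::nat \<Rightarrow> real. 0 \<le> \<tau> 0 \<and> mono \<tau> \<longrightarrow>
        prob_space.indep_vars N (\<lambda>_. borel) (\<lambda>i \<omega>. S (\<tau> (Suc i)) \<omega> - S (\<tau> i) \<omega>) {..<n}) \<and>
     (\<forall>s\<ge>0. \<forall>t\<ge>0. distr N borel (\<lambda>\<omega>. S (s + t) \<omega> - S s \<omega>) = distr N borel (S t)) \<and>
     (\<forall>t\<ge>0. \<forall>l>0. (\<integral>\<omega>. exp (- l * S t \<omega>) \<partial>N) = exp (- t * laplace_exponent \<kappa> \<mu> l))"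

text \<open>The infimum is taken in \<open>[0,\<infinity>]\<close>, so that it is \<open>\<infinity>\<close> on the null set of paths which never
  exceed level \<open>t\<close>.\<close>

definition inverse_subordinator :: "(real \<Rightarrow> 'w \<Rightarrow> real) \<Rightarrow> real \<Rightarrow> 'w \<Rightarrow> ennreal" where
  "inverse_subordinator S t \<omega> = (INF s\<in>{s. 0 < s \<and> t < S s \<omega>}. ennreal s)"

text \<open>The time argument of a process is a real number; the value \<open>\<infinity>\<close> is sent to \<open>0\<close>.\<close>

abbreviation inverse_time :: "(real \<Rightarrow> 'w \<Rightarrow> real) \<Rightarrow> real \<Rightarrow> 'w \<Rightarrow> real" where
  "inverse_time S t \<omega> \<equiv> enn2real (inverse_subordinator S t \<omega>)"


section \<open>Strong Markov processes\<close>

text \<open>The filtration is indexed by \<open>[0,\<infinity>]\<close>, so that stopping times may be infinite and the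
  \<open>\<sigma>\<close>-algebra \<open>pre_sigma T\<close> of events up to \<open>T\<close> consists of events in \<open>F \<infinity>\<close>.
  Progressive measurability makes \<open>X\<close> at a random time a random variable; it holds for
  right-continuous adapted processes in metrizable spaces.\<close>

definition strong_markov_process ::
    "'w measure \<Rightarrow> (ennreal \<Rightarrow> 'w measure) \<Rightarrow> ('e::topological_space \<Rightarrow> 'w measure) \<Rightarrow>
     (real \<Rightarrow> 'w \<Rightarrow> 'e) \<Rightarrow> bool" where
  "strong_markov_process M F Px X \<longleftrightarrow>
     filtration (space M) F \<and> (\<forall>t. subalgebra M (F t)) \<and>
     Px \<in> borel \<rightarrow>\<^sub>M prob_algebra M \<and>
     (\<forall>t\<ge>0. (\<lambda>(s, \<omega>). X s \<omega>) \<in> restrict_space borel {0..t} \<Otimes>\<^sub>M F (ennreal t) \<rightarrow>\<^sub>M borel) \<and>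
     (\<forall>x. AE \<omega> in Px x. X 0 \<omega> = x) \<and>
     (\<forall>T. stopping_time F T \<longrightarrow>
        (\<forall>A\<in>sets (filtration.pre_sigma (space M) F T). \<forall>x. \<forall>t\<ge>0. \<forall>B\<in>sets borel.
           measure (Px x) {\<omega>\<in>A. T \<omega> < \<infinity> \<and> X (enn2real (T \<omega>) + t) \<omega> \<in> B} =
           (LINT \<omega>:{\<omega>\<in>A. T \<omega> < \<infinity>}|Px x.
              measure (Px (X (enn2real (T \<omega>)) \<omega>)) {\<omega>'\<in>space M. X t \<omega>' \<in> B})))"

text \<open>Independence of \<open>X\<close> (with its filtration) and \<open>S\<close> under a probability measure \<open>N\<close>.\<close>

definition independent_of_process ::
    "'w measure \<Rightarrow> (ennreal \<Rightarrow> 'w measure) \<Rightarrow> (real \<Rightarrow> 'w \<Rightarrow> real) \<Rightarrow> bool" where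
  "independent_of_process N F S \<longleftrightarrow>
     prob_space.indep_set N (sets (F \<infinity>))
       (sigma_sets (space N) {S t -` B \<inter> space N | t B. 0 \<le> t \<and> B \<in> sets borel})"


section \<open>Banach spaces of functions\<close>

text \<open>
  A Banach space \<open>'b\<close> whose elements are functions on \<open>E\<close>, possibly up to null sets: \<open>V\<close> is the
  space of representatives and \<open>cls f\<close> the element represented by \<open>f \<in> V\<close>.  Representatives are
  identified when they agree a.e. with respect to every measure in \<open>\<N>\<close>, and convergence in norm
  implies convergence in \<open>L\<^sup>1(\<nu>)\<close> for \<open>\<nu> \<in> \<N>\<close>.  The two typical examples are
  \<^item> continuous functions vanishing at infinity: \<open>\<N>\<close> is the set of Dirac measures (so that
    a.e. equality is equality) and \<open>cls\<close> is bijective;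
  \<^item> \<open>L\<^sup>p(E; m)\<close>: \<open>\<N>\<close> is the set of restrictions of \<open>m\<close> to Borel sets of finite measure.
\<close>

definition banach_function_space ::
    "'e::topological_space measure set \<Rightarrow> ('e \<Rightarrow> real) set \<Rightarrow> (('e \<Rightarrow> real) \<Rightarrow> 'b::banach) \<Rightarrow> bool" where
  "banach_function_space \<N> V cls \<longleftrightarrow>
     (\<forall>\<nu>\<in>\<N>. finite_measure \<nu> \<and> sets \<nu> = sets borel) \<and>
     V \<subseteq> borel_measurable borel \<and>
     (\<forall>f\<in>V. \<forall>g\<in>V. (\<lambda>x. f x + g x) \<in> V \<and> cls (\<lambda>x. f x + g x) = cls f + cls g) \<and>
     (\<forall>f\<in>V. \<forall>c. (\<lambda>x. c * f x) \<in> V \<and> cls (\<lambda>x. c * f x) = c *\<^sub>R cls f) \<and>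
     cls ` V = UNIV \<and>
     (\<forall>f\<in>V. \<forall>g\<in>borel_measurable borel.
        (g \<in> V \<and> cls g = cls f) \<longleftrightarrow> (\<forall>\<nu>\<in>\<N>. AE x in \<nu>. g x = f x)) \<and>
     (\<forall>\<nu>\<in>\<N>. \<exists>C. \<forall>f\<in>V. integrable \<nu> f \<and> (\<integral>x. \<bar>f x\<bar> \<partial>\<nu>) \<le> C * norm (cls f))"

text \<open>\<open>P\<^sub>t f(x) = \<E>\<^sub>x[f(X\<^sub>t)]\<close> as an identity in the Banach space.\<close>

definition transition_semigroup ::
    "'e::topological_space measure set \<Rightarrow> ('e \<Rightarrow> real) set \<Rightarrow> (('e \<Rightarrow> real) \<Rightarrow> 'b::banach) \<Rightarrow>
     ('e \<Rightarrow> 'w measure) \<Rightarrow> (real \<Rightarrow> 'w \<Rightarrow> 'e) \<Rightarrow> (real \<Rightarrow> 'b \<Rightarrow>\<^sub>L 'b) \<Rightarrow> bool" where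
  "transition_semigroup \<N> V cls Px X P \<longleftrightarrow>
     (\<forall>t\<ge>0. \<forall>f\<in>V.
        (\<forall>\<nu>\<in>\<N>. AE x in \<nu>. integrable (Px x) (\<lambda>\<omega>. f (X t \<omega>))) \<and>
        (\<lambda>x. \<integral>\<omega>. f (X t \<omega>) \<partial>Px x) \<in> V \<and>
        P t (cls f) = cls (\<lambda>x. \<integral>\<omega>. f (X t \<omega>) \<partial>Px x))"


section \<open>The time fractional equation\<close>

text \<open>\<open>w(x) = \<mu>(x,\<infinity>)\<close>; only used for \<open>x > 0\<close>, where it is finite.\<close>

definition levy_tail :: "real measure \<Rightarrow> real \<Rightarrow> real" where
  "levy_tail \<mu> x = measure \<mu> {x<..}"

definition frac_integrand :: "(real \<Rightarrow> real) \<Rightarrow> 'b::banach \<Rightarrow> (real \<Rightarrow> 'b) \<Rightarrow> real \<Rightarrow> real \<Rightarrow> 'b" where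
  "frac_integrand w f u t s = w (t - s) *\<^sub>R (u s - f)"

definition frac_integral :: "(real \<Rightarrow> real) \<Rightarrow> 'b::banach \<Rightarrow> (real \<Rightarrow> 'b) \<Rightarrow> real \<Rightarrow> 'b" where
  "frac_integral w f u t =
     banach_integral (restrict_space lborel {0<..<t}) (frac_integrand w f u t)"

definition strong_solution ::
    "real \<Rightarrow> (real \<Rightarrow> real) \<Rightarrow> (real \<Rightarrow> 'b \<Rightarrow>\<^sub>L 'b::banach) \<Rightarrow> 'b \<Rightarrow> (real \<Rightarrow> 'b) \<Rightarrow> bool" where
  "strong_solution \<kappa> w P f u \<longleftrightarrow>
     u 0 = f \<and>
     bounded (u ` {0<..}) \<and>
     (\<forall>t\<ge>0. u t \<in> generator_domain P) \<and>
     bounded ((\<lambda>t. generator P (u t)) ` {0..}) \<and>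
     continuous_on {0..} u \<and>
     continuous_on {0..} (\<lambda>t. generator P (u t)) \<and>
     (\<forall>t>0. banach_integrable (restrict_space lborel {0<..<t}) (frac_integrand w f u t) \<and>
        ((\<lambda>\<delta>. (1 / \<delta>) *\<^sub>R (\<kappa> *\<^sub>R (u (t + \<delta>) - u t) +
                 frac_integral w f u (t + \<delta>) - frac_integral w f u t))
          \<longlongrightarrow> generator P (u t)) (at 0))"

end

theory Submission
  imports Defs
begin

text \<open>
  Write \<open>T\<^sub>t\<close> for the inverse subordinator, \<open>\<Phi>\<close> for the Laplace exponent of \<open>S\<close>, \<open>w\<close> for the tail of the
  Levy measure and \<open>L\<close> for the generator.  The solution is \<open>u(t) = \<E>[P(T\<^sub>t) f]\<close>, and everything about it
  follows from one observation: if \<open>\<tau>\<close> is exponential with rate \<open>l\<close> and independent of \<open>S\<close>, then \<open>T\<^sub>\<tau>\<close> is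
  exponential with rate \<open>\<Phi>(l)\<close>, because \<open>\<P>(T\<^sub>\<tau> > a) = \<P>(S\<^sub>a < \<tau>) = \<E>[exp(-l S\<^sub>a)] = exp(-a \<Phi>(l))\<close>
  (\<open>exponential_time_distributed\<close>).  Hence the Laplace transform of \<open>u\<close> at \<open>l\<close> is \<open>\<Phi>(l)/l\<close> times the
  resolvent of \<open>L\<close> at \<open>\<Phi>(l)\<close>, applied to \<open>f\<close>.  On the other hand the transform of \<open>w\<close> is \<open>\<Phi>(l)/l - \<kappa>\<close>,
  so the operation \<open>z \<mapsto> \<kappa> z + w * z\<close> multiplies transforms by \<open>\<Phi>(l)/l\<close>.

  Existence.  The equation is proved in the integrated form
  \<open>\<kappa> (u(t) - f) + I\<^sub>t(u) = \<integral>\<^sub>0\<^sup>t L u(s) ds\<close>: after Laplace transformation it is the resolvent identity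
  \<open>R L f = c R f - f\<close> with \<open>c = \<Phi>(l)\<close>, and Laplace transforms determine continuous functions
  (\<open>laplace_unique\<close>).  It may be differentiated because \<open>L u(t) = \<E>[P(T\<^sub>t) L f]\<close> is continuous in \<open>t\<close>.  That
  continuity holds because \<open>t \<mapsto> T\<^sub>t\<close> has continuous paths, as \<open>S\<close> is strictly increasing when the
  Levy measure is infinite.

  Uniqueness.  Transforming the equation for an arbitrary solution \<open>v\<close> and testing it with a functional
  \<open>\<eta>\<close> gives a relation between the transforms of \<open>\<eta>(v)\<close> and \<open>\<eta>(L v)\<close>.  For \<open>\<eta> = \<psi> \<circ> R\<close> the resolvent
  identity removes the generator, and the transform of \<open>\<psi>(v)\<close> turns out to be the one already computed
  for \<open>u\<close> (\<open>strong_solution_laplace\<close>).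

  All identities between elements of the Banach space are tested with bounded functionals, so that
  Laplace transforms, convolutions and Fubini's theorem are only applied to real functions.  In a
  Banach space of functions the integrals over Borel sets against the measures in \<open>\<N>\<close> are bounded
  functionals and separate points.  Norm estimates are made on the Bochner integrals themselves.

  Probabilistic representation.  By the transform formula the law of \<open>T\<^sub>t\<close> is the same under every
  starting point, and \<open>T\<^sub>t\<close> is independent of \<open>X\<close>; so \<open>\<E>\<^sub>x[f(X(T\<^sub>t))]\<close> is the mixture of the functions
  \<open>\<E>\<^sub>x[f(X\<^sub>s)]\<close> over the law of \<open>T\<^sub>t\<close>.  Its identification with \<open>u(t)\<close> is an exchange of the integrals over
  \<open>s\<close> and \<open>x\<close>, carried out on the sets where \<open>\<E>\<^sub>x|f(X(T\<^sub>t))|\<close> is bounded (\<open>AE_rep_u\<close>).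
\<close>


section \<open>Bochner integrals without separability\<close>

text \<open>In a nonseparable space sums of Borel measurable functions may fail to be measurable.  A simple
  function, however, has finitely many values, and on each of its level sets the difference is a
  translate of \<open>f\<close>.\<close>
lemma borel_measurable_diff_simple_function:
  fixes f :: "'a \<Rightarrow> 'b::real_normed_vector"
  assumes f: "f \<in> borel_measurable M" and s: "simple_function M s"
  shows "(\<lambda>x. f x - s x) \<in> borel_measurable M"
proof (rule measurable_compose_countable'[where g = s and I = "s ` space M"])
  show "(\<lambda>x. f x - y) \<in> borel_measurable M" for y
    by (rule measurable_compose[OF f])
       (intro borel_measurable_continuous_onI continuous_intros)
  show "s \<in> measurable M (count_space (s ` space M))"
    using s by (simp add: simple_function_def measurable_count_space_eq2)
  show "countable (s ` space M)"
    using s by (simp add: simple_function_def countable_finite)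
qed

lemma simple_bochner_integral_dist_le:
  fixes s t :: "'a \<Rightarrow> 'b::real_normed_vector"
  assumes s: "Bochner_Integration.simple_bochner_integrable M s"
    and t: "Bochner_Integration.simple_bochner_integrable M t"
  shows "ennreal (norm (Bochner_Integration.simple_bochner_integral M s -
            Bochner_Integration.simple_bochner_integral M t))
         \<le> (\<integral>\<^sup>+x. ennreal (norm (s x - t x)) \<partial>M)"
proof -
  have d: "Bochner_Integration.simple_bochner_integrable M (\<lambda>x. s x - t x)"
    using simple_bochner_integrable_compose2[of "(-)", OF _ s t] by simp
  have n: "Bochner_Integration.simple_bochner_integrable M (\<lambda>x. norm (s x - t x))"
    using simple_bochner_integrable_compose2[of "\<lambda>a b. norm (a - b)", OF _ s t] by simp
  have "ennreal (norm (Bochner_Integration.simple_bochner_integral M (\<lambda>x. s x - t x)))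
     \<le> ennreal (Bochner_Integration.simple_bochner_integral M (\<lambda>x. norm (s x - t x)))"
    using simple_bochner_integral_norm_bound[OF d] by (rule ennreal_leI)
  also have "\<dots> = (\<integral>\<^sup>+x. ennreal (norm (s x - t x)) \<partial>M)"
    by (rule simple_bochner_integral_eq_nn_integral[OF n]) simp
  finally show ?thesis
    using simple_bochner_integral_diff[OF s t] by simp
qed

text \<open>The basic estimate for Bochner integrals: \<open>g = f\<close> gives uniqueness, \<open>g = 0\<close> the norm bound, and a
  varying \<open>g\<close> continuity in a parameter.  Measurability of \<open>norm (f x - g x)\<close> has to be assumed, since
  without separability it does not follow from that of \<open>f\<close> and \<open>g\<close>.\<close>
lemma has_banach_integral_dist_le:
  fixes f g :: "'a \<Rightarrow> 'b::real_normed_vector"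
  assumes f: "has_banach_integral M f y" and g: "has_banach_integral M g z"
    and fg: "(\<lambda>x. norm (f x - g x)) \<in> borel_measurable M"
  shows "ennreal (norm (y - z)) \<le> (\<integral>\<^sup>+x. ennreal (norm (f x - g x)) \<partial>M)"
proof -
  from f obtain s where fm: "f \<in> borel_measurable M"
    and s: "\<And>i. Bochner_Integration.simple_bochner_integrable M (s i)"
    and s0: "(\<lambda>i. \<integral>\<^sup>+x. ennreal (norm (f x - s i x)) \<partial>M) \<longlonglongrightarrow> 0"
    and sy: "(\<lambda>i. Bochner_Integration.simple_bochner_integral M (s i)) \<longlonglongrightarrow> y"
    unfolding has_banach_integral_def by blast
  from g obtain t where gm: "g \<in> borel_measurable M"
    and t: "\<And>i. Bochner_Integration.simple_bochner_integrable M (t i)"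
    and t0: "(\<lambda>i. \<integral>\<^sup>+x. ennreal (norm (g x - t i x)) \<partial>M) \<longlonglongrightarrow> 0"
    and tz: "(\<lambda>i. Bochner_Integration.simple_bochner_integral M (t i)) \<longlonglongrightarrow> z"
    unfolding has_banach_integral_def by blast
  let ?S = "\<lambda>i. Bochner_Integration.simple_bochner_integral M (s i)"
  let ?T = "\<lambda>i. Bochner_Integration.simple_bochner_integral M (t i)"
  let ?a = "\<lambda>i. \<integral>\<^sup>+x. ennreal (norm (f x - s i x)) \<partial>M"
  let ?b = "\<lambda>i. \<integral>\<^sup>+x. ennreal (norm (g x - t i x)) \<partial>M"
  let ?c = "\<integral>\<^sup>+x. ennreal (norm (f x - g x)) \<partial>M"
  have sf: "simple_function M (s i)" "simple_function M (t i)" for i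
    using s[of i] t[of i] by (auto elim: simple_bochner_integrable.cases)
  have "ennreal (norm (?S i - ?T i)) \<le> ?a i + (?c + ?b i)" for i
  proof -
    have m: "(\<lambda>x. ennreal (norm (f x - s i x))) \<in> borel_measurable M"
       "(\<lambda>x. ennreal (norm (g x - t i x))) \<in> borel_measurable M"
      using borel_measurable_diff_simple_function[OF fm sf(1)]
            borel_measurable_diff_simple_function[OF gm sf(2)]
      by (auto intro!: measurable_compose[OF _ measurable_ennreal]
            measurable_compose[OF _ borel_measurable_norm] borel_measurable_norm)
    have "ennreal (norm (?S i - ?T i)) \<le> (\<integral>\<^sup>+x. ennreal (norm (s i x - t i x)) \<partial>M)"
      by (rule simple_bochner_integral_dist_le[OF s t])
    also have "\<dots> \<le> (\<integral>\<^sup>+x. ennreal (norm (f x - s i x)) +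
                 (ennreal (norm (f x - g x)) + ennreal (norm (g x - t i x))) \<partial>M)"
    proof (rule nn_integral_mono)
      fix x
      have "norm (s i x - t i x) \<le> norm (f x - s i x) + (norm (f x - g x) + norm (g x - t i x))"
        using norm_triangle_ineq[of "s i x - f x" "f x - t i x"]
          norm_triangle_ineq[of "f x - g x" "g x - t i x"]
        by (simp add: norm_minus_commute)
      then show "ennreal (norm (s i x - t i x)) \<le> ennreal (norm (f x - s i x)) +
                 (ennreal (norm (f x - g x)) + ennreal (norm (g x - t i x)))"
        by (simp add: ennreal_plus[symmetric] del: ennreal_plus)
    qed
    also have "\<dots> = ?a i + (?c + ?b i)"
      using m fg by (subst nn_integral_add; (subst nn_integral_add)?) auto
    finally show ?thesis .
  qed
  moreover have "(\<lambda>i. ennreal (norm (?S i - ?T i))) \<longlonglongrightarrow> ennreal (norm (y - z))"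
    by (intro tendsto_intros sy tz)
  moreover have "(\<lambda>i. ?a i + (?c + ?b i)) \<longlonglongrightarrow> 0 + (?c + 0)"
    by (intro tendsto_add tendsto_const s0 t0)
  ultimately have "ennreal (norm (y - z)) \<le> 0 + (?c + 0)"
    by (blast intro: LIMSEQ_le)
  then show ?thesis by simp
qed

lemma has_banach_integral_unique:
  assumes "has_banach_integral M f y" "has_banach_integral M f z"
  shows "y = z"
  using has_banach_integral_dist_le[OF assms] by simp

lemma banach_integral_eq:
  "has_banach_integral M f y \<Longrightarrow> banach_integral M f = y"
  unfolding banach_integral_def by (blast intro: has_banach_integral_unique)

lemma has_banach_integral_bounded_linear:
  fixes f :: "'a \<Rightarrow> 'b::real_normed_vector" and T :: "'b \<Rightarrow> 'c::real_normed_vector"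
  assumes T: "bounded_linear T" and f: "has_banach_integral M f y"
  shows "has_banach_integral M (\<lambda>x. T (f x)) (T y)"
proof -
  interpret T: bounded_linear T by fact
  from f obtain s where fm: "f \<in> borel_measurable M"
    and s: "\<And>i. Bochner_Integration.simple_bochner_integrable M (s i)"
    and s0: "(\<lambda>i. \<integral>\<^sup>+x. ennreal (norm (f x - s i x)) \<partial>M) \<longlonglongrightarrow> 0"
    and sy: "(\<lambda>i. Bochner_Integration.simple_bochner_integral M (s i)) \<longlonglongrightarrow> y"
    unfolding has_banach_integral_def by blast
  obtain K where K: "0 < K" "\<And>x. norm (T x) \<le> norm x * K"
    using T.pos_bounded by blast
  have sf: "simple_function M (s i)" for i
    using s[of i] by (auto elim: simple_bochner_integrable.cases)
  have "(\<lambda>x. T (f x)) \<in> borel_measurable M"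
    by (rule measurable_compose[OF fm])
       (intro borel_measurable_continuous_onI T.continuous_on continuous_on_id)
  moreover have "Bochner_Integration.simple_bochner_integrable M (\<lambda>x. T (s i x))" for i
    using simple_bochner_integrable_compose2[of "\<lambda>a b. T a", OF _ s s] by (simp add: T.zero)
  moreover have "(\<lambda>i. Bochner_Integration.simple_bochner_integral M (\<lambda>x. T (s i x))) \<longlonglongrightarrow> T y"
    using T.tendsto[OF sy] simple_bochner_integral_linear[OF T.linear_axioms s] by simp
  moreover have "(\<lambda>i. \<integral>\<^sup>+x. ennreal (norm (T (f x) - T (s i x))) \<partial>M) \<longlonglongrightarrow> 0"
  proof (rule tendsto_sandwich[OF _ _ tendsto_const])
    show "\<forall>\<^sub>F i in sequentially. (\<integral>\<^sup>+x. ennreal (norm (T (f x) - T (s i x))) \<partial>M)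
        \<le> ennreal K * (\<integral>\<^sup>+x. ennreal (norm (f x - s i x)) \<partial>M)"
    proof (intro always_eventually allI)
      fix i
      have m: "(\<lambda>x. ennreal (norm (f x - s i x))) \<in> borel_measurable M"
        using borel_measurable_diff_simple_function[OF fm sf]
        by (auto intro!: measurable_compose[OF _ measurable_ennreal] borel_measurable_norm)
      have "(\<integral>\<^sup>+x. ennreal (norm (T (f x) - T (s i x))) \<partial>M)
         \<le> (\<integral>\<^sup>+x. ennreal K * ennreal (norm (f x - s i x)) \<partial>M)"
        using K by (intro nn_integral_mono)
          (simp add: T.diff[symmetric] ennreal_mult[symmetric] mult.commute)
      also have "\<dots> = ennreal K * (\<integral>\<^sup>+x. ennreal (norm (f x - s i x)) \<partial>M)"
        by (rule nn_integral_cmult[OF m])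
      finally show "(\<integral>\<^sup>+x. ennreal (norm (T (f x) - T (s i x))) \<partial>M)
        \<le> ennreal K * (\<integral>\<^sup>+x. ennreal (norm (f x - s i x)) \<partial>M)" .
    qed
    show "(\<lambda>i. ennreal K * (\<integral>\<^sup>+x. ennreal (norm (f x - s i x)) \<partial>M)) \<longlonglongrightarrow> 0"
      using ennreal_tendsto_cmult[OF _ s0, of "ennreal K"] by simp
  qed simp
  ultimately show ?thesis
    unfolding has_banach_integral_def by (intro conjI exI[of _ "\<lambda>i x. T (s i x)"]) auto
qed

lemma has_banach_integral_real:
  fixes f :: "'a \<Rightarrow> real"
  assumes "has_banach_integral M f y"
  shows "integrable M f" "integral\<^sup>L M f = y"
  using assms unfolding has_banach_integral_iff_has_bochner_integral
  by (auto simp: integrable.simps has_bochner_integral_integral_eq)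

text \<open>The Bochner integrands of this theory are a scalar density times a continuous curve at a real
  random variable.  Approximating the density and the real variable by simple functions produces
  vector-valued simple functions, whatever the size of the target space.\<close>
lemma banach_integrable_scaleR_continuous:
  fixes k :: "real \<Rightarrow> 'b::banach"
  assumes c: "integrable M c" and T[measurable]: "T \<in> borel_measurable M"
    and k: "continuous_on UNIV k" and B: "\<And>s. norm (k s) \<le> B"
  shows "banach_integrable M (\<lambda>x. c x *\<^sub>R k (T x))"
proof -
  have B0: "0 \<le> B" using B[of 0] norm_ge_zero order_trans by blast
  have [measurable]: "c \<in> borel_measurable M" using c by auto
  obtain C where C: "\<And>i. simple_function M (C i)" "\<And>x. x \<in> space M \<Longrightarrow> (\<lambda>i. C i x) \<longlonglongrightarrow> c x"
      "\<And>i x. x \<in> space M \<Longrightarrow> \<bar>C i x\<bar> \<le> 2 * \<bar>c x\<bar>"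
    using borel_measurable_implies_sequence_metric[of c M 0] that
    by (simp add: dist_real_def) blast
  obtain F where F: "\<And>i. simple_function M (F i)" "\<And>x. x \<in> space M \<Longrightarrow> (\<lambda>i. F i x) \<longlonglongrightarrow> T x"
    using borel_measurable_implies_sequence_metric[OF T, of 0] by blast
  let ?f = "\<lambda>x. c x *\<^sub>R k (T x)"
  define s where "s i x = C i x *\<^sub>R k (F i x)" for i x
  have fm: "?f \<in> borel_measurable M"
  proof -
    have "(\<lambda>x. (c x, T x)) \<in> M \<rightarrow>\<^sub>M borel" by measurable
    moreover have "continuous_on UNIV (\<lambda>p. fst p *\<^sub>R k (snd p))"
      by (intro continuous_intros continuous_on_compose2[OF k]) auto
    ultimately show ?thesis
      using measurable_compose[OF _ borel_measurable_continuous_onI] by fastforce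
  qed
  have sf: "simple_function M (s i)" for i
    unfolding s_def using C(1) F(1) by (rule simple_function_compose2[where h = "\<lambda>a b. a *\<^sub>R k b"])
  have nf: "norm (?f x) \<le> 2 * B * \<bar>c x\<bar>" for x
  proof -
    have "\<bar>c x\<bar> * norm (k (T x)) \<le> \<bar>c x\<bar> * B"
      using B by (intro mult_left_mono) auto
    moreover have "0 \<le> \<bar>c x\<bar> * B" using B0 by simp
    ultimately show ?thesis by (simp add: mult_ac)
  qed
  have ns: "norm (s i x) \<le> 2 * B * \<bar>c x\<bar>" if "x \<in> space M" for i x
  proof -
    have "\<bar>C i x\<bar> * norm (k (F i x)) \<le> (2 * \<bar>c x\<bar>) * B"
      using C(3)[OF that] B by (intro mult_mono) auto
    then show ?thesis by (simp add: s_def mult_ac)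
  qed
  have cfin: "integrable M (\<lambda>x. 2 * B * \<bar>c x\<bar>)" using c by auto
  have si: "Bochner_Integration.simple_bochner_integrable M (s i)" for i
  proof (rule simple_bochner_integrableI_bounded[OF sf])
    have "(\<integral>\<^sup>+x. ennreal (norm (s i x)) \<partial>M) \<le> (\<integral>\<^sup>+x. ennreal (2 * B * \<bar>c x\<bar>) \<partial>M)"
      by (intro nn_integral_mono ennreal_leI ns)
    also have "\<dots> < \<infinity>"
      using cfin B0 by (subst nn_integral_eq_integral) auto
    finally show "(\<integral>\<^sup>+x. ennreal (norm (s i x)) \<partial>M) < \<infinity>" .
  qed
  have dm: "(\<lambda>x. norm (?f x - s i x)) \<in> borel_measurable M" for i
    using measurable_compose[OF borel_measurable_diff_simple_function[OF fm sf[of i]]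
        borel_measurable_continuous_onI[of norm]]
    by (simp add: continuous_on_norm_id)
  have conv: "(\<lambda>i. \<integral>\<^sup>+x. ennreal (norm (?f x - s i x)) \<partial>M) \<longlonglongrightarrow> 0"
  proof -
    have "(\<lambda>i. \<integral>\<^sup>+x. ennreal (norm (0 - norm (?f x - s i x))) \<partial>M) \<longlonglongrightarrow> 0"
    proof (rule nn_integral_dominated_convergence_norm[where w = "\<lambda>x. 4 * B * \<bar>c x\<bar>"])
      show "AE x in M. norm (norm (?f x - s j x)) \<le> 4 * B * \<bar>c x\<bar>" for j
      proof (rule AE_I2)
        fix x assume "x \<in> space M"
        then show "norm (norm (?f x - s j x)) \<le> 4 * B * \<bar>c x\<bar>"
          using norm_triangle_ineq4[of "?f x" "s j x"] nf[of x] ns[of x j]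
          unfolding real_norm_def abs_norm_cancel by linarith
      qed
      have "(\<integral>\<^sup>+x. ennreal (4 * B * \<bar>c x\<bar>) \<partial>M) = ennreal (\<integral>x. 4 * B * \<bar>c x\<bar> \<partial>M)"
        using c B0 by (intro nn_integral_eq_integral) auto
      then show "(\<integral>\<^sup>+x. ennreal (4 * B * \<bar>c x\<bar>) \<partial>M) < \<infinity>" by simp
      show "AE x in M. (\<lambda>i. norm (?f x - s i x)) \<longlonglongrightarrow> 0"
      proof (rule AE_I2)
        fix x assume x: "x \<in> space M"
        have "isCont k (T x)" using k by (simp add: continuous_on_eq_continuous_at)
        then have "(\<lambda>i. k (F i x)) \<longlonglongrightarrow> k (T x)"
          using F(2)[OF x] isCont_tendsto_compose by blast
        then have "(\<lambda>i. ?f x - s i x) \<longlonglongrightarrow> ?f x - ?f x"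
          unfolding s_def by (intro tendsto_intros C(2)[OF x])
        then show "(\<lambda>i. norm (?f x - s i x)) \<longlonglongrightarrow> 0"
          by (auto dest: tendsto_norm)
      qed
    qed (use dm in auto)
    then show ?thesis by simp
  qed
  let ?S = "\<lambda>i. Bochner_Integration.simple_bochner_integral M (s i)"
  have dist: "ennreal (norm (?S i - ?S j)) \<le>
      (\<integral>\<^sup>+x. ennreal (norm (?f x - s i x)) \<partial>M) + (\<integral>\<^sup>+x. ennreal (norm (?f x - s j x)) \<partial>M)" for i j
  proof -
    have "ennreal (norm (?S i - ?S j)) \<le> (\<integral>\<^sup>+x. ennreal (norm (s i x - s j x)) \<partial>M)"
      by (rule simple_bochner_integral_dist_le[OF si si])
    also have "\<dots> \<le> (\<integral>\<^sup>+x. ennreal (norm (?f x - s i x)) + ennreal (norm (?f x - s j x)) \<partial>M)"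
    proof (rule nn_integral_mono)
      fix x
      show "ennreal (norm (s i x - s j x)) \<le> ennreal (norm (?f x - s i x)) + ennreal (norm (?f x - s j x))"
        using norm_triangle_ineq4[of "?f x - s j x" "?f x - s i x"]
        by (simp add: ennreal_plus[symmetric] add.commute del: ennreal_plus)
    qed
    also have "\<dots> = (\<integral>\<^sup>+x. ennreal (norm (?f x - s i x)) \<partial>M) + (\<integral>\<^sup>+x. ennreal (norm (?f x - s j x)) \<partial>M)"
      using dm by (intro nn_integral_add) auto
    finally show ?thesis .
  qed
  have "Cauchy ?S"
  proof (rule metric_CauchyI)
    fix e :: real assume e: "0 < e"
    then have "\<forall>\<^sub>F i in sequentially. (\<integral>\<^sup>+x. ennreal (norm (?f x - s i x)) \<partial>M) < ennreal (e/2)"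
      using conv by (intro order_tendstoD(2)[OF conv]) auto
    then obtain N where N: "\<And>i. N \<le> i \<Longrightarrow> (\<integral>\<^sup>+x. ennreal (norm (?f x - s i x)) \<partial>M) < ennreal (e/2)"
      by (auto simp: eventually_sequentially)
    show "\<exists>N. \<forall>m\<ge>N. \<forall>n\<ge>N. dist (?S m) (?S n) < e"
    proof (intro exI[of _ N] allI impI)
      fix m n assume "N \<le> m" "N \<le> n"
      then have "ennreal (norm (?S m - ?S n)) < ennreal (e/2) + ennreal (e/2)"
        using dist[of m n] add_strict_mono[OF N N] by (meson order_le_less_trans)
      then show "dist (?S m) (?S n) < e"
        using e by (simp add: dist_norm ennreal_plus[symmetric] ennreal_less_iff del: ennreal_plus)
    qed
  qed
  then obtain y where "?S \<longlonglongrightarrow> y" by (auto simp: Cauchy_convergent_iff convergent_def)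
  then show ?thesis
    unfolding banach_integrable_def has_banach_integral_def using fm si conv by blast
qed

lemma banach_integrable_integral:
  "banach_integrable M f \<Longrightarrow> has_banach_integral M f (banach_integral M f)"
  unfolding banach_integrable_def using banach_integral_eq by metis

lemma has_banach_integral_cong:
  assumes "\<And>x. x \<in> space M \<Longrightarrow> f x = g x"
  shows "has_banach_integral M f y \<longleftrightarrow> has_banach_integral M g y"
proof -
  have "f \<in> borel_measurable M \<longleftrightarrow> g \<in> borel_measurable M"
    using assms by (rule measurable_cong)
  moreover have "(\<integral>\<^sup>+x. ennreal (norm (f x - s x)) \<partial>M) = (\<integral>\<^sup>+x. ennreal (norm (g x - s x)) \<partial>M)" for s
    using assms by (intro nn_integral_cong) simp
  ultimately show ?thesis unfolding has_banach_integral_def by simp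
qed

lemma has_banach_integral_zero:
  "has_banach_integral M f y \<Longrightarrow> has_banach_integral M (\<lambda>_. 0 :: 'c::real_normed_vector) 0"
  using has_banach_integral_bounded_linear[OF bounded_linear_zero] by blast

section \<open>Laplace transforms on the half-line\<close>

definition laplace :: "real \<Rightarrow> (real \<Rightarrow> real) \<Rightarrow> real" where
  "laplace l q = (\<integral>t. exp (- l * t) * q t \<partial>lborel)"

definition laplace_integrable :: "real \<Rightarrow> (real \<Rightarrow> real) \<Rightarrow> bool" where
  "laplace_integrable l q \<longleftrightarrow> integrable lborel (\<lambda>t. exp (- l * t) * q t)"

text \<open>Functions on the half-line are extended by zero, so that Laplace transforms and convolutions are
  integrals over the whole line.\<close>
definition causal :: "(real \<Rightarrow> real) \<Rightarrow> real \<Rightarrow> real" where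
  "causal q t = indicator {0..} t * q t"

lemma causal_simps [simp]: "0 \<le> t \<Longrightarrow> causal q t = q t" "t < 0 \<Longrightarrow> causal q t = 0"
  by (auto simp: causal_def)

lemma causal_measurable:
  assumes "continuous_on {0..} q"
  shows "causal q \<in> borel_measurable borel"
  using borel_measurable_continuous_on_indicator[OF _ assms]
  by (simp add: causal_def[abs_def])

lemma laplace_one:
  assumes l: "0 < l"
  shows "laplace_integrable l (causal (\<lambda>_. 1))" and "laplace l (causal (\<lambda>_. 1)) = 1 / l"
proof -
  have "(\<integral>\<^sup>+t. ennreal (exp (- l * t)) * indicator {0..} t \<partial>lborel) = ennreal (0 - (- exp (- l * 0) / l))"
  proof (rule nn_integral_FTC_atLeast)
    show "DERIV (\<lambda>t. - exp (- l * t) / l) t :> exp (- l * t)" for t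
      using l by (auto intro!: derivative_eq_intros)
    have "filterlim (\<lambda>t. l * t) at_top at_top"
      using l by (intro filterlim_tendsto_pos_mult_at_top[OF tendsto_const] filterlim_ident)
    then have "((\<lambda>t. exp (- (l * t))) \<longlongrightarrow> 0) at_top"
      by (intro filterlim_compose[OF exp_at_bot]) (simp add: filterlim_uminus_at_bot)
    from tendsto_divide[OF tendsto_minus[OF this] tendsto_const[of l]] l
    show "((\<lambda>t. - exp (- l * t) / l) \<longlongrightarrow> 0) at_top" by simp
  qed auto
  then have *: "(\<integral>\<^sup>+t. ennreal (exp (- l * t) * causal (\<lambda>_. 1) t) \<partial>lborel) = ennreal (1 / l)"
    by (simp add: causal_def ennreal_mult ennreal_indicator)
  have m: "causal (\<lambda>_. 1) \<in> borel_measurable borel"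
    by (rule causal_measurable) auto
  have "has_bochner_integral lborel (\<lambda>t. exp (- l * t) * causal (\<lambda>_. 1) t) (1 / l)"
    using l m * by (intro has_bochner_integral_nn_integral) (auto simp: causal_def)
  then show "laplace_integrable l (causal (\<lambda>_. 1))" "laplace l (causal (\<lambda>_. 1)) = 1 / l"
    unfolding laplace_integrable_def laplace_def
    by (auto simp: has_bochner_integral_integral_eq integrable.simps)
qed

lemma laplace_const:
  assumes l: "0 < l"
  shows "laplace_integrable l (causal (\<lambda>_. c))" and "laplace l (causal (\<lambda>_. c)) = c / l"
proof -
  have eq: "exp (- l * t) * causal (\<lambda>_. c) t = exp (- l * t) * causal (\<lambda>_. 1) t * c" for t
    by (simp add: causal_def)
  show "laplace_integrable l (causal (\<lambda>_. c))" "laplace l (causal (\<lambda>_. c)) = c / l"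
    using laplace_one[OF l] unfolding laplace_integrable_def laplace_def eq
    by simp_all
qed

lemma laplace_integrable_bounded:
  assumes l: "0 < l" and q: "continuous_on {0..} q" and B: "\<And>t. 0 \<le> t \<Longrightarrow> \<bar>q t\<bar> \<le> B"
  shows "laplace_integrable l (causal q)"
  unfolding laplace_integrable_def
proof (rule Bochner_Integration.integrable_bound)
  show "integrable lborel (\<lambda>t. exp (- l * t) * causal (\<lambda>_. B) t)"
    using laplace_const(1)[OF l] by (simp add: laplace_integrable_def)
  show "(\<lambda>t. exp (- l * t) * causal q t) \<in> borel_measurable lborel"
    using causal_measurable[OF q] by measurable
  show "AE t in lborel. norm (exp (- l * t) * causal q t) \<le> norm (exp (- l * t) * causal (\<lambda>_. B) t)"
    using B by (intro AE_I2) (force simp: causal_def indicator_def abs_mult intro!: mult_left_mono)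
qed

lemma laplace_lincomb:
  assumes "laplace_integrable l q" "laplace_integrable l r"
  shows "laplace_integrable l (\<lambda>t. a * q t + b * r t)"
    and "laplace l (\<lambda>t. a * q t + b * r t) = a * laplace l q + b * laplace l r"
proof -
  have eq: "exp (- l * t) * (a * q t + b * r t) = a * (exp (- l * t) * q t) + b * (exp (- l * t) * r t)" for t
    by (simp add: algebra_simps)
  show "laplace_integrable l (\<lambda>t. a * q t + b * r t)"
    "laplace l (\<lambda>t. a * q t + b * r t) = a * laplace l q + b * laplace l r"
    using assms unfolding laplace_integrable_def laplace_def eq by simp_all
qed

lemma laplace_shift:
  assumes l: "0 < l" and q: "continuous_on {0..} q" and B: "\<And>t. 0 \<le> t \<Longrightarrow> \<bar>q t\<bar> \<le> B"
  shows "laplace l (causal (\<lambda>t. q t - c)) = laplace l (causal q) - c / l"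
proof -
  have "causal (\<lambda>t. q t - c) = (\<lambda>t. 1 * causal q t + (-1) * causal (\<lambda>_. c) t)"
    by (auto simp: causal_def fun_eq_iff algebra_simps)
  then show ?thesis
    using laplace_lincomb(2)[OF laplace_integrable_bounded[OF l q B] laplace_const(1)[OF l], of 1 "-1" c]
    by (simp add: laplace_const(2)[OF l])
qed

lemma integrable_mult_continuous_exp:
  fixes G h :: "real \<Rightarrow> real"
  assumes G: "integrable lborel G" and G0: "\<And>t. t < 0 \<Longrightarrow> G t = 0" and h: "continuous_on {0..1} h"
  shows "integrable lborel (\<lambda>t. G t * h (exp (- t)))"
proof -
  have "compact (h ` {0..1})" using h by (rule compact_continuous_image) simp
  then obtain B where B: "\<And>x. x \<in> {0..1} \<Longrightarrow> \<bar>h x\<bar> \<le> B"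
    using compact_imp_bounded bounded_iff by (metis image_eqI real_norm_def)
  have eq: "G t * h (exp (- t)) = G t * causal (\<lambda>t. h (exp (- t))) t" for t
    using G0[of t] by (cases "t < 0") auto
  have m: "causal (\<lambda>t. h (exp (- t))) \<in> borel_measurable borel"
    by (intro causal_measurable continuous_on_compose2[OF h] continuous_intros) auto
  show ?thesis
    unfolding eq
  proof (rule Bochner_Integration.integrable_bound)
    show "integrable lborel (\<lambda>t. B * G t)" using G by simp
    show "AE t in lborel. norm (G t * causal (\<lambda>t. h (exp (- t))) t) \<le> norm (B * G t)"
    proof (rule AE_I2)
      fix t
      show "norm (G t * causal (\<lambda>t. h (exp (- t))) t) \<le> norm (B * G t)"
      proof (cases "t < 0")
        case True
        then show ?thesis using G0[of t] by simp
      next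
        case False
        then have "\<bar>h (exp (- t))\<bar> * \<bar>G t\<bar> \<le> \<bar>B\<bar> * \<bar>G t\<bar>"
          using B[of "exp (- t)"] by (intro mult_right_mono) auto
        then show ?thesis using False by (simp add: abs_mult mult.commute)
      qed
    qed
  qed (use G m in measurable)
qed

text \<open>A transform that vanishes at the positive integers annihilates every polynomial in \<open>exp (- t)\<close>,
  hence, by Bernstein's approximation theorem, every continuous function of \<open>exp (- t)\<close>.\<close>
lemma laplace_zero_continuous_test:
  assumes int: "\<And>l. 0 < l \<Longrightarrow> laplace_integrable l (causal q)"
    and zero: "\<And>l. 0 < l \<Longrightarrow> laplace l (causal q) = 0"
    and h: "continuous_on {0..1} h"
  shows "(\<integral>t. exp (- t) * causal q t * h (exp (- t)) \<partial>lborel) = 0"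
proof -
  define G where "G t = exp (- t) * causal q t" for t
  have G: "integrable lborel G" using int[of 1] by (simp add: laplace_integrable_def G_def[abs_def])
  have G0: "t < 0 \<Longrightarrow> G t = 0" for t by (simp add: G_def)
  have I: "integrable lborel (\<lambda>t. G t * p (exp (- t)))" if "continuous_on {0..1} p" for p
    using that by (intro integrable_mult_continuous_exp G G0)
  have Ip: "integrable lborel (\<lambda>t. G t * (exp (- t) ^ k * (1 - exp (- t)) ^ m))" for k m
    by (rule I[of "\<lambda>x. x ^ k * (1 - x) ^ m"]) (intro continuous_intros)
  have pw: "(\<integral>t. G t * (exp (- t) ^ k * (1 - exp (- t)) ^ m) \<partial>lborel) = 0" for k m
  proof (induction m arbitrary: k)
    case 0
    have "G t * (exp (- t) ^ k * (1 - exp (- t)) ^ 0) = exp (- (real (Suc k)) * t) * causal q t" for t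
    proof -
      have "exp (- (real (Suc k)) * t) = exp (real (Suc k) * (- t))"
        by (simp only: mult_minus_left mult_minus_right)
      also have "\<dots> = exp (- t) ^ Suc k" by (rule exp_of_nat_mult)
      finally have e: "exp (- (real (Suc k)) * t) = exp (- t) ^ Suc k" .
      show ?thesis unfolding e by (simp add: G_def)
    qed
    then show ?case using zero[of "real (Suc k)"] by (simp add: laplace_def)
  next
    case (Suc m)
    have "(\<integral>t. G t * (exp (- t) ^ k * (1 - exp (- t)) ^ Suc m) \<partial>lborel) =
       (\<integral>t. G t * (exp (- t) ^ k * (1 - exp (- t)) ^ m) - G t * (exp (- t) ^ Suc k * (1 - exp (- t)) ^ m) \<partial>lborel)"
      by (intro Bochner_Integration.integral_cong) (auto simp: algebra_simps)
    also have "\<dots> = 0"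
      using Suc.IH[of k] Suc.IH[of "Suc k"]
      by (subst Bochner_Integration.integral_diff[OF Ip Ip]) simp
    finally show ?case .
  qed
  have bern: "(\<integral>t. G t * (\<Sum>k\<le>n. c k * Bernstein n k (exp (- t))) \<partial>lborel) = 0" for n c
  proof -
    have "(\<integral>t. G t * (\<Sum>k\<le>n. c k * Bernstein n k (exp (- t))) \<partial>lborel) =
      (\<integral>t. (\<Sum>k\<le>n. (c k * of_nat (n choose k)) * (G t * (exp (- t) ^ k * (1 - exp (- t)) ^ (n - k)))) \<partial>lborel)"
      by (intro Bochner_Integration.integral_cong) (auto simp: sum_distrib_left Bernstein_def mult_ac)
    also have "\<dots> = (\<Sum>k\<le>n. (c k * of_nat (n choose k)) * (\<integral>t. G t * (exp (- t) ^ k * (1 - exp (- t)) ^ (n - k)) \<partial>lborel))"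
      by (subst Bochner_Integration.integral_sum) (simp_all only: integrable_mult_right Ip integral_mult_right_zero)
    finally show ?thesis by (simp add: pw)
  qed
  have "\<bar>\<integral>t. G t * h (exp (- t)) \<partial>lborel\<bar> \<le> e * (\<integral>t. \<bar>G t\<bar> \<partial>lborel)" if e: "0 < e" for e
  proof -
    from Bernstein_Weierstrass[OF h e] obtain n where
      n: "\<And>x. x \<in> {0..1} \<Longrightarrow> \<bar>h x - (\<Sum>k\<le>n. h (k / n) * Bernstein n k x)\<bar> < e" by blast
    define p where "p x = (\<Sum>k\<le>n. h (k / n) * Bernstein n k x)" for x
    have pc: "continuous_on {0..1} p" unfolding p_def Bernstein_def by (intro continuous_intros)
    have "(\<integral>t. G t * h (exp (- t)) \<partial>lborel) = (\<integral>t. G t * h (exp (- t)) \<partial>lborel) - (\<integral>t. G t * p (exp (- t)) \<partial>lborel)"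
      using bern[where n = n and c = "\<lambda>k. h (k / n)"] by (simp add: p_def)
    also have "\<dots> = (\<integral>t. G t * h (exp (- t)) - G t * p (exp (- t)) \<partial>lborel)"
      using I[OF h] I[OF pc] by (subst Bochner_Integration.integral_diff) auto
    also have "\<bar>\<dots>\<bar> \<le> (\<integral>t. e * \<bar>G t\<bar> \<partial>lborel)"
    proof (rule order_trans[OF integral_abs_bound], rule integral_mono)
      show "integrable lborel (\<lambda>t. \<bar>G t * h (exp (- t)) - G t * p (exp (- t))\<bar>)"
        using I[OF h] I[OF pc] by auto
      show "integrable lborel (\<lambda>t. e * \<bar>G t\<bar>)" using G by auto
      fix t
      show "\<bar>G t * h (exp (- t)) - G t * p (exp (- t))\<bar> \<le> e * \<bar>G t\<bar>"
      proof (cases "t < 0")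
        case True
        then show ?thesis using G0[of t] by simp
      next
        case False
        then have "\<bar>G t\<bar> * \<bar>h (exp (- t)) - p (exp (- t))\<bar> \<le> \<bar>G t\<bar> * e"
          using n[of "exp (- t)"] unfolding p_def by (intro mult_left_mono) auto
        then show ?thesis
          unfolding right_diff_distrib[symmetric] abs_mult by (simp only: mult.commute)
      qed
    qed
    finally show ?thesis by simp
  qed
  note small = this
  have "\<bar>\<integral>t. G t * h (exp (- t)) \<partial>lborel\<bar> \<le> 0"
  proof (rule field_le_epsilon)
    fix e :: real assume "0 < e"
    define C where "C = (\<integral>t. \<bar>G t\<bar> \<partial>lborel)"
    have C: "0 \<le> C" by (simp add: C_def)
    have "e / (C + 1) * C \<le> e" using C \<open>0 < e\<close> by (simp add: field_simps)
    then show "\<bar>\<integral>t. G t * h (exp (- t)) \<partial>lborel\<bar> \<le> 0 + e"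
      using small[of "e / (C + 1)"] \<open>0 < e\<close> C unfolding C_def[symmetric] by auto
  qed
  then show ?thesis by (simp add: G_def)
qed

text \<open>The test function is \<open>q\<close> itself, cut off around \<open>t0\<close> and rewritten in the variable \<open>exp (- t)\<close>.  The
  integrand that results is continuous, nonnegative and has integral zero.\<close>
lemma laplace_zero_imp_zero:
  assumes q: "continuous_on {0..} q"
    and int: "\<And>l. 0 < l \<Longrightarrow> laplace_integrable l (causal q)"
    and zero: "\<And>l. 0 < l \<Longrightarrow> laplace l (causal q) = 0"
    and t0: "0 \<le> t0"
  shows "q t0 = 0"
proof -
  define H where "H t = max 0 (1 - \<bar>t - t0\<bar>) * q t" for t
  \<comment> \<open>The cutoff vanishes for \<open>t \<ge> t0 + 1\<close>, that is for \<open>exp (- t) \<le> c\<close>; there the logarithm is avoided.\<close>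
  define c where "c = exp (- (t0 + 1))"
  have c: "0 < c" "c \<le> 1" using t0 by (auto simp: c_def)
  define h where "h x = (if x \<le> c then 0 else H (- ln x))" for x
  have Hc: "continuous_on {0..} H" unfolding H_def by (intro continuous_intros q)
  have "continuous_on ({0..c} \<union> {c..1}) h"
    unfolding h_def
  proof (rule continuous_on_cases)
    have "- ln x \<in> {0..}" if "x \<in> {c..1}" for x
      using that c by (auto simp: ln_le_zero_iff)
    then show "continuous_on {c..1} (\<lambda>x. H (- ln x))"
      using c by (intro continuous_on_compose2[OF Hc] continuous_intros) auto
    have "H (- ln c) = 0" by (simp add: c_def H_def)
    then show "\<forall>x. x \<in> {0..c} \<and> \<not> x \<le> c \<or> x \<in> {c..1} \<and> x \<le> c \<longrightarrow> 0 = H (- ln x)"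
      by force
  qed auto
  moreover have "{0..c} \<union> {c..1} = {0..1}" using c by auto
  ultimately have h: "continuous_on {0..1} h" by simp
  have hH: "h (exp (- t)) = (if t0 + 1 \<le> t then 0 else H t)" for t by (simp add: h_def c_def)
  let ?f = "\<lambda>t. exp (- t) * q t * H t"
  have eq: "exp (- t) * causal q t * h (exp (- t)) = indicator {0..t0+1} t *\<^sub>R ?f t" for t
    by (auto simp: hH indicator_def causal_def H_def)
  have fc: "continuous_on {0..t0+1} ?f"
    by (intro continuous_intros continuous_on_subset[OF q] continuous_on_subset[OF Hc]) auto
  have "set_integrable lborel {0..t0+1} ?f"
    by (rule borel_integrable_atLeastAtMost') (rule fc)
  from has_integral_set_lebesgue[OF set_integrable_subset] set_borel_integral_eq_integral[OF this]
  have "?f integrable_on {0..t0+1}" "integral {0..t0+1} ?f = 0"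
    using laplace_zero_continuous_test[OF int zero h] by (simp_all add: eq set_lebesgue_integral_def)
  then have 0: "(?f has_integral 0) (cbox 0 (t0+1))"
    by (simp add: has_integral_iff)
  have "?f t0 = 0"
  proof (rule has_integral_0_cbox_imp_0[OF _ _ 0])
    fix x
    have e: "?f x = exp (- x) * max 0 (1 - \<bar>x - t0\<bar>) * (q x * q x)"
      by (simp add: H_def)
    show "0 \<le> ?f x" unfolding e by (rule mult_nonneg_nonneg[OF _ zero_le_square]) simp
  next
  qed (use fc t0 in auto)
  then show ?thesis by (simp add: H_def)
qed

lemma laplace_unique:
  assumes "continuous_on {0..} q" "continuous_on {0..} r"
    and "\<And>l. 0 < l \<Longrightarrow> laplace_integrable l (causal q)"
    and "\<And>l. 0 < l \<Longrightarrow> laplace_integrable l (causal r)"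
    and "\<And>l. 0 < l \<Longrightarrow> laplace l (causal q) = laplace l (causal r)"
    and "0 \<le> t"
  shows "q t = r t"
proof -
  have eq: "causal (\<lambda>t. q t - r t) = (\<lambda>t. 1 * causal q t + (-1) * causal r t)"
    by (auto simp: causal_def algebra_simps)
  have "q t - r t = 0"
    using laplace_lincomb[of _ "causal q" "causal r" 1 "-1"] assms
    by (intro laplace_zero_imp_zero[of "\<lambda>t. q t - r t"]) (auto simp: eq intro!: continuous_intros)
  then show ?thesis by simp
qed

definition fun_convolution :: "(real \<Rightarrow> real) \<Rightarrow> (real \<Rightarrow> real) \<Rightarrow> real \<Rightarrow> real" where
  "fun_convolution a b t = (\<integral>s. a (t - s) * b s \<partial>lborel)"

lemma integral_convolution:
  assumes a: "integrable lborel a" and b: "integrable lborel b"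
  shows "integrable lborel (fun_convolution a b)"
    and "(\<integral>t. fun_convolution a b t \<partial>lborel) = (\<integral>t. a t \<partial>lborel) * (\<integral>t. b t \<partial>lborel)"
proof -
  have [measurable]: "a \<in> borel_measurable borel" "b \<in> borel_measurable borel"
    using a b by auto
  have shift: "(\<integral>t. a (t - s) \<partial>lborel) = (\<integral>t. a t \<partial>lborel)"
      "(\<integral>t. \<bar>a (t - s)\<bar> \<partial>lborel) = (\<integral>t. \<bar>a t\<bar> \<partial>lborel)"
      "integrable lborel (\<lambda>t. a (t - s))" for s
    using lborel_integral_real_affine[of 1 a "-s"] lborel_integral_real_affine[of 1 "\<lambda>t. \<bar>a t\<bar>" "-s"]
      lborel_integrable_real_affine[OF a, of 1 "-s"] by (simp_all add: algebra_simps)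
  have I: "integrable (lborel \<Otimes>\<^sub>M lborel) (\<lambda>(s, t). a (t - s) * b s)"
  proof (rule lborel_pair.Fubini_integrable)
    show "integrable lborel (\<lambda>s. \<integral>t. norm (case (s, t) of (s, t) \<Rightarrow> a (t - s) * b s) \<partial>lborel)"
      using b by (simp add: abs_mult shift)
  qed (auto simp: shift)
  show "integrable lborel (fun_convolution a b)"
    using lborel_pair.integrable_snd[OF I] by (simp add: fun_convolution_def[abs_def])
  have "(\<integral>t. fun_convolution a b t \<partial>lborel) = (\<integral>s. (\<integral>t. a (t - s) * b s \<partial>lborel) \<partial>lborel)"
    using lborel_pair.Fubini_integral[OF I] by (simp add: fun_convolution_def)
  also have "\<dots> = (\<integral>t. a t \<partial>lborel) * (\<integral>t. b t \<partial>lborel)"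
    by (simp add: shift)
  finally show "(\<integral>t. fun_convolution a b t \<partial>lborel) = (\<integral>t. a t \<partial>lborel) * (\<integral>t. b t \<partial>lborel)" .
qed

lemma laplace_convolution:
  assumes "laplace_integrable l a" "laplace_integrable l b"
  shows "laplace_integrable l (fun_convolution a b)"
    and "laplace l (fun_convolution a b) = laplace l a * laplace l b"
proof -
  have eq: "exp (- l * t) * fun_convolution a b t =
     fun_convolution (\<lambda>t. exp (- l * t) * a t) (\<lambda>t. exp (- l * t) * b t) t" for t
  proof -
    have "exp (- l * t) * fun_convolution a b t = (\<integral>s. exp (- l * t) * (a (t - s) * b s) \<partial>lborel)"
      by (simp add: fun_convolution_def)
    also have "\<dots> = fun_convolution (\<lambda>t. exp (- l * t) * a t) (\<lambda>t. exp (- l * t) * b t) t"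
      unfolding fun_convolution_def
    proof (intro Bochner_Integration.integral_cong refl)
      fix s
      have "exp (- l * t) = exp (- l * (t - s)) * exp (- l * s)"
        by (simp add: exp_add[symmetric] algebra_simps)
      then show "exp (- l * t) * (a (t - s) * b s) = exp (- l * (t - s)) * a (t - s) * (exp (- l * s) * b s)"
        by simp
    qed
    finally show ?thesis .
  qed
  show "laplace_integrable l (fun_convolution a b)"
    "laplace l (fun_convolution a b) = laplace l a * laplace l b"
    using integral_convolution[OF assms[unfolded laplace_integrable_def]]
    unfolding laplace_integrable_def laplace_def eq by auto
qed

lemma fun_convolution_commute: "fun_convolution a b t = fun_convolution b a t"
  using lborel_integral_real_affine[of "-1" "\<lambda>s. a (t - s) * b s" t]
  by (simp add: fun_convolution_def mult.commute)

text \<open>Because \<open>b 0 = 0\<close>, the extension of \<open>b\<close> by zero is continuous on the whole line; its translates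
  converge pointwise, and dominated convergence applies.\<close>
lemma continuous_convolution:
  assumes a: "laplace_integrable 1 a" and a0: "\<And>t. t < 0 \<Longrightarrow> a t = 0"
    and b: "continuous_on {0..} b" and b0: "b 0 = 0" and B: "\<And>t. 0 \<le> t \<Longrightarrow> \<bar>b t\<bar> \<le> B"
  shows "continuous_on UNIV (fun_convolution a (causal b))"
proof -
  have B0: "0 \<le> B" using B[of 0] by simp
  have "continuous_on ({..0} \<union> {0..}) (\<lambda>t. if t \<le> 0 then 0 else b t)"
  proof (rule continuous_on_cases)
    have "x = 0" if "x \<in> {..0} \<and> \<not> x \<le> 0 \<or> x \<in> {0..} \<and> x \<le> 0" for x :: real
      using that by auto
    then show "\<forall>x. x \<in> {..0} \<and> \<not> x \<le> 0 \<or> x \<in> {0..} \<and> x \<le> 0 \<longrightarrow> 0 = b x"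
      using b0 by metis
  qed (use b in auto)
  moreover have "causal b = (\<lambda>t. if t \<le> 0 then 0 else b t)"
  proof
    show "causal b t = (if t \<le> 0 then 0 else b t)" for t
      using b0 by (cases "t = 0") (auto simp: causal_def indicator_def)
  qed
  moreover have "{..0} \<union> {0..} = (UNIV :: real set)" by auto
  ultimately have bc: "continuous_on UNIV (causal b)" by simp
  then have [measurable]: "causal b \<in> borel_measurable borel" by (rule borel_measurable_continuous_onI)
  have "(\<lambda>t. exp (1 * t) * (exp (- 1 * t) * a t)) \<in> borel_measurable borel"
    using a[unfolded laplace_integrable_def, THEN borel_measurable_integrable] by simp
  then have [measurable]: "a \<in> borel_measurable borel"
    by (simp add: mult.assoc[symmetric] exp_add[symmetric])
  have eq: "fun_convolution a (causal b) t = (\<integral>s. causal b (t - s) * a s \<partial>lborel)" for t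
    using fun_convolution_commute[of a "causal b" t] by (simp add: fun_convolution_def)
  show ?thesis
  proof (rule continuous_on_sequentiallyI)
    fix x t assume xt: "x \<longlonglongrightarrow> (t::real)"
    obtain T where T: "\<And>n. \<bar>x n\<bar> \<le> T"
      using convergent_imp_Bseq[OF convergentI[OF xt]] by (auto simp: Bseq_def)
    show "(\<lambda>n. fun_convolution a (causal b) (x n)) \<longlonglongrightarrow> fun_convolution a (causal b) t"
      unfolding eq
    \<comment> \<open>For \<open>s \<le> x n \<le> T\<close> the factor \<open>exp T\<close> compensates the weight \<open>exp (- s)\<close>; for larger \<open>s\<close> the integrand is 0.\<close>
    proof (rule integral_dominated_convergence[where w = "\<lambda>s. B * exp T * \<bar>exp (- 1 * s) * a s\<bar>"])
      show "integrable lborel (\<lambda>s. B * exp T * \<bar>exp (- 1 * s) * a s\<bar>)"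
        using a unfolding laplace_integrable_def by (intro integrable_mult_right integrable_abs)
      show "AE s in lborel. (\<lambda>n. causal b (x n - s) * a s) \<longlonglongrightarrow> causal b (t - s) * a s"
      proof (rule AE_I2)
        fix s
        have "(\<lambda>n. causal b (x n - s)) \<longlonglongrightarrow> causal b (t - s)"
          by (rule continuous_on_tendsto_compose[OF bc]) (auto intro!: tendsto_intros xt)
        then show "(\<lambda>n. causal b (x n - s) * a s) \<longlonglongrightarrow> causal b (t - s) * a s"
          by (rule tendsto_mult[OF _ tendsto_const])
      qed
      show "AE s in lborel. norm (causal b (x n - s) * a s) \<le> B * exp T * \<bar>exp (- 1 * s) * a s\<bar>" for n
      proof (rule AE_I2)
        fix s
        show "norm (causal b (x n - s) * a s) \<le> B * exp T * \<bar>exp (- 1 * s) * a s\<bar>"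
        proof (cases "s \<le> x n")
          case True
          have "1 \<le> exp (T - s)" using True T[of n] by simp
          then have "B * 1 * \<bar>a s\<bar> \<le> B * exp (T - s) * \<bar>a s\<bar>"
            using B0 by (intro mult_right_mono mult_left_mono) auto
          moreover have "\<bar>causal b (x n - s)\<bar> * \<bar>a s\<bar> \<le> B * \<bar>a s\<bar>"
            using True B[of "x n - s"] by (intro mult_right_mono) auto
          moreover have "B * exp T * \<bar>exp (- 1 * s) * a s\<bar> = B * exp (T - s) * \<bar>a s\<bar>"
            by (simp add: abs_mult exp_diff exp_minus field_simps)
          ultimately show ?thesis
            unfolding real_norm_def abs_mult[of "causal b (x n - s)"] by linarith
        next
          case False
          then show ?thesis using B0 by simp
        qed
      qed
    qed measurable
  qed
qed

lemma convolution_one_eq_integral: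
  assumes q: "continuous_on {0..} q"
  shows "fun_convolution (causal (\<lambda>_. 1)) (causal q) = causal (\<lambda>t. integral {0..t} q)"
proof
  fix t
  have eq: "causal (\<lambda>_. 1) (t - s) * causal q s = indicator {0..t} s *\<^sub>R q s" for s
    by (auto simp: causal_def indicator_def)
  show "fun_convolution (causal (\<lambda>_. 1)) (causal q) t = causal (\<lambda>t. integral {0..t} q) t"
  proof (cases "t < 0")
    case True
    then show ?thesis by (simp add: fun_convolution_def eq)
  next
    case False
    have "set_integrable lborel {0..t} q"
      by (intro borel_integrable_atLeastAtMost' continuous_on_subset[OF q]) auto
    from set_borel_integral_eq_integral(2)[OF this] False show ?thesis
      by (simp add: fun_convolution_def eq set_lebesgue_integral_def)
  qed
qed

lemma continuous_on_integral_atLeast: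
  fixes q :: "real \<Rightarrow> real"
  assumes q: "continuous_on {0..} q"
  shows "continuous_on {0..} (\<lambda>t. integral {0..t} q)"
  unfolding continuous_on_eq_continuous_within
proof
  fix t :: real assume t: "t \<in> {0..}"
  have "continuous_on {0..t + 1} (\<lambda>t. integral {0..t} q)"
    by (intro indefinite_integral_continuous_1 integrable_continuous_real continuous_on_subset[OF q]) auto
  then have "continuous (at t within {0..t + 1}) (\<lambda>t. integral {0..t} q)"
    using t by (auto simp: continuous_on_eq_continuous_within)
  moreover have "at t within {0..} = at t within {0..t + 1}"
    by (rule at_within_nhd[of t "{..<t + 1}"]) auto
  ultimately show "continuous (at t within {0..}) (\<lambda>t. integral {0..t} q)" by simp
qed

lemma laplace_integral:
  assumes l: "0 < l" and q: "continuous_on {0..} q" and i: "laplace_integrable l (causal q)"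
  shows "laplace_integrable l (causal (\<lambda>t. integral {0..t} q))"
    and "laplace l (causal (\<lambda>t. integral {0..t} q)) = laplace l (causal q) / l"
  using laplace_convolution[OF laplace_one(1)[OF l] i] laplace_one(2)[OF l]
  by (simp_all add: convolution_one_eq_integral[OF q])

section \<open>Bounded strongly continuous semigroups\<close>

lemma has_vector_derivative_iff_difference_quotient:
  fixes f :: "real \<Rightarrow> 'b::real_normed_vector"
  shows "(f has_vector_derivative y) (at s within A) \<longleftrightarrow>
    ((\<lambda>t. (f t - f s) /\<^sub>R (t - s)) \<longlongrightarrow> y) (at s within A)"
proof -
  have eq: "\<forall>\<^sub>F t in at s within A. norm (f t - f s - (t - s) *\<^sub>R y) / norm (t - s)
      = norm ((f t - f s) /\<^sub>R (t - s) - y)"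
    unfolding eventually_at_filter
  proof (intro always_eventually allI impI)
    fix t assume "t \<noteq> s"
    then have "(f t - f s) /\<^sub>R (t - s) - y = (f t - f s - (t - s) *\<^sub>R y) /\<^sub>R (t - s)"
      by (simp add: scaleR_diff_right)
    then show "norm (f t - f s - (t - s) *\<^sub>R y) / norm (t - s) = norm ((f t - f s) /\<^sub>R (t - s) - y)"
      by (simp add: divide_inverse mult.commute)
  qed
  show ?thesis
    unfolding has_vector_derivative_def has_derivative_iff_norm tendsto_cong[OF eq]
      tendsto_norm_zero_iff LIM_zero_iff
    by (simp add: bounded_linear_scaleR_left)
qed

locale bounded_semigroup =
  fixes P :: "real \<Rightarrow> 'b \<Rightarrow>\<^sub>L 'b::banach"
  assumes sg: "strongly_continuous_semigroup P" and ub: "uniformly_bounded P"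
begin

lemma P_zero [simp]: "P 0 x = x"
  using sg by (simp add: strongly_continuous_semigroup_def)

lemma P_add: "0 \<le> s \<Longrightarrow> 0 \<le> t \<Longrightarrow> P (s + t) x = P s (P t x)"
  using sg by (simp add: strongly_continuous_semigroup_def)

text \<open>At least 1, so that it also bounds the norm of \<open>P 0\<close>.\<close>
definition K :: real where "K = max 1 (SUP t\<in>{0<..}. norm (P t))"

lemma K_ge_1: "1 \<le> K" by (simp add: K_def)

lemma norm_P: assumes "0 \<le> t" shows "norm (P t x) \<le> K * norm x"
proof (cases "t = 0")
  case True
  then show ?thesis using mult_right_mono[OF K_ge_1, of "norm x"] by simp
next
  case False
  then have "norm (P t) \<le> (SUP t\<in>{0<..}. norm (P t))"
    using assms ub unfolding uniformly_bounded_def by (intro cSUP_upper) auto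
  also have "\<dots> \<le> K" by (simp add: K_def)
  finally have "norm (P t) * norm x \<le> K * norm x" by (rule mult_right_mono) simp
  then show ?thesis using norm_blinfun[of "P t" x] by linarith
qed

lemma norm_P_diff:
  assumes "0 \<le> s" "0 \<le> t"
  shows "norm (P t x - P s x) \<le> K * norm (P \<bar>t - s\<bar> x - x)"
proof -
  have *: "norm (P (a + h) x - P a x) \<le> K * norm (P h x - x)" if "0 \<le> a" "0 \<le> h" for a h
    using norm_P[OF that(1), of "P h x - x"] P_add[OF that] by (simp add: blinfun.diff_right)
  show ?thesis
    using *[of s "t - s"] *[of t "s - t"] assms
    by (cases "s \<le> t") (auto simp: norm_minus_commute)
qed

lemma tendsto_P_zero: "((\<lambda>t. P t x) \<longlongrightarrow> x) (at_right 0)"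
  using sg by (simp add: strongly_continuous_semigroup_def)


lemma continuous_P: "continuous_on {0..} (\<lambda>t. P t x)"
  unfolding continuous_on_def
proof
  fix s :: real assume s: "s \<in> {0..}"
  have abs: "filterlim (\<lambda>t. \<bar>t - s\<bar>) (at_right 0) (at s within {0..})"
    unfolding filterlim_at
    by (auto simp: eventually_at_filter intro!: tendsto_eq_intros)
  have "((\<lambda>t. K * norm (P \<bar>t - s\<bar> x - x)) \<longlongrightarrow> K * norm (x - x)) (at s within {0..})"
    by (intro tendsto_intros filterlim_compose[OF tendsto_P_zero abs])
  then have lim: "((\<lambda>t. K * norm (P \<bar>t - s\<bar> x - x)) \<longlongrightarrow> 0) (at s within {0..})" by simp
  have "((\<lambda>t. P t x - P s x) \<longlongrightarrow> 0) (at s within {0..})"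
  proof (rule Lim_null_comparison[OF _ lim])
    show "\<forall>\<^sub>F t in at s within {0..}. norm (P t x - P s x) \<le> K * norm (P \<bar>t - s\<bar> x - x)"
      using s norm_P_diff unfolding eventually_at_filter by (intro always_eventually) auto
  qed
  then show "((\<lambda>t. P t x) \<longlongrightarrow> P s x) (at s within {0..})"
    by (simp add: LIM_zero_iff)
qed

lemma continuous_functional_P:
  "bounded_linear \<psi> \<Longrightarrow> continuous_on {0..} (\<lambda>t. \<psi> (P t x))"
  by (rule bounded_linear.continuous_on[OF _ continuous_P])

lemma tendsto_generator:
  assumes "x \<in> generator_domain P"
  shows "((\<lambda>h. (P h x - x) /\<^sub>R h) \<longlongrightarrow> generator P x) (at_right 0)"
proof -
  obtain y where y: "((\<lambda>h. (P h x - x) /\<^sub>R h) \<longlongrightarrow> y) (at_right 0)"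
    using assms unfolding generator_domain_def by blast
  then have "generator P x = y"
    unfolding generator_def by (intro tendsto_Lim) auto
  then show ?thesis using y by simp
qed

lemma generatorI:
  assumes "((\<lambda>h. (P h x - x) /\<^sub>R h) \<longlongrightarrow> y) (at_right 0)"
  shows "x \<in> generator_domain P" "generator P x = y"
  using assms unfolding generator_def generator_domain_def by (auto intro!: tendsto_Lim)

text \<open>For \<open>t\<close> on either side of \<open>s\<close> the difference quotient is \<open>P (min t s)\<close> applied to the quotient of
  \<open>x\<close> at step \<open>\<bar>t - s\<bar>\<close>; uniform boundedness and strong continuity give the limit.\<close>
lemma P_has_vector_derivative:
  assumes x: "x \<in> generator_domain P" and s: "0 \<le> s"
  shows "((\<lambda>t. P t x) has_vector_derivative P s (generator P x)) (at s within {0..})"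
proof -
  let ?F = "at s within {0..}" and ?L = "generator P x"
  define D where "D h = (P h x - x) /\<^sub>R h" for h
  have abs: "filterlim (\<lambda>t. \<bar>t - s\<bar>) (at_right 0) ?F"
    unfolding filterlim_at
    by (auto simp: eventually_at_filter intro!: tendsto_eq_intros)
  have nn: "\<forall>\<^sub>F t in ?F. 0 \<le> t \<and> t \<noteq> s"
    by (auto simp: eventually_at_filter)
  have "((\<lambda>t. K * norm (D \<bar>t - s\<bar> - ?L)) \<longlongrightarrow> K * norm (?L - ?L)) ?F"
    unfolding D_def by (intro tendsto_intros filterlim_compose[OF tendsto_generator[OF x] abs])
  then have lim: "((\<lambda>t. K * norm (D \<bar>t - s\<bar> - ?L)) \<longlongrightarrow> 0) ?F" by simp
  have 1: "((\<lambda>t. P (min t s) (D \<bar>t - s\<bar> - ?L)) \<longlongrightarrow> 0) ?F"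
    by (rule Lim_null_comparison[OF _ lim])
       (use nn s norm_P in \<open>auto elim!: eventually_mono\<close>)
  have "((\<lambda>t. P t ?L) \<longlongrightarrow> P s ?L) ?F"
    using continuous_P s by (simp add: continuous_on_def)
  have 2: "((\<lambda>t. P (min t s) ?L) \<longlongrightarrow> P s ?L) ?F"
  proof (rule continuous_on_tendsto_compose[OF continuous_P])
    have "((\<lambda>t. min t s) \<longlongrightarrow> min s s) ?F" by (intro tendsto_intros)
    then show "((\<lambda>t. min t s) \<longlongrightarrow> s) ?F" by simp
  qed (use nn s in \<open>auto elim!: eventually_mono\<close>)
  have "((\<lambda>t. P (min t s) (D \<bar>t - s\<bar>)) \<longlongrightarrow> P s ?L) ?F"
    using tendsto_add[OF 1 2] by (simp add: blinfun.diff_right)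
  moreover have "\<forall>\<^sub>F t in ?F. P (min t s) (D \<bar>t - s\<bar>) = (P t x - P s x) /\<^sub>R (t - s)"
    using nn
  proof eventually_elim
    case (elim t)
    show ?case
    proof (cases "t < s")
      case True
      have "P t (D (s - t)) = (P s x - P t x) /\<^sub>R (s - t)"
        using P_add[of t "s - t" x] elim True
        by (simp add: D_def blinfun.scaleR_right blinfun.diff_right)
      also have "\<dots> = (P t x - P s x) /\<^sub>R (t - s)"
        using inverse_minus_eq[of "s - t"] by (simp add: scaleR_diff_right)
      finally show ?thesis using True by simp
    next
      case False
      then show ?thesis
        using P_add[of s "t - s" x] elim s
        by (simp add: D_def blinfun.scaleR_right blinfun.diff_right)
    qed
  qed
  ultimately have "((\<lambda>t. (P t x - P s x) /\<^sub>R (t - s)) \<longlongrightarrow> P s ?L) ?F"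
    by (rule Lim_transform_eventually)
  then show ?thesis
    by (simp only: has_vector_derivative_iff_difference_quotient)
qed

text \<open>The composition of \<open>\<psi>\<close> with the resolvent of the generator at \<open>c\<close>, the latter being the Laplace
  transform of the semigroup.\<close>
definition resolvent_functional :: "real \<Rightarrow> ('b \<Rightarrow> real) \<Rightarrow> 'b \<Rightarrow> real" where
  "resolvent_functional c \<psi> x = laplace c (causal (\<lambda>s. \<psi> (P s x)))"

text \<open>One constant serves all \<open>x\<close>, which is what makes resolvent functionals bounded.\<close>
lemma functional_P_bound:
  assumes "bounded_linear \<psi>"
  shows "\<exists>B\<ge>0. \<forall>s x. 0 \<le> s \<longrightarrow> \<bar>\<psi> (P s x)\<bar> \<le> B * norm x"
proof -
  obtain C where C: "0 < C" "\<And>x. norm (\<psi> x) \<le> norm x * C"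
    using bounded_linear.pos_bounded[OF assms] by blast
  show ?thesis
  proof (intro exI[of _ "K * C"] conjI allI impI)
    show "0 \<le> K * C" using K_ge_1 C by simp
  next
    fix s x assume "0 \<le> (s::real)"
    then have "norm (P s x) * C \<le> (K * norm x) * C"
      using C by (intro mult_right_mono norm_P) auto
    then show "\<bar>\<psi> (P s x)\<bar> \<le> K * C * norm x"
      using C(2)[of "P s x"] by (simp add: mult_ac)
  qed
qed

lemma laplace_integrable_functional_P:
  assumes "bounded_linear \<psi>" "0 < c"
  shows "laplace_integrable c (causal (\<lambda>s. \<psi> (P s x)))"
proof -
  obtain B where B: "0 \<le> B" "\<And>s x. 0 \<le> s \<Longrightarrow> \<bar>\<psi> (P s x)\<bar> \<le> B * norm x"
    using functional_P_bound[OF assms(1)] by auto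
  show ?thesis
    by (rule laplace_integrable_bounded[OF assms(2) continuous_functional_P[OF assms(1)] B(2)])
qed

lemma bounded_linear_resolvent_functional:
  assumes \<psi>: "bounded_linear \<psi>" and c: "0 < c"
  shows "bounded_linear (resolvent_functional c \<psi>)"
proof -
  interpret \<psi>: bounded_linear \<psi> by fact
  note I = laplace_integrable_functional_P[OF \<psi> c]
  obtain B where B: "0 \<le> B" "\<And>s x. 0 \<le> s \<Longrightarrow> \<bar>\<psi> (P s x)\<bar> \<le> B * norm x"
    using functional_P_bound[OF \<psi>] by auto
  show ?thesis
  proof (rule bounded_linear_intro)
    show "resolvent_functional c \<psi> (x + y) = resolvent_functional c \<psi> x + resolvent_functional c \<psi> y" for x y
    proof -
      have "causal (\<lambda>s. \<psi> (P s (x + y))) = (\<lambda>s. 1 * causal (\<lambda>s. \<psi> (P s x)) s + 1 * causal (\<lambda>s. \<psi> (P s y)) s)"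
        by (auto simp: causal_def blinfun.add_right \<psi>.add algebra_simps)
      then show ?thesis
        unfolding resolvent_functional_def using laplace_lincomb(2)[OF I I, of 1 x 1 y] by simp
    qed
    show "resolvent_functional c \<psi> (r *\<^sub>R x) = r *\<^sub>R resolvent_functional c \<psi> x" for r x
    proof -
      have "causal (\<lambda>s. \<psi> (P s (r *\<^sub>R x))) = (\<lambda>s. r * causal (\<lambda>s. \<psi> (P s x)) s + 0 * causal (\<lambda>s. \<psi> (P s x)) s)"
        by (auto simp: causal_def blinfun.scaleR_right \<psi>.scaleR)
      then show ?thesis
        unfolding resolvent_functional_def using laplace_lincomb(2)[OF I I, of r x 0 x] by simp
    qed
    fix x
    have "norm (resolvent_functional c \<psi> x) \<le> laplace c (causal (\<lambda>_. B * norm x))"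
      unfolding resolvent_functional_def laplace_def real_norm_def
    proof (rule order_trans[OF integral_abs_bound], rule integral_mono)
      show "integrable lborel (\<lambda>t. \<bar>exp (- c * t) * causal (\<lambda>s. \<psi> (P s x)) t\<bar>)"
        using I[of x] unfolding laplace_integrable_def by (rule integrable_abs)
      show "integrable lborel (\<lambda>t. exp (- c * t) * causal (\<lambda>_. B * norm x) t)"
        using laplace_const(1)[OF c] unfolding laplace_integrable_def .
      show "\<bar>exp (- c * t) * causal (\<lambda>s. \<psi> (P s x)) t\<bar> \<le> exp (- c * t) * causal (\<lambda>_. B * norm x) t" for t
        using B(2)[of t x] by (cases "t < 0") (auto simp: abs_mult)
    qed
    then show "norm (resolvent_functional c \<psi> x) \<le> norm x * (B / c)"
      by (simp add: laplace_const(2)[OF c] mult.commute)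
  qed
qed

text \<open>The resolvent identity \<open>R L x = c R x - x\<close>.  It is the Laplace transform of
  \<open>\<psi> (P t x) - \<psi> x = \<integral>\<^sub>0\<^sup>t \<psi> (P s (L x)) ds\<close>.\<close>
lemma resolvent_functional_generator:
  assumes \<psi>: "bounded_linear \<psi>" and c: "0 < c" and x: "x \<in> generator_domain P"
  shows "resolvent_functional c \<psi> (generator P x) = c * resolvent_functional c \<psi> x - \<psi> x"
proof -
  let ?q = "\<lambda>s. \<psi> (P s x)" and ?r = "\<lambda>s. \<psi> (P s (generator P x))"
  note I = laplace_integrable_functional_P[OF \<psi> c]
  have rc: "continuous_on {0..} ?r" by (rule continuous_functional_P[OF \<psi>])
  have "integral {0..t} ?r = ?q t - ?q 0" if "0 \<le> t" for t
  proof (rule integral_unique, rule fundamental_theorem_of_calculus[OF that])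
    fix s assume "s \<in> {0..t}"
    then show "(?q has_vector_derivative ?r s) (at s within {0..t})"
      using bounded_linear.has_vector_derivative[OF \<psi> P_has_vector_derivative[OF x, of s]]
      by (auto intro: has_vector_derivative_within_subset)
  qed
  then have "causal (\<lambda>t. integral {0..t} ?r) = (\<lambda>t. 1 * causal ?q t + (-1) * causal (\<lambda>_. \<psi> x) t)"
    by (auto simp: causal_def indicator_def)
  then have "laplace c (causal ?r) / c = laplace c (causal ?q) - \<psi> x / c"
    using laplace_integral(2)[OF c rc I] laplace_lincomb(2)[OF I[of x] laplace_const(1)[OF c], of 1 "-1" "\<psi> x"]
      laplace_const(2)[OF c, of "\<psi> x"] by simp
  then show ?thesis
    using c by (simp add: resolvent_functional_def field_simps)
qed

end

section \<open>The Laplace exponent and the tail of the Levy measure\<close>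

locale levy_measure =
  fixes \<kappa> :: real and \<mu> :: "real measure"
  assumes drift_nonneg: "0 \<le> \<kappa>"
    and sets_\<mu>: "sets \<mu> = sets (restrict_space borel {0<..})"
    and infinite_activity: "emeasure \<mu> {0<..} = \<infinity>"
    and levy_finite: "(\<integral>\<^sup>+x. ennreal (min 1 x) \<partial>\<mu>) < \<infinity>"
begin

lemma space_\<mu>: "space \<mu> = {0<..}"
  using sets_eq_imp_space_eq[OF sets_\<mu>] by (simp add: space_restrict_space)

lemma ident_measurable_\<mu> [measurable]: "(\<lambda>x. x) \<in> \<mu> \<rightarrow>\<^sub>M borel"
  using measurable_restrict_space1[OF measurable_ident, of borel "{0<..}"]
  by (simp add: measurable_cong_sets[OF sets_\<mu> refl] id_def)

lemma emeasure_greaterThan_finite: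
  assumes "0 < a" shows "emeasure \<mu> {a<..} < \<infinity>"
proof -
  have s: "{a<..} \<in> sets \<mu>"
    using assms by (auto simp: sets_\<mu> sets_restrict_space_iff)
  have "ennreal (min 1 a) * emeasure \<mu> {a<..} = (\<integral>\<^sup>+x. ennreal (min 1 a) * indicator {a<..} x \<partial>\<mu>)"
    using s by (simp add: nn_integral_cmult_indicator)
  also have "\<dots> \<le> (\<integral>\<^sup>+x. ennreal (min 1 x) \<partial>\<mu>)"
    by (intro nn_integral_mono) (auto simp: indicator_def intro!: ennreal_leI)
  also note levy_finite
  finally show ?thesis
    using assms by (auto simp: ennreal_mult_less_top)
qed

lemma sigma_finite_\<mu>: "sigma_finite_measure \<mu>"
proof (rule sigma_finite_measure.intro, intro exI conjI ballI)
  let ?A = "range (\<lambda>n. {1 / real (Suc n)<..})"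
  show "countable ?A" by simp
  show "?A \<subseteq> sets \<mu>"
  proof safe
    fix n :: nat
    show "{1 / real (Suc n)<..} \<in> sets \<mu>"
      by (auto simp: sets_\<mu> sets_restrict_space_iff intro: order_less_trans[of 0 "1 / real (Suc n)", rotated])
  qed
  show "\<Union>?A = space \<mu>"
  proof (auto simp: space_\<mu>)
    fix x :: real assume "0 < x"
    from reals_Archimedean[OF this] show "\<exists>n. 1 / (1 + real n) < x"
      by (auto simp: inverse_eq_divide add.commute)
  next
    fix x :: real and n :: nat assume "1 / (1 + real n) < x"
    then show "0 < x" by (rule order_less_trans[rotated]) simp
  qed
  fix a assume "a \<in> ?A"
  then obtain n :: nat where "a = {1 / real (Suc n)<..}" by auto
  then show "emeasure \<mu> a \<noteq> \<infinity>"
    using emeasure_greaterThan_finite[of "1 / real (Suc n)"] by simp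
qed

lemma integrable_one_minus_exp:
  assumes l: "0 < l"
  shows "integrable \<mu> (\<lambda>x. 1 - exp (- l * x))"
proof (rule Bochner_Integration.integrable_bound)
  have "integrable \<mu> (\<lambda>x. min 1 x)"
  proof (rule integrableI_nonneg)
    show "AE x in \<mu>. 0 \<le> min 1 x" by (rule AE_I2) (simp add: space_\<mu>)
  qed (use levy_finite in auto)
  then show "integrable \<mu> (\<lambda>x. max 1 l * min 1 x)" by simp
  show "AE x in \<mu>. norm (1 - exp (- l * x)) \<le> norm (max 1 l * min 1 x)"
  proof (rule AE_I2)
    fix x assume "x \<in> space \<mu>"
    then have x: "0 < x" by (simp add: space_\<mu>)
    have e: "0 < exp (- l * x)" "exp (- l * x) \<le> 1" using l x by auto
    have "1 - exp (- l * x) \<le> l * x" using exp_ge_add_one_self[of "- l * x"] by simp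
    also have "\<dots> \<le> max 1 l * x" using x by (intro mult_right_mono) auto
    finally have "1 - exp (- l * x) \<le> max 1 l * x" .
    moreover have "1 - exp (- l * x) \<le> max 1 l * 1" using e(1) max.cobounded1[of 1 l] by linarith
    ultimately have "1 - exp (- l * x) \<le> max 1 l * min 1 x" by (auto simp: min_def)
    then show "norm (1 - exp (- l * x)) \<le> norm (max 1 l * min 1 x)"
      using e x by simp
  qed
qed measurable

definition \<Phi> :: "real \<Rightarrow> real" where "\<Phi> = laplace_exponent \<kappa> \<mu>"

lemma nn_integral_one_minus_exp:
  assumes "0 < l"
  shows "(\<integral>\<^sup>+x. ennreal (1 - exp (- l * x)) \<partial>\<mu>) = ennreal (\<Phi> l - \<kappa> * l)"
proof -
  have "AE x in \<mu>. 0 \<le> 1 - exp (- l * x)"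
    using assms by (intro AE_I2) (simp add: space_\<mu>)
  from nn_integral_eq_integral[OF integrable_one_minus_exp[OF assms] this] show ?thesis
    by (simp add: \<Phi>_def laplace_exponent_def)
qed

lemma \<Phi>_pos:
  assumes l: "0 < l" shows "0 < \<Phi> l"
proof -
  have "0 \<le> (\<integral>x. 1 - exp (- l * x) \<partial>\<mu>)"
    using l by (intro integral_nonneg_AE AE_I2) (auto simp: space_\<mu>)
  moreover have "(\<integral>x. 1 - exp (- l * x) \<partial>\<mu>) \<noteq> 0"
  proof
    assume "(\<integral>x. 1 - exp (- l * x) \<partial>\<mu>) = 0"
    then have "AE x in \<mu>. 1 - exp (- l * x) = 0"
      using l by (subst (asm) integral_nonneg_eq_0_iff_AE[OF integrable_one_minus_exp])
        (auto simp: space_\<mu> intro!: AE_I2)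
    moreover have "AE x in \<mu>. 1 - exp (- l * x) \<noteq> 0"
      using l by (intro AE_I2) (simp add: space_\<mu>)
    ultimately have "AE x in \<mu>. False" by eventually_elim simp
    then have "emeasure \<mu> (space \<mu>) = 0"
      using AE_iff_measurable[of "space \<mu>" \<mu> "\<lambda>_. False"] by simp
    then show False using infinite_activity by (simp add: space_\<mu>)
  qed
  ultimately show ?thesis
    using drift_nonneg l by (auto simp: \<Phi>_def laplace_exponent_def intro!: add_nonneg_pos)
qed

text \<open>Monotone convergence, as \<open>\<mu>\<close> has infinite mass.  This growth is the reason why the subordinator is
  strictly increasing.\<close>
lemma \<Phi>_at_top: "filterlim (\<lambda>n::nat. \<Phi> (real (Suc n))) at_top sequentially"
proof -
  let ?h = "\<lambda>(n::nat) x. 1 - exp (- real (Suc n) * x)"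
  let ?g = "\<lambda>n x. indicator {0<..} x * ennreal (?h n x)"
  have "(\<lambda>n. \<integral>\<^sup>+x. ?g n x \<partial>\<mu>) \<longlonglongrightarrow> (\<integral>\<^sup>+x. indicator {0<..} x \<partial>\<mu>)"
  proof (rule nn_integral_LIMSEQ)
    show "incseq ?g"
      by (intro incseq_SucI le_funI) (auto simp: indicator_def intro!: ennreal_leI)
    show "(\<lambda>n. ?g n x) \<longlonglongrightarrow> indicator {0<..} x" for x :: real
    proof (cases "0 < x")
      case x: True
      have "(\<lambda>n. exp (- x) ^ n) \<longlonglongrightarrow> 0"
        using x by (intro LIMSEQ_realpow_zero) auto
      from LIMSEQ_Suc[OF this] have "(\<lambda>n. 1 - exp (- x) ^ Suc n) \<longlonglongrightarrow> 1 - 0"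
        by (intro tendsto_diff tendsto_const)
      moreover have "exp (- x) ^ Suc n = exp (- real (Suc n) * x)" for n
        using exp_of_nat_mult[of "Suc n" "- x"] by (simp only: mult_minus_left mult_minus_right)
      ultimately have "(\<lambda>n. ?h n x) \<longlonglongrightarrow> 1" by (simp only: diff_zero)
      from tendsto_ennrealI[OF this] x show ?thesis by simp
    qed simp
  qed measurable
  moreover have "(\<integral>\<^sup>+x. ?g n x \<partial>\<mu>) = (\<integral>\<^sup>+x. ennreal (?h n x) \<partial>\<mu>)" for n
    by (intro nn_integral_cong) (simp add: space_\<mu>)
  moreover have "(\<integral>\<^sup>+x. indicator {0<..} x \<partial>\<mu>) = (\<integral>\<^sup>+x. 1 \<partial>\<mu>)"
    by (intro nn_integral_cong) (simp add: space_\<mu>)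
  moreover have "(\<integral>\<^sup>+x. 1 \<partial>\<mu>) = \<infinity>" using infinite_activity by (simp add: space_\<mu>)
  ultimately have lim: "(\<lambda>n. ennreal (\<Phi> (real (Suc n)) - \<kappa> * real (Suc n))) \<longlonglongrightarrow> \<infinity>"
    by (simp only: nn_integral_one_minus_exp[OF of_nat_0_less_iff[THEN iffD2, OF zero_less_Suc]])
  show ?thesis
    unfolding filterlim_at_top
  proof
    fix Z :: real
    have "\<forall>\<^sub>F n in sequentially. ennreal (max 0 Z) < ennreal (\<Phi> (real (Suc n)) - \<kappa> * real (Suc n))"
      using lim by (rule order_tendstoD) simp
    then show "\<forall>\<^sub>F n in sequentially. Z \<le> \<Phi> (real (Suc n))"
    proof eventually_elim
      case (elim n)
      then have "max 0 Z < \<Phi> (real (Suc n)) - \<kappa> * real (Suc n)"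
        using ennreal_less_iff[OF max.cobounded1] by blast
      moreover have "0 \<le> \<kappa> * real (Suc n)" using drift_nonneg by simp
      ultimately show ?case by simp
    qed
  qed
qed

abbreviation w :: "real \<Rightarrow> real" where "w \<equiv> levy_tail \<mu>"

lemma levy_tail_nonneg: "0 \<le> w t" by (simp add: levy_tail_def)

lemma levy_tail_nonpos: "t \<le> 0 \<Longrightarrow> w t = 0"
proof (cases "t = 0")
  case True
  \<comment> \<open>The mass is infinite, and \<open>measure\<close> then returns 0.\<close>
  then show ?thesis using infinite_activity by (simp add: levy_tail_def measure_def)
next
  case False
  \<comment> \<open>A ray from a negative point is not contained in the space of \<open>\<mu>\<close>, so its measure is 0 by convention.\<close>
  moreover assume "t \<le> 0"
  ultimately have "{t<..} \<notin> sets \<mu>"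
    by (auto simp: sets_\<mu> sets_restrict_space_iff subset_eq)
  then show ?thesis by (simp add: levy_tail_def measure_notin_sets)
qed

lemma ennreal_levy_tail:
  assumes "0 < t"
  shows "ennreal (w t) = (\<integral>\<^sup>+x. indicator {x. 0 < t \<and> t < x} x \<partial>\<mu>)"
proof -
  have "{t<..} \<in> sets \<mu>"
    using assms by (auto simp: sets_\<mu> sets_restrict_space_iff)
  moreover have "indicator {x. 0 < t \<and> t < x} x = (indicator {t<..} x :: ennreal)" for x
    using assms by (auto simp: indicator_def)
  ultimately show ?thesis
    using emeasure_greaterThan_finite[OF assms]
    by (simp add: levy_tail_def emeasure_eq_ennreal_measure)
qed

lemma levy_tail_measurable [measurable]: "w \<in> borel_measurable borel"
proof -
  interpret sigma_finite_measure \<mu> by (rule sigma_finite_\<mu>)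
  have "(\<lambda>t. \<integral>\<^sup>+x. indicator {x. 0 < t \<and> t < x} x \<partial>\<mu>) \<in> borel_measurable (borel :: real measure)"
    unfolding indicator_def by measurable
  then have "(\<lambda>t. enn2real (\<integral>\<^sup>+x. indicator {x. 0 < t \<and> t < x} x \<partial>\<mu>)) \<in> borel_measurable (borel :: real measure)"
    by measurable
  moreover have "w t = enn2real (\<integral>\<^sup>+x. indicator {x. 0 < t \<and> t < x} x \<partial>\<mu>)" for t
  proof (cases "0 < t")
    case True
    show ?thesis unfolding ennreal_levy_tail[OF True, symmetric]
      by (simp add: levy_tail_nonneg)
  next
    case False
    then show ?thesis by (simp add: levy_tail_nonpos)
  qed
  then have "w = (\<lambda>t. enn2real (\<integral>\<^sup>+x. indicator {x. 0 < t \<and> t < x} x \<partial>\<mu>))" by blast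
  ultimately show ?thesis by metis
qed

text \<open>Tonelli's theorem for \<open>exp (- l * t)\<close> on the region \<open>0 < t < x\<close>: integrating over \<open>t\<close> first gives
  \<open>(1 - exp (- l * x)) / l\<close>, integrating over \<open>x\<close> first gives the tail.\<close>
lemma nn_laplace_levy_tail:
  assumes l: "0 < l"
  shows "(\<integral>\<^sup>+t. ennreal (exp (- l * t) * w t) \<partial>lborel) = ennreal ((\<Phi> l - \<kappa> * l) / l)"
proof -
  interpret M: sigma_finite_measure \<mu> by (rule sigma_finite_\<mu>)
  interpret pair_sigma_finite lborel \<mu> by unfold_locales
  let ?g = "\<lambda>t x. ennreal (exp (- l * t)) * indicator {x. 0 < t \<and> t < x} x"
  have "(\<integral>\<^sup>+t. ennreal (exp (- l * t) * w t) \<partial>lborel) = (\<integral>\<^sup>+t. \<integral>\<^sup>+x. ?g t x \<partial>\<mu> \<partial>lborel)"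
  proof (rule nn_integral_cong)
    fix t :: real
    have [measurable]: "(\<lambda>x. indicator {x. 0 < t \<and> t < x} x :: ennreal) \<in> borel_measurable \<mu>"
      unfolding indicator_def by measurable
    show "ennreal (exp (- l * t) * w t) = (\<integral>\<^sup>+x. ?g t x \<partial>\<mu>)"
    proof (cases "0 < t")
      case True
      have "(\<integral>\<^sup>+x. ?g t x \<partial>\<mu>) = ennreal (exp (- l * t)) * ennreal (w t)"
        unfolding ennreal_levy_tail[OF True] by (rule nn_integral_cmult) measurable
      then show ?thesis by (simp add: ennreal_mult levy_tail_nonneg)
    next
      case False
      then show ?thesis by (simp add: levy_tail_nonpos)
    qed
  qed
  also have "\<dots> = (\<integral>\<^sup>+x. \<integral>\<^sup>+t. ?g t x \<partial>lborel \<partial>\<mu>)"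
    by (rule Fubini'[symmetric]) (unfold indicator_def, measurable)
  also have "\<dots> = (\<integral>\<^sup>+x. ennreal (1 / l) * ennreal (1 - exp (- l * x)) \<partial>\<mu>)"
  proof (rule nn_integral_cong)
    fix x assume "x \<in> space \<mu>"
    then have x: "0 < x" by (simp add: space_\<mu>)
    have "(\<integral>\<^sup>+t. ?g t x \<partial>lborel) = (\<integral>\<^sup>+t. ennreal (exp (- l * t)) * indicator {0..x} t \<partial>lborel)"
    proof (rule nn_integral_cong_AE)
      show "AE t in lborel. ?g t x = ennreal (exp (- l * t)) * indicator {0..x} t"
        using AE_lborel_singleton[of 0] AE_lborel_singleton[of x]
        by eventually_elim (auto simp: indicator_def)
    qed
    also have "\<dots> = ennreal ((- exp (- l * x) / l) - (- exp (- l * 0) / l))"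
      using l x by (intro nn_integral_FTC_Icc) (auto intro!: derivative_eq_intros)
    also have "\<dots> = ennreal (1 / l) * ennreal (1 - exp (- l * x))"
      using l x by (subst ennreal_mult[symmetric]) (auto simp: field_simps)
    finally show "(\<integral>\<^sup>+t. ?g t x \<partial>lborel) = ennreal (1 / l) * ennreal (1 - exp (- l * x))" .
  qed
  also have "\<dots> = ennreal (1 / l) * ennreal (\<Phi> l - \<kappa> * l)"
    by (subst nn_integral_cmult) (simp_all only: nn_integral_one_minus_exp[OF l], measurable)
  also have "\<dots> = ennreal ((\<Phi> l - \<kappa> * l) / l)"
    using l by (subst ennreal_mult'[symmetric]) auto
  finally show ?thesis .
qed

lemma laplace_levy_tail:
  assumes l: "0 < l"
  shows "laplace_integrable l w" and "laplace l w = (\<Phi> l - \<kappa> * l) / l"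
proof -
  have "0 \<le> (\<integral>x. 1 - exp (- l * x) \<partial>\<mu>)"
    using l by (intro integral_nonneg_AE AE_I2) (auto simp: space_\<mu>)
  then have nn: "0 \<le> (\<Phi> l - \<kappa> * l) / l"
    using l by (simp add: \<Phi>_def laplace_exponent_def)
  have "has_bochner_integral lborel (\<lambda>t. exp (- l * t) * w t) ((\<Phi> l - \<kappa> * l) / l)"
    by (intro has_bochner_integral_nn_integral nn nn_laplace_levy_tail l)
       (auto simp: levy_tail_nonneg)
  then show "laplace_integrable l w" "laplace l w = (\<Phi> l - \<kappa> * l) / l"
    unfolding laplace_integrable_def laplace_def
    by (simp_all only: has_bochner_integral_iff)
qed

end

section \<open>Inverses of increasing paths\<close>

lemma right_continuous_le:
  fixes y :: "real \<Rightarrow> real"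
  assumes rc: "continuous (at_right t) y" and b: "t < b"
    and le: "\<And>q. q \<in> \<rat> \<Longrightarrow> t < q \<Longrightarrow> q < b \<Longrightarrow> y q \<le> c"
  shows "y t \<le> c"
proof (rule ccontr)
  assume "\<not> y t \<le> c"
  then have "\<forall>\<^sub>F s in at_right t. c < y s"
    using rc by (intro order_tendstoD(1)[where y = "y t"]) (auto simp: continuous_within)
  then obtain d where d: "t < d" "\<And>s. t < s \<Longrightarrow> s < d \<Longrightarrow> c < y s"
    by (auto simp: eventually_at_right_field)
  obtain q where "q \<in> \<rat>" "t < q" "q < min b d"
    using Rats_dense_in_real[of t "min b d"] b d(1) by auto
  then show False using le[of q] d(2)[of q] by auto
qed

lemma strict_mono_on_rational:
  fixes y :: "real \<Rightarrow> real"
  assumes rc: "\<And>t. 0 \<le> t \<Longrightarrow> continuous (at_right t) y"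
    and mono: "\<And>q r. q \<in> \<rat> \<Longrightarrow> r \<in> \<rat> \<Longrightarrow> 0 \<le> q \<Longrightarrow> q < r \<Longrightarrow> y q < y r"
  shows "strict_mono_on {0..} y"
proof (rule strict_mono_onI)
  fix s t :: real assume st: "s \<in> {0..}" "t \<in> {0..}" "s < t"
  obtain q where q: "q \<in> \<rat>" "s < q" "q < t"
    using Rats_dense_in_real[OF st(3)] by auto
  obtain r where r: "r \<in> \<rat>" "q < r" "r < t"
    using Rats_dense_in_real[OF q(3)] by auto
  have "y s \<le> y q"
  proof (rule right_continuous_le[OF rc q(2)])
    fix p assume "p \<in> \<rat>" "s < p" "p < q"
    then show "y p \<le> y q" using mono[of p q] q(1) st by auto
  qed (use st in auto)
  also have "\<dots> < y r" using mono[of q r] q r st by auto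
  also have "y r \<le> y t"
  proof (rule ccontr)
    assume "\<not> y r \<le> y t"
    moreover have "- y t \<le> - y r"
    proof (rule right_continuous_le[where y = "\<lambda>t. - y t" and b = "t + 1"])
      show "continuous (at_right t) (\<lambda>t. - y t)" using rc[of t] st by (intro continuous_intros) auto
      fix p assume "p \<in> \<rat>" "t < p" "p < t + 1"
      then show "- y p \<le> - y r" using mono[of r p] r q st by auto
    qed auto
    ultimately show False by simp
  qed
  finally show "y s < y t" .
qed

text \<open>The properties shared by almost all paths of the subordinator.\<close>
locale increasing_path =
  fixes y :: "real \<Rightarrow> real"
  assumes y0: "y 0 = 0" and mono: "strict_mono_on {0..} y"
    and rc: "\<And>t. 0 \<le> t \<Longrightarrow> continuous (at_right t) y"
    and unbounded: "\<And>t. \<exists>s>0. t < y s"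
begin

definition inv_path :: "real \<Rightarrow> real" where
  "inv_path t = enn2real (INF s\<in>{s. 0 < s \<and> t < y s}. ennreal s)"

lemma ennreal_inv_path: "ennreal (inv_path t) = (INF s\<in>{s. 0 < s \<and> t < y s}. ennreal s)"
proof -
  obtain s where "0 < s" "t < y s" using unbounded by blast
  then have "(INF s\<in>{s. 0 < s \<and> t < y s}. ennreal s) \<le> ennreal s"
    by (intro INF_lower) auto
  then show ?thesis
    unfolding inv_path_def by (simp add: le_less_trans top.not_eq_extremum)
qed

lemma inv_path_nonneg: "0 \<le> inv_path t" by (simp add: inv_path_def)

lemma inv_path_le:
  assumes "0 < s" "t < y s" shows "inv_path t \<le> s"
proof -
  have "ennreal (inv_path t) \<le> ennreal s"
    unfolding ennreal_inv_path using assms by (intro INF_lower) auto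
  then show ?thesis using assms by (simp add: ennreal_le_iff)
qed

lemma inv_path_ge:
  assumes s: "0 \<le> s" and le: "y s \<le> t" shows "s \<le> inv_path t"
proof -
  have "ennreal s \<le> ennreal (inv_path t)"
    unfolding ennreal_inv_path
  proof (rule INF_greatest)
    fix r assume "r \<in> {r. 0 < r \<and> t < y r}"
    then have r: "0 < r" "t < y r" by auto
    have "\<not> r < s"
      using strict_mono_onD[OF mono, of r s] r s le by auto
    then show "ennreal s \<le> ennreal r" by (simp add: ennreal_leI)
  qed
  then show ?thesis using inv_path_nonneg by (simp add: ennreal_le_iff)
qed

lemma inv_path_less: "0 \<le> s \<Longrightarrow> inv_path t < s \<Longrightarrow> t < y s"
  using inv_path_ge[of s t] by force

lemma less_inv_path: "0 \<le> s \<Longrightarrow> s < inv_path t \<Longrightarrow> y s < t"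
proof -
  assume s: "0 \<le> s" "s < inv_path t"
  \<comment> \<open>Strict monotonicity between \<open>s\<close> and an intermediate point makes the inequality strict.\<close>
  define r where "r = (s + inv_path t) / 2"
  have r: "s < r" "r < inv_path t" using s by (auto simp: r_def)
  have "y r \<le> t" using inv_path_le[of r t] r s by force
  then show "y s < t" using strict_mono_onD[OF mono, of s r] r s by auto
qed

lemma inv_path_zero: "inv_path 0 = 0"
proof -
  have "inv_path 0 \<le> s" if "0 < s" for s
    using inv_path_le[OF that, of 0] strict_mono_onD[OF mono, of 0 s] y0 that by auto
  then show ?thesis using inv_path_nonneg[of 0] by (meson dense_le_bounded antisym field_le_epsilon dense_ge)
qed

text \<open>A jump of the inverse would be an interval on which \<open>y\<close> is constant.\<close>
lemma inv_path_continuous: "isCont inv_path t"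
  unfolding isCont_def
proof (rule order_tendstoI)
  fix a assume a: "a < inv_path t"
  show "\<forall>\<^sub>F s in at t. a < inv_path s"
  proof (cases "a < 0")
    case True
    then show ?thesis using inv_path_nonneg by (intro always_eventually) (auto intro: less_le_trans)
  next
    case False
    obtain r where r: "a < r" "r < inv_path t" using dense[OF a] by auto
    have "y r < t" using less_inv_path[of r t] r False by auto
    then have "\<forall>\<^sub>F s in at t. y r < s"
      by (intro order_tendstoD(1)[OF tendsto_ident_at])
    then show ?thesis
    proof eventually_elim
      case (elim s)
      then have "r \<le> inv_path s" using r False by (intro inv_path_ge) auto
      then show ?case using r by simp
    qed
  qed
next
  fix b assume b: "inv_path t < b"
  obtain r where r: "inv_path t < r" "r < b" using dense[OF b] by auto
  have r0: "0 < r" using r inv_path_nonneg[of t] by simp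
  have "t < y r" using inv_path_less[of r t] r r0 by auto
  then have "\<forall>\<^sub>F s in at t. s < y r"
    by (intro order_tendstoD(2)[OF tendsto_ident_at])
  then show "\<forall>\<^sub>F s in at t. inv_path s < b"
  proof eventually_elim
    case (elim s)
    then have "inv_path s \<le> r" using r0 by (intro inv_path_le) auto
    then show ?case using r by simp
  qed
qed

text \<open>The sublevel set of the inverse is the half-line up to \<open>y a\<close>, except perhaps for its endpoint, which an
  exponential time hits with probability zero.\<close>
lemma inv_path_sublevel:
  assumes a: "0 \<le> a" shows "{..<y a} \<subseteq> {t. inv_path t \<le> a}" "{t. inv_path t \<le> a} \<subseteq> {..y a}"
proof -
  show "{..<y a} \<subseteq> {t. inv_path t \<le> a}"
  proof
    fix t assume "t \<in> {..<y a}"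
    then have t: "t < y a" by simp
    show "t \<in> {t. inv_path t \<le> a}"
    proof (cases "a = 0")
      case True
      then have "inv_path t \<le> s" if "0 < s" for s
        using inv_path_le[OF that, of t] strict_mono_onD[OF mono, of 0 s] y0 t that by auto
      then show ?thesis using True by (auto intro: field_le_epsilon)
    next
      case False
      then show ?thesis using inv_path_le[of a t] a t by auto
    qed
  qed
  show "{t. inv_path t \<le> a} \<subseteq> {..y a}"
  proof
    fix t assume t: "t \<in> {t. inv_path t \<le> a}"
    have "- y a \<le> - t"
    proof (rule right_continuous_le[where y = "\<lambda>t. - y t" and b = "a + 1"])
      show "continuous (at_right a) (\<lambda>t. - y t)" using rc[OF a] by (intro continuous_intros)
      fix q assume "a < q"
      then show "- y q \<le> - t" using inv_path_less[of q t] t a by auto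
    qed simp
    then show "t \<in> {..y a}" by simp
  qed
qed

end

section \<open>The inverse subordinator\<close>

lemma inverse_time_eq_inv_path:
  "increasing_path (\<lambda>s. S s \<omega>) \<Longrightarrow> inverse_time S t \<omega> = increasing_path.inv_path (\<lambda>s. S s \<omega>) t"
  by (simp add: increasing_path.inv_path_def inverse_subordinator_def)

text \<open>By right continuity the infimum may be taken over rational times.  The measure \<open>A\<close> is kept general:
  one instance gives joint measurability in time and sample point, another one measurability with
  respect to the \<open>\<sigma>\<close>-algebra generated by \<open>S\<close>.\<close>
lemma inverse_time_measurable:
  assumes rc: "\<And>\<omega> s. \<omega> \<in> space A \<Longrightarrow> 0 \<le> s \<Longrightarrow> continuous (at_right s) (\<lambda>s. S s \<omega>)"
    and meas: "\<And>s. 0 \<le> s \<Longrightarrow> S s \<in> borel_measurable A"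
  shows "(\<lambda>(t, \<omega>). inverse_time S t \<omega>) \<in> borel_measurable (borel \<Otimes>\<^sub>M A)"
proof -
  let ?Q = "\<rat> \<inter> {0<..} :: real set"
  let ?J = "\<lambda>p. INF q\<in>?Q. if fst p < S q (snd p) then ennreal q else \<infinity>"
  have "?J \<in> borel_measurable (borel \<Otimes>\<^sub>M A)"
  proof (rule borel_measurable_INF)
    show "countable ?Q" using countable_rat by (rule countable_subset[rotated]) auto
    fix q assume "q \<in> ?Q"
    then have [measurable]: "S q \<in> borel_measurable A" using meas[of q] by auto
    show "(\<lambda>p. if fst p < S q (snd p) then ennreal q else \<infinity>) \<in> borel_measurable (borel \<Otimes>\<^sub>M A)"
      by measurable
  qed
  then have "(\<lambda>p. enn2real (?J p)) \<in> borel_measurable (borel \<Otimes>\<^sub>M A)" by measurable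
  moreover have "inverse_subordinator S t \<omega> = ?J (t, \<omega>)" if \<omega>: "\<omega> \<in> space A" for t \<omega>
    unfolding inverse_subordinator_def
  proof (rule antisym)
    show "(INF s\<in>{s. 0 < s \<and> t < S s \<omega>}. ennreal s) \<le> ?J (t, \<omega>)"
      by (rule INF_greatest) (auto intro: INF_lower)
    show "?J (t, \<omega>) \<le> (INF s\<in>{s. 0 < s \<and> t < S s \<omega>}. ennreal s)"
    proof (rule INF_greatest)
      fix s assume "s \<in> {s. 0 < s \<and> t < S s \<omega>}"
      then have s: "0 < s" "t < S s \<omega>" by auto
      show "?J (t, \<omega>) \<le> ennreal s"
      proof (rule ccontr)
        assume "\<not> ?J (t, \<omega>) \<le> ennreal s"
        then have "ennreal s < ?J (t, \<omega>)" by simp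
        then obtain b where b: "ennreal s < b" "b < ?J (t, \<omega>)" using dense by blast
        then have bfin: "b = ennreal (enn2real b)"
          using less_le_trans[OF b(2) top_greatest] by (simp add: ennreal_enn2real)
        then have sb: "s < enn2real b" using b(1) s by (metis ennreal_less_iff less_imp_le)
        have "S s \<omega> \<le> t"
        proof (rule right_continuous_le[OF rc[OF \<omega>] sb])
          fix q assume q: "q \<in> \<rat>" "s < q" "q < enn2real b"
          show "S q \<omega> \<le> t"
          proof (rule ccontr)
            assume "\<not> S q \<omega> \<le> t"
            then have "?J (t, \<omega>) \<le> ennreal q"
              using q s by (intro INF_lower2[of q]) auto
            also have "\<dots> \<le> ennreal (enn2real b)" using q by (intro ennreal_leI) simp
            finally show False using b(2) bfin by simp
          qed
        qed (use s in simp)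
        then show False using s by simp
      qed
    qed
  qed
  ultimately show ?thesis
    by (subst measurable_cong[where g = "\<lambda>p. enn2real (?J p)"]) (auto simp: space_pair_measure)
qed

locale driving_subordinator = levy_measure +
  fixes N :: "'w measure" and S :: "real \<Rightarrow> 'w \<Rightarrow> real"
  assumes sub: "subordinator N \<kappa> \<mu> S"
begin

sublocale prob_space N using sub by (simp add: subordinator_def)

lemma S_measurable: "0 \<le> t \<Longrightarrow> S t \<in> borel_measurable N"
  and S_zero: "\<omega> \<in> space N \<Longrightarrow> S 0 \<omega> = 0"
  and S_nonneg: "\<omega> \<in> space N \<Longrightarrow> 0 \<le> t \<Longrightarrow> 0 \<le> S t \<omega>"
  and S_right_continuous: "\<omega> \<in> space N \<Longrightarrow> 0 \<le> t \<Longrightarrow> continuous (at_right t) (\<lambda>s. S s \<omega>)"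
  and S_increment: "0 \<le> s \<Longrightarrow> 0 \<le> t \<Longrightarrow> distr N borel (\<lambda>\<omega>. S (s + t) \<omega> - S s \<omega>) = distr N borel (S t)"
  and S_laplace: "0 \<le> t \<Longrightarrow> 0 < l \<Longrightarrow> (\<integral>\<omega>. exp (- l * S t \<omega>) \<partial>N) = exp (- t * \<Phi> l)"
proof -
  note D = sub[unfolded subordinator_def, folded \<Phi>_def, THEN conjunct2]
  note paths = D[THEN conjunct2, THEN conjunct1, rule_format]
  note laws = D[THEN conjunct2, THEN conjunct2, THEN conjunct2]
  show "0 \<le> t \<Longrightarrow> S t \<in> borel_measurable N" using D[THEN conjunct1] by simp
  show "\<omega> \<in> space N \<Longrightarrow> S 0 \<omega> = 0" using paths by simp
  show "\<omega> \<in> space N \<Longrightarrow> 0 \<le> t \<Longrightarrow> 0 \<le> S t \<omega>" using paths by simp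
  show "\<omega> \<in> space N \<Longrightarrow> 0 \<le> t \<Longrightarrow> continuous (at_right t) (\<lambda>s. S s \<omega>)" using paths by simp
  show "0 \<le> s \<Longrightarrow> 0 \<le> t \<Longrightarrow> distr N borel (\<lambda>\<omega>. S (s + t) \<omega> - S s \<omega>) = distr N borel (S t)"
    using laws[THEN conjunct1] by simp
  show "0 \<le> t \<Longrightarrow> 0 < l \<Longrightarrow> (\<integral>\<omega>. exp (- l * S t \<omega>) \<partial>N) = exp (- t * \<Phi> l)"
    using laws[THEN conjunct2] by (simp add: \<Phi>_def)
qed

lemma integrable_exp_S:
  assumes "0 \<le> t" "0 < l"
  shows "integrable N (\<lambda>\<omega>. exp (- l * S t \<omega>))"
proof (rule integrable_const_bound[where B = 1])
  show "AE \<omega> in N. norm (exp (- l * S t \<omega>)) \<le> 1"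
    using S_nonneg assms by (intro AE_I2) simp
qed (use S_measurable[OF assms(1)] in measurable)

lemma chernoff:
  assumes t: "0 \<le> t" and l: "0 < l"
  shows "prob {\<omega> \<in> space N. S t \<omega> \<le> c} \<le> exp (l * c - t * \<Phi> l)"
proof -
  note [measurable] = S_measurable[OF t]
  have "prob {\<omega> \<in> space N. S t \<omega> \<le> c} = (\<integral>\<omega>. indicator {\<omega> \<in> space N. S t \<omega> \<le> c} \<omega> \<partial>N)"
    by simp
  also have "\<dots> \<le> (\<integral>\<omega>. exp (l * c) * exp (- l * S t \<omega>) \<partial>N)"
  proof (rule integral_mono)
    show "integrable N (\<lambda>\<omega>. exp (l * c) * exp (- l * S t \<omega>))"
      using integrable_exp_S[OF t l] by (rule integrable_mult_right)
    show "integrable N (\<lambda>\<omega>. indicator {\<omega> \<in> space N. S t \<omega> \<le> c} \<omega> :: real)"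
      by (rule integrable_real_indicator) (auto simp: less_top[symmetric])
    fix \<omega>
    have "1 \<le> exp (l * c) * exp (- l * S t \<omega>)" if "S t \<omega> \<le> c"
      unfolding exp_add[symmetric] using that l by simp
    then show "indicator {\<omega> \<in> space N. S t \<omega> \<le> c} \<omega> \<le> exp (l * c) * exp (- l * S t \<omega>)"
      by (auto simp: indicator_def)
  qed
  also have "\<dots> = exp (l * c) * (\<integral>\<omega>. exp (- l * S t \<omega>) \<partial>N)"
    by (rule integral_mult_right_zero)
  also have "\<dots> = exp (l * c - t * \<Phi> l)"
    unfolding S_laplace[OF t l] exp_add[symmetric] by simp
  finally show ?thesis .
qed

text \<open>By Chernoff's inequality at level 0 the probability of \<open>S h \<le> 0\<close> is at most \<open>exp (- h * \<Phi> l)\<close> for every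
  \<open>l\<close>, and \<open>\<Phi>\<close> is unbounded.\<close>
lemma AE_S_pos:
  assumes h: "0 < h" shows "AE \<omega> in N. 0 < S h \<omega>"
proof -
  note [measurable] = S_measurable[OF less_imp_le[OF h]]
  have "filterlim (\<lambda>n. h * \<Phi> (real (Suc n))) at_top sequentially"
    using h by (intro filterlim_tendsto_pos_mult_at_top[OF tendsto_const] \<Phi>_at_top)
  then have "(\<lambda>n. exp (- (h * \<Phi> (real (Suc n))))) \<longlonglongrightarrow> 0"
    by (intro filterlim_compose[OF exp_at_bot]) (simp add: filterlim_uminus_at_bot)
  then have "prob {\<omega> \<in> space N. S h \<omega> \<le> 0} \<le> 0"
  proof (rule LIMSEQ_le_const)
    show "\<exists>M. \<forall>n\<ge>M. prob {\<omega> \<in> space N. S h \<omega> \<le> 0} \<le> exp (- (h * \<Phi> (real (Suc n))))"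
      using chernoff[of h "real (Suc _)" 0] h by auto
  qed
  then have "prob {\<omega> \<in> space N. S h \<omega> \<le> 0} = 0"
    by (simp add: measure_le_0_iff)
  then have "AE \<omega> in N. \<not> S h \<omega> \<le> 0"
    by (subst (asm) prob_eq_0) auto
  then show ?thesis by (simp add: not_le)
qed

lemma AE_S_less:
  assumes "0 \<le> s" "s < t" shows "AE \<omega> in N. S s \<omega> < S t \<omega>"
proof -
  have [measurable]: "S s \<in> borel_measurable N" "S t \<in> borel_measurable N" "S (t - s) \<in> borel_measurable N"
    using S_measurable assms by auto
  have "AE x in distr N borel (S (t - s)). 0 < x"
    using AE_S_pos[of "t - s"] assms by (subst AE_distr_iff) auto
  then have "AE x in distr N borel (\<lambda>\<omega>. S (s + (t - s)) \<omega> - S s \<omega>). 0 < x"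
    by (subst S_increment) (use assms in auto)
  then show ?thesis
    by (subst (asm) AE_distr_iff) auto
qed

lemma AE_S_unbounded: "AE \<omega> in N. \<exists>s>0. t < S s \<omega>"
proof -
  have m: "{\<omega> \<in> space N. S (real n) \<omega> \<le> t} \<in> sets N" for n :: nat
    using S_measurable[of "real n"] by measurable
  have "filterlim (\<lambda>n. real n * \<Phi> 1) at_top sequentially"
    using \<Phi>_pos[of 1] by (intro filterlim_at_top_mult_tendsto_pos[OF tendsto_const] filterlim_real_sequentially) auto
  then have "(\<lambda>n. exp (- (real n * \<Phi> 1))) \<longlonglongrightarrow> 0"
    by (intro filterlim_compose[OF exp_at_bot]) (simp add: filterlim_uminus_at_bot)
  from tendsto_mult_left[OF this, of "exp t"]
  have lim: "(\<lambda>n. exp t * exp (- (real n * \<Phi> 1))) \<longlonglongrightarrow> 0" by simp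
  let ?B = "\<Inter>n::nat. {\<omega> \<in> space N. S (real n) \<omega> \<le> t}"
  have B: "?B \<in> sets N" using m by blast
  have "prob ?B \<le> 0"
    using lim
  proof (rule LIMSEQ_le_const)
    have "prob ?B \<le> exp t * exp (- (real n * \<Phi> 1))" for n :: nat
    proof -
      have "prob ?B \<le> prob {\<omega> \<in> space N. S (real n) \<omega> \<le> t}"
        by (rule finite_measure_mono) (use m in auto)
      also have "\<dots> \<le> exp t * exp (- (real n * \<Phi> 1))"
        using chernoff[of "real n" 1 t] by (simp add: exp_diff exp_minus divide_inverse)
      finally show ?thesis .
    qed
    then show "\<exists>M. \<forall>n\<ge>M. prob ?B \<le> exp t * exp (- (real n * \<Phi> 1))" by blast
  qed
  then have "prob ?B = 0" by (simp add: measure_le_0_iff)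
  then have "AE \<omega> in N. \<omega> \<notin> ?B" using prob_eq_0[OF B] by simp
  then show ?thesis
    using AE_space
  proof eventually_elim
    case (elim \<omega>)
    then obtain n :: nat where n: "t < S (real n) \<omega>" by (auto simp: not_le)
    show ?case
    proof (cases "n = 0")
      case False
      then show ?thesis using n by (intro exI[of _ "real n"]) auto
    next
      \<comment> \<open>The level is exceeded at time 0 already; right continuity provides a positive time.\<close>
      case True
      have "\<forall>\<^sub>F s in at_right 0. t < S s \<omega>"
        using S_right_continuous[OF elim(2), of 0] n True
        by (intro order_tendstoD(1)[where y = "S 0 \<omega>"]) (auto simp: continuous_within)
      then obtain d where "0 < d" "\<And>s. 0 < s \<Longrightarrow> s < d \<Longrightarrow> t < S s \<omega>"
        by (auto simp: eventually_at_right_field)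
      then show ?thesis by (intro exI[of _ "d / 2"]) auto
    qed
  qed
qed

text \<open>Strict monotonicity and unboundedness hold almost surely for rational times and integer levels,
  and right continuity extends them.\<close>
lemma AE_increasing_path: "AE \<omega> in N. increasing_path (\<lambda>s. S s \<omega>)"
proof -
  have "AE \<omega> in N. \<forall>n::nat. \<exists>s>0. real n < S s \<omega>"
    using AE_S_unbounded by (subst AE_all_countable) auto
  moreover have "AE \<omega> in N. \<forall>p\<in>{(q, r). q \<in> \<rat> \<and> r \<in> \<rat> \<and> 0 \<le> q \<and> q < r}. S (fst p) \<omega> < S (snd p) \<omega>"
  proof (rule AE_ball_countable')
    have "countable (\<rat> \<times> \<rat> :: (real \<times> real) set)"
      by (intro countable_SIGMA countable_rat)
    then show "countable {(q, r). q \<in> \<rat> \<and> r \<in> \<rat> \<and> 0 \<le> q \<and> q < (r::real)}"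
      by (rule countable_subset[rotated]) auto
  qed (auto intro: AE_S_less)
  ultimately show ?thesis
    using AE_space
  proof eventually_elim
    case (elim \<omega>)
    show ?case
    proof
      show "S 0 \<omega> = 0" using S_zero elim by simp
      show "continuous (at_right t) (\<lambda>s. S s \<omega>)" if "0 \<le> t" for t
        using S_right_continuous elim that by simp
      show "strict_mono_on {0..} (\<lambda>s. S s \<omega>)"
        using elim S_right_continuous by (intro strict_mono_on_rational) auto
      show "\<exists>s>0. t < S s \<omega>" for t
      proof -
        obtain n :: nat where "t < real n" using reals_Archimedean2 by blast
        then show ?thesis using elim(1) by (meson order_less_trans)
      qed
    qed
  qed
qed

abbreviation T :: "real \<Rightarrow> 'w \<Rightarrow> real" where "T \<equiv> inverse_time S"

lemma T_nonneg: "0 \<le> T t \<omega>" by simp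

lemma T_pair_measurable: "(\<lambda>(t, \<omega>). T t \<omega>) \<in> borel_measurable (borel \<Otimes>\<^sub>M N)"
  by (rule inverse_time_measurable) (auto intro: S_right_continuous S_measurable)

lemma T_measurable [measurable]: "T t \<in> borel_measurable N"
  using measurable_compose[OF measurable_Pair1' T_pair_measurable, of t] by simp

lemma AE_T_continuous: "AE \<omega> in N. \<forall>t. isCont (\<lambda>t. T t \<omega>) t"
  using AE_increasing_path
  by eventually_elim (simp add: inverse_time_eq_inv_path increasing_path.inv_path_continuous)

lemma AE_T_zero: "AE \<omega> in N. T 0 \<omega> = 0"
  using AE_increasing_path
  by eventually_elim (simp add: inverse_time_eq_inv_path increasing_path.inv_path_zero)

text \<open>At an independent exponential time of rate \<open>l\<close> the inverse subordinator is exponential of rate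
  \<open>\<Phi> l\<close>: given the path, the event \<open>T t \<le> a\<close> is \<open>t \<le> S a\<close> up to a null set, and has probability
  \<open>1 - exp (- l * S a)\<close>.\<close>
lemma exponential_time_distributed:
  assumes l: "0 < l"
  shows "distributed (N \<Otimes>\<^sub>M density lborel (exponential_density l)) lborel
           (\<lambda>(\<omega>, t). T t \<omega>) (exponential_density (\<Phi> l))"
proof (rule exponential_distributedI[OF _ \<Phi>_pos[OF l]])
  let ?D = "density lborel (exponential_density l)"
  interpret D: prob_space ?D using l by (rule prob_space_exponential_density)
  have "(\<lambda>(\<omega>, t). T t \<omega>) \<in> borel_measurable (N \<Otimes>\<^sub>M borel)"
    using measurable_compose[OF measurable_pair_swap' T_pair_measurable] by (simp add: case_prod_beta)
  then show meas [measurable]: "(\<lambda>(\<omega>, t). T t \<omega>) \<in> borel_measurable (N \<Otimes>\<^sub>M ?D)"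
    by (simp add: measurable_cong_sets[OF sets_pair_measure_cong[OF refl sets_density] refl]
          cong: measurable_cong_sets)
  fix a :: real assume a: "0 \<le> a"
  note [measurable] = S_measurable[OF a]
  let ?X = "{p \<in> space (N \<Otimes>\<^sub>M ?D). (case p of (\<omega>, t) \<Rightarrow> T t \<omega>) \<le> a}"
  have X: "?X \<in> sets (N \<Otimes>\<^sub>M ?D)" by measurable
  have cdf: "emeasure ?D {..c} = ennreal (1 - exp (- l * c))" if "0 \<le> c" for c
    using emeasure_erlang_density[OF l, of 0 c] that by (simp add: erlang_CDF_0)
  have "AE \<omega> in N. emeasure ?D (Pair \<omega> -` ?X) = ennreal (1 - exp (- l * S a \<omega>))"
    using AE_increasing_path AE_space
  proof eventually_elim
    case (elim \<omega>)
    interpret increasing_path "\<lambda>s. S s \<omega>" by fact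
    have eq: "Pair \<omega> -` ?X = {t. inv_path t \<le> a}"
      using elim by (auto simp: space_pair_measure inverse_time_eq_inv_path)
    have ms: "{t. inv_path t \<le> a} \<in> sets ?D"
      using sets_Pair1[OF X, of \<omega>] unfolding eq .
    have c: "0 \<le> S a \<omega>" using S_nonneg elim a by simp
    have "emeasure ?D {..S a \<omega>} = emeasure ?D {..<S a \<omega>}"
    proof (rule emeasure_eq_AE)
      have "AE t in lborel. t \<noteq> S a \<omega>" by (rule AE_lborel_singleton)
      then show "AE t in ?D. (t \<in> {..S a \<omega>}) = (t \<in> {..<S a \<omega>})"
        by (subst AE_density) (auto elim: eventually_mono)
    qed auto
    then have "emeasure ?D {..S a \<omega>} \<le> emeasure ?D {t. inv_path t \<le> a}"
      using emeasure_mono[OF inv_path_sublevel(1)[OF a] ms] by simp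
    moreover have "emeasure ?D {t. inv_path t \<le> a} \<le> emeasure ?D {..S a \<omega>}"
      by (rule emeasure_mono[OF inv_path_sublevel(2)[OF a]]) simp
    ultimately show ?case
      unfolding eq cdf[OF c, symmetric] by (rule antisym[rotated])
  qed
  then have "emeasure (N \<Otimes>\<^sub>M ?D) ?X = (\<integral>\<^sup>+\<omega>. ennreal (1 - exp (- l * S a \<omega>)) \<partial>N)"
    unfolding D.emeasure_pair_measure_alt[OF X] by (rule nn_integral_cong_AE)
  also have "\<dots> = ennreal (\<integral>\<omega>. 1 - exp (- l * S a \<omega>) \<partial>N)"
  proof (rule nn_integral_eq_integral)
    show "AE \<omega> in N. 0 \<le> 1 - exp (- l * S a \<omega>)"
      using S_nonneg a l by (intro AE_I2) simp
  qed (use integrable_exp_S[OF a l] in auto)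
  also have "(\<integral>\<omega>. 1 - exp (- l * S a \<omega>) \<partial>N) = 1 - exp (- a * \<Phi> l)"
    using integrable_exp_S[OF a l] S_laplace[OF a l] by (simp add: prob_space)
  also have "ennreal (1 - exp (- a * \<Phi> l)) = 1 - ennreal (exp (- a * \<Phi> l))"
    by (simp add: ennreal_minus[symmetric])
  finally show "emeasure (N \<Otimes>\<^sub>M ?D) ?X = 1 - ennreal (exp (- a * \<Phi> l))" .
qed

lemma borel_measurable_continuous_T:
  assumes h: "continuous_on {0..} (h :: real \<Rightarrow> real)"
  shows "(\<lambda>\<omega>. h (T t \<omega>)) \<in> borel_measurable N"
proof -
  have "(\<lambda>\<omega>. causal h (T t \<omega>)) \<in> borel_measurable N"
    using causal_measurable[OF h] by measurable
  then show ?thesis by simp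
qed

lemma expectation_T_integrable:
  assumes "continuous_on {0..} h" "\<And>s. 0 \<le> s \<Longrightarrow> \<bar>h s\<bar> \<le> (B::real)"
  shows "integrable N (\<lambda>\<omega>. h (T t \<omega>))"
  using assms by (intro integrable_const_bound[where B = B] borel_measurable_continuous_T AE_I2) auto

lemma continuous_expectation_T:
  fixes h :: "real \<Rightarrow> real"
  assumes h: "continuous_on {0..} h" and B: "\<And>s. 0 \<le> s \<Longrightarrow> \<bar>h s\<bar> \<le> B"
  shows "continuous_on {0..} (\<lambda>t. \<integral>\<omega>. h (T t \<omega>) \<partial>N)"
proof (rule continuous_on_sequentiallyI)
  fix x t assume x: "x \<longlonglongrightarrow> (t::real)"
  show "(\<lambda>n. \<integral>\<omega>. h (T (x n) \<omega>) \<partial>N) \<longlonglongrightarrow> (\<integral>\<omega>. h (T t \<omega>) \<partial>N)"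
  proof (rule integral_dominated_convergence[where w = "\<lambda>_. B"])
    show "AE \<omega> in N. (\<lambda>n. h (T (x n) \<omega>)) \<longlonglongrightarrow> h (T t \<omega>)"
      using AE_T_continuous
    proof eventually_elim
      case (elim \<omega>)
      then have "(\<lambda>n. T (x n) \<omega>) \<longlonglongrightarrow> T t \<omega>"
        using isCont_tendsto_compose[OF _ x] by blast
      then show ?case
        by (rule continuous_on_tendsto_compose[OF h]) auto
    qed
    show "AE \<omega> in N. norm (h (T (x n) \<omega>)) \<le> B" for n
      using B by (intro AE_I2) simp
  qed (use borel_measurable_continuous_T[OF h] in auto)
qed

lemma abs_expectation_T_le:
  fixes h :: "real \<Rightarrow> real"
  assumes "continuous_on {0..} h" and B: "\<And>s. 0 \<le> s \<Longrightarrow> \<bar>h s\<bar> \<le> B"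
  shows "\<bar>\<integral>\<omega>. h (T t \<omega>) \<partial>N\<bar> \<le> B"
proof -
  have "\<bar>\<integral>\<omega>. h (T t \<omega>) \<partial>N\<bar> \<le> (\<integral>\<omega>. \<bar>h (T t \<omega>)\<bar> \<partial>N)" by (rule Bochner_Integration.integral_abs_bound)
  also have "\<dots> \<le> B"
    using expectation_T_integrable[OF assms(1) B, of t] B by (intro integral_le_const integrable_abs AE_I2) auto
  finally show ?thesis .
qed

text \<open>Both sides are, up to the factor \<open>l\<close>, the expectation of \<open>h\<close> at the inverse subordinator evaluated at an
  independent exponential time.\<close>
lemma laplace_expectation_T:
  fixes h :: "real \<Rightarrow> real"
  assumes l: "0 < l" and h: "continuous_on {0..} h" and B: "\<And>s. 0 \<le> s \<Longrightarrow> \<bar>h s\<bar> \<le> B"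
  shows "laplace l (causal (\<lambda>t. \<integral>\<omega>. h (T t \<omega>) \<partial>N)) = \<Phi> l / l * laplace (\<Phi> l) (causal h)"
proof -
  let ?D = "density lborel (exponential_density l)"
  interpret D: prob_space ?D using l by (rule prob_space_exponential_density)
  interpret Q: pair_prob_space N ?D ..
  have [measurable]: "causal h \<in> borel_measurable borel" by (rule causal_measurable[OF h])
  note dist = exponential_time_distributed[OF l]
  have [measurable]: "(\<lambda>(\<omega>, t). T t \<omega>) \<in> borel_measurable (N \<Otimes>\<^sub>M ?D)"
    using dist by (simp add: distributed_def)
  have hT: "causal h (T t \<omega>) = h (T t \<omega>)" for t \<omega> by simp
  have cB: "\<bar>causal h s\<bar> \<le> B" for s
    using B[of s] B[of 0] by (cases "s < 0") auto
  have int: "integrable (N \<Otimes>\<^sub>M ?D) (\<lambda>(\<omega>, t). causal h (T t \<omega>))"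
  proof (rule Q.P.integrable_const_bound[where B = B])
    show "AE p in N \<Otimes>\<^sub>M ?D. norm (case p of (\<omega>, t) \<Rightarrow> causal h (T t \<omega>)) \<le> B"
      unfolding case_prod_beta real_norm_def by (intro AE_I2 cB)
  qed measurable
  have "\<Phi> l * laplace (\<Phi> l) (causal h) = (\<integral>s. exponential_density (\<Phi> l) s * causal h s \<partial>lborel)"
    unfolding laplace_def integral_mult_right_zero[symmetric]
    by (intro Bochner_Integration.integral_cong) (auto simp: exponential_density_def causal_def mult_ac)
  also have "\<dots> = (\<integral>p. causal h (case p of (\<omega>, t) \<Rightarrow> T t \<omega>) \<partial>(N \<Otimes>\<^sub>M ?D))"
    using \<Phi>_pos[OF l] by (intro distributed_integral[OF dist]) (auto simp: exponential_density_nonneg)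
  also have "\<dots> = (\<integral>t. (\<integral>\<omega>. causal h (T t \<omega>) \<partial>N) \<partial>?D)"
  proof -
    have "(\<lambda>p. causal h (case p of (\<omega>, t) \<Rightarrow> T t \<omega>)) = (\<lambda>(\<omega>, t). causal h (T t \<omega>))" by auto
    then show ?thesis
      using Q.integral_snd[of "\<lambda>\<omega> t. causal h (T t \<omega>)", OF int] by metis
  qed
  also have "\<dots> = (\<integral>t. exponential_density l t *\<^sub>R (\<integral>\<omega>. causal h (T t \<omega>) \<partial>N) \<partial>lborel)"
  proof (rule integral_density)
    have "(\<lambda>(t, \<omega>). causal h (T t \<omega>)) \<in> borel_measurable (borel \<Otimes>\<^sub>M N)"
      using measurable_compose[OF T_pair_measurable \<open>causal h \<in> borel_measurable borel\<close>]
      by (simp add: case_prod_beta)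
    then show "(\<lambda>t. \<integral>\<omega>. causal h (T t \<omega>) \<partial>N) \<in> borel_measurable lborel"
      using borel_measurable_lebesgue_integral[of "\<lambda>t \<omega>. causal h (T t \<omega>)" borel] by simp
  qed (use l in \<open>auto simp: exponential_density_nonneg\<close>)
  also have "\<dots> = l * laplace l (causal (\<lambda>t. \<integral>\<omega>. h (T t \<omega>) \<partial>N))"
    unfolding laplace_def integral_mult_right_zero[symmetric] hT
    by (intro Bochner_Integration.integral_cong) (auto simp: exponential_density_def causal_def mult_ac)
  finally show ?thesis using l by (simp add: field_simps)
qed

end

section \<open>The law of the inverse subordinator\<close>

text \<open>For \<open>h\<close> bounded and continuous, \<open>\<E>[h (T t)]\<close> is continuous in \<open>t\<close> and its transform depends only on \<open>\<Phi>\<close>.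
  Taking \<open>h\<close> to be a cosine or a sine yields equality of the characteristic functions.\<close>
lemma inverse_time_law_unique:
  assumes N1: "driving_subordinator \<kappa> \<mu> N1 S1" and N2: "driving_subordinator \<kappa> \<mu> N2 S2" and t: "0 \<le> t"
  shows "distr N1 borel (inverse_time S1 t) = distr N2 borel (inverse_time S2 t)"
proof (rule Levy_uniqueness)
  interpret N1: driving_subordinator \<kappa> \<mu> N1 S1 by fact
  interpret N2: driving_subordinator \<kappa> \<mu> N2 S2 by fact
  show "real_distribution (distr N1 borel (inverse_time S1 t))" "real_distribution (distr N2 borel (inverse_time S2 t))"
    by (auto intro!: N1.real_distribution_distr N2.real_distribution_distr)
  have eq: "(\<integral>\<omega>. h (inverse_time S1 t \<omega>) \<partial>N1) = (\<integral>\<omega>. h (inverse_time S2 t \<omega>) \<partial>N2)"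
    if h: "continuous_on {0..} h" and B: "\<And>s. 0 \<le> s \<Longrightarrow> \<bar>h s\<bar> \<le> 1" for h :: "real \<Rightarrow> real"
  proof (rule laplace_unique[OF _ _ _ _ _ t])
    show c: "continuous_on {0..} (\<lambda>t. \<integral>\<omega>. h (inverse_time S1 t \<omega>) \<partial>N1)"
      "continuous_on {0..} (\<lambda>t. \<integral>\<omega>. h (inverse_time S2 t \<omega>) \<partial>N2)"
      by (rule N1.continuous_expectation_T[OF h B] N2.continuous_expectation_T[OF h B]; assumption)+
    fix l :: real assume l: "0 < l"
    show "laplace_integrable l (causal (\<lambda>t. \<integral>\<omega>. h (inverse_time S1 t \<omega>) \<partial>N1))"
      by (rule laplace_integrable_bounded[OF l c(1) N1.abs_expectation_T_le[OF h B]])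
    show "laplace_integrable l (causal (\<lambda>t. \<integral>\<omega>. h (inverse_time S2 t \<omega>) \<partial>N2))"
      by (rule laplace_integrable_bounded[OF l c(2) N2.abs_expectation_T_le[OF h B]])
    show "laplace l (causal (\<lambda>t. \<integral>\<omega>. h (inverse_time S1 t \<omega>) \<partial>N1)) =
      laplace l (causal (\<lambda>t. \<integral>\<omega>. h (inverse_time S2 t \<omega>) \<partial>N2))"
      using N1.laplace_expectation_T[OF l h B] N2.laplace_expectation_T[OF l h B] by simp
  qed
  show "char (distr N1 borel (inverse_time S1 t)) = char (distr N2 borel (inverse_time S2 t))"
  proof
    fix \<theta> :: real
    have Re_Im: "Re (char (distr N borel (inverse_time S t)) \<theta>) = (\<integral>\<omega>. cos (\<theta> * inverse_time S t \<omega>) \<partial>N)"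
        "Im (char (distr N borel (inverse_time S t)) \<theta>) = (\<integral>\<omega>. sin (\<theta> * inverse_time S t \<omega>) \<partial>N)"
      if "driving_subordinator \<kappa> \<mu> N S" for N :: "'x measure" and S
    proof -
      interpret driving_subordinator \<kappa> \<mu> N S by fact
      have i: "integrable N (\<lambda>\<omega>. iexp (\<theta> * inverse_time S t \<omega>))"
        by (rule integrable_iexp) auto
      have e: "char (distr N borel (inverse_time S t)) \<theta> = (CLINT \<omega>|N. iexp (\<theta> * inverse_time S t \<omega>))"
        unfolding char_def by (subst integral_distr) auto
      show "Re (char (distr N borel (inverse_time S t)) \<theta>) = (\<integral>\<omega>. cos (\<theta> * inverse_time S t \<omega>) \<partial>N)"
        unfolding e integral_Re[OF i, symmetric] by (simp add: Re_exp)
      show "Im (char (distr N borel (inverse_time S t)) \<theta>) = (\<integral>\<omega>. sin (\<theta> * inverse_time S t \<omega>) \<partial>N)"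
        unfolding e integral_Im[OF i, symmetric] by (simp add: Im_exp)
    qed
    show "char (distr N1 borel (inverse_time S1 t)) \<theta> = char (distr N2 borel (inverse_time S2 t)) \<theta>"
      by (rule complex_eqI)
         (simp_all add: Re_Im[OF N1] Re_Im[OF N2] eq[of "\<lambda>s. cos (\<theta> * s)"] eq[of "\<lambda>s. sin (\<theta> * s)"] continuous_intros)
  qed
qed

section \<open>The time-changed semigroup\<close>

text \<open>Vector identities are checked on bounded functionals.  Separation of points is an assumption of the
  locale; in a Banach space of functions it is seen directly.\<close>
locale time_changed_semigroup =
  driving_subordinator \<kappa> \<mu> N S + bounded_semigroup P
  for \<kappa> :: real and \<mu> :: "real measure" and N :: "'w measure" and S :: "real \<Rightarrow> 'w \<Rightarrow> real"
    and P :: "real \<Rightarrow> 'b \<Rightarrow>\<^sub>L 'b::banach" +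
  assumes functionals_separate: "\<And>y::'b. (\<And>\<psi>::'b \<Rightarrow> real. bounded_linear \<psi> \<Longrightarrow> \<psi> y = 0) \<Longrightarrow> y = 0"
begin

lemma functionals_eqI:
  fixes y z :: 'b
  assumes "\<And>\<psi>::'b \<Rightarrow> real. bounded_linear \<psi> \<Longrightarrow> \<psi> y = \<psi> z"
  shows "y = z"
proof -
  have "y - z = 0"
    using assms by (intro functionals_separate) (simp add: bounded_linear.linear linear_diff)
  then show ?thesis by simp
qed

text \<open>The operators \<open>g \<mapsto> \<E>[P (T t) g]\<close>.  They commute with the semigroup, but in general they do not form a
  semigroup in \<open>t\<close>.\<close>
definition A :: "real \<Rightarrow> 'b \<Rightarrow> 'b" where
  "A t g = banach_integral N (\<lambda>\<omega>. P (T t \<omega>) g)"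

lemma continuous_P_max: "continuous_on UNIV (\<lambda>s. P (max 0 s) g)"
  by (rule continuous_on_compose2[OF continuous_P]) (auto intro!: continuous_intros)

lemma has_banach_integral_A: "has_banach_integral N (\<lambda>\<omega>. P (T t \<omega>) g) (A t g)"
proof -
  have "banach_integrable N (\<lambda>\<omega>. 1 *\<^sub>R P (max 0 (T t \<omega>)) g)"
    by (rule banach_integrable_scaleR_continuous[OF _ T_measurable continuous_P_max])
       (auto intro: norm_P)
  then show ?thesis
    unfolding A_def by (intro banach_integrable_integral) simp
qed

lemma functional_A:
  assumes "bounded_linear (\<psi> :: 'b \<Rightarrow> real)"
  shows "\<psi> (A t g) = (\<integral>\<omega>. \<psi> (P (T t \<omega>) g) \<partial>N)"
  using has_banach_integral_real(2)[OF has_banach_integral_bounded_linear[OF assms has_banach_integral_A]]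
  by simp

lemma functional_A_integrable:
  assumes "bounded_linear (\<psi> :: 'b \<Rightarrow> real)"
  shows "integrable N (\<lambda>\<omega>. \<psi> (P (T t \<omega>) g))"
  by (rule has_banach_integral_real(1)[OF has_banach_integral_bounded_linear[OF assms has_banach_integral_A]])

lemma A_diff: "A t (g - h) = A t g - A t h"
proof (rule functionals_eqI)
  fix \<psi> :: "'b \<Rightarrow> real" assume \<psi>: "bounded_linear \<psi>"
  interpret \<psi>: bounded_linear \<psi> by fact
  show "\<psi> (A t (g - h)) = \<psi> (A t g - A t h)"
    using functional_A_integrable[OF \<psi>]
    by (simp add: functional_A[OF \<psi>] \<psi>.diff blinfun.diff_right)
qed

lemma A_scaleR: "A t (r *\<^sub>R g) = r *\<^sub>R A t g"
proof (rule functionals_eqI)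
  fix \<psi> :: "'b \<Rightarrow> real" assume \<psi>: "bounded_linear \<psi>"
  interpret \<psi>: bounded_linear \<psi> by fact
  show "\<psi> (A t (r *\<^sub>R g)) = \<psi> (r *\<^sub>R A t g)"
    by (simp add: functional_A[OF \<psi>] \<psi>.scaleR blinfun.scaleR_right)
qed

lemma A_commute:
  assumes h: "0 \<le> h" shows "A t (P h g) = P h (A t g)"
proof -
  have "P (T t \<omega>) (P h g) = P h (P (T t \<omega>) g)" for \<omega>
    using P_add[OF T_nonneg h, of t \<omega> g] P_add[OF h T_nonneg, of t \<omega> g] by (simp add: add.commute)
  then have "has_banach_integral N (\<lambda>\<omega>. P (T t \<omega>) (P h g)) (P h (A t g))"
    using has_banach_integral_bounded_linear[OF blinfun.bounded_linear_right has_banach_integral_A, of "P h"]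
    by simp
  then show ?thesis by (rule has_banach_integral_unique[OF has_banach_integral_A])
qed

lemma norm_P_T_measurable: "(\<lambda>\<omega>. norm (P (T s \<omega>) g - P (T t \<omega>) g)) \<in> borel_measurable N"
proof -
  have "(\<lambda>\<omega>. (T s \<omega>, T t \<omega>)) \<in> N \<rightarrow>\<^sub>M borel" by measurable
  moreover have "continuous_on UNIV (\<lambda>p. norm (P (max 0 (fst p)) g - P (max 0 (snd p)) g))"
    by (intro continuous_intros continuous_on_compose2[OF continuous_P_max[of g]]) auto
  ultimately have "(\<lambda>\<omega>. norm (P (max 0 (fst (T s \<omega>, T t \<omega>))) g - P (max 0 (snd (T s \<omega>, T t \<omega>))) g)) \<in> borel_measurable N"
    by (rule measurable_compose[OF _ borel_measurable_continuous_onI])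
  then show ?thesis by simp
qed

lemma norm_A: "norm (A t g) \<le> K * norm g"
proof -
  have "ennreal (norm (A t g - 0)) \<le> (\<integral>\<^sup>+\<omega>. ennreal (norm (P (T t \<omega>) g - 0)) \<partial>N)"
  proof (rule has_banach_integral_dist_le[OF has_banach_integral_A has_banach_integral_zero[OF has_banach_integral_A]])
    have "(\<lambda>\<omega>. P (T t \<omega>) g) \<in> borel_measurable N"
      using has_banach_integral_A unfolding has_banach_integral_def by blast
    from measurable_compose[OF this borel_measurable_continuous_onI[of norm]]
    show "(\<lambda>\<omega>. norm (P (T t \<omega>) g - 0)) \<in> borel_measurable N"
      by (simp add: continuous_on_norm_id)
  qed
  also have "\<dots> \<le> (\<integral>\<^sup>+\<omega>. ennreal (K * norm g) \<partial>N)"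
    by (intro nn_integral_mono ennreal_leI) (simp add: norm_P)
  also have "\<dots> = ennreal (K * norm g)" by (simp add: emeasure_space_1)
  finally show ?thesis
    using K_ge_1 by (simp add: ennreal_le_iff)
qed

text \<open>Dominated convergence for \<open>norm (P (T s) g - P (T t) g)\<close>, using continuity of the paths of \<open>T\<close>.\<close>
lemma continuous_A: "continuous_on {0..} (\<lambda>t. A t g)"
proof (rule continuous_on_sequentiallyI)
  fix x t assume x: "x \<longlonglongrightarrow> (t::real)"
  let ?d = "\<lambda>n \<omega>. norm (P (T (x n) \<omega>) g - P (T t \<omega>) g)"
  have "(\<lambda>n. \<integral>\<^sup>+\<omega>. ennreal (norm (0 - ?d n \<omega>)) \<partial>N) \<longlonglongrightarrow> 0"
  proof (rule nn_integral_dominated_convergence_norm[where w = "\<lambda>_. 2 * (K * norm g)"])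
    show "AE \<omega> in N. norm (?d n \<omega>) \<le> 2 * (K * norm g)" for n
    proof (rule AE_I2)
      fix \<omega>
      show "norm (?d n \<omega>) \<le> 2 * (K * norm g)"
        using norm_triangle_ineq4[of "P (T (x n) \<omega>) g" "P (T t \<omega>) g"]
          norm_P[OF T_nonneg, of "x n" \<omega> g] norm_P[OF T_nonneg, of t \<omega> g] by simp
    qed
    show "(\<integral>\<^sup>+\<omega>. ennreal (2 * (K * norm g)) \<partial>N) < \<infinity>" by (simp add: emeasure_space_1)
    show "AE \<omega> in N. (\<lambda>n. ?d n \<omega>) \<longlonglongrightarrow> 0"
      using AE_T_continuous
    proof eventually_elim
      case (elim \<omega>)
      then have "(\<lambda>n. T (x n) \<omega>) \<longlonglongrightarrow> T t \<omega>"
        using isCont_tendsto_compose[OF _ x] by blast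
      then have "(\<lambda>n. P (T (x n) \<omega>) g) \<longlonglongrightarrow> P (T t \<omega>) g"
        by (rule continuous_on_tendsto_compose[OF continuous_P]) auto
      from tendsto_norm[OF tendsto_diff[OF this tendsto_const[of "P (T t \<omega>) g"]]]
      show ?case by simp
    qed
  qed (use norm_P_T_measurable in auto)
  then have lim: "(\<lambda>n. \<integral>\<^sup>+\<omega>. ennreal (?d n \<omega>) \<partial>N) \<longlonglongrightarrow> 0" by simp
  have "(\<lambda>n. ennreal (norm (A (x n) g - A t g))) \<longlonglongrightarrow> 0"
    by (rule tendsto_sandwich[OF _ _ tendsto_const lim])
       (auto intro!: always_eventually has_banach_integral_dist_le has_banach_integral_A norm_P_T_measurable)
  then have "(\<lambda>n. norm (A (x n) g - A t g)) \<longlonglongrightarrow> 0"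
    by (simp add: ennreal_tendsto_0_iff)
  then show "(\<lambda>n. A (x n) g) \<longlonglongrightarrow> A t g"
    by (simp add: tendsto_norm_zero_iff LIM_zero_iff)
qed

lemma A_zero: "A 0 g = g"
proof (rule functionals_eqI)
  fix \<psi> :: "'b \<Rightarrow> real" assume \<psi>: "bounded_linear \<psi>"
  have "\<psi> (A 0 g) = (\<integral>\<omega>. \<psi> g \<partial>N)"
    unfolding functional_A[OF \<psi>]
  proof (rule integral_cong_AE)
    show "AE \<omega> in N. \<psi> (P (T 0 \<omega>) g) = \<psi> g"
      using AE_T_zero by eventually_elim simp
  qed (use functional_A_integrable[OF \<psi>] in auto)
  then show "\<psi> (A 0 g) = \<psi> g" by (simp add: prob_space)
qed

text \<open>\<open>A t\<close> commutes with the semigroup and is bounded, so it may be applied to the difference quotients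
  that define the generator.\<close>
lemma generator_A:
  assumes g: "g \<in> generator_domain P"
  shows "A t g \<in> generator_domain P" and "generator P (A t g) = A t (generator P g)"
proof -
  let ?D = "\<lambda>h. (P h g - g) /\<^sub>R h"
  have "((\<lambda>h. K * norm (?D h - generator P g)) \<longlongrightarrow> K * norm (generator P g - generator P g)) (at_right 0)"
    by (intro tendsto_intros tendsto_generator[OF g])
  then have lim: "((\<lambda>h. K * norm (?D h - generator P g)) \<longlongrightarrow> 0) (at_right 0)" by simp
  have "((\<lambda>h. A t (?D h) - A t (generator P g)) \<longlongrightarrow> 0) (at_right 0)"
    by (rule Lim_null_comparison[OF _ lim]) (simp add: A_diff[symmetric] norm_A)
  then have "((\<lambda>h. A t (?D h)) \<longlongrightarrow> A t (generator P g)) (at_right 0)"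
    by (simp add: LIM_zero_iff)
  moreover have "\<forall>\<^sub>F h in at_right 0. A t (?D h) = (P h (A t g) - A t g) /\<^sub>R h"
    using eventually_at_right_less[of 0]
    by eventually_elim (simp add: A_scaleR A_diff A_commute)
  ultimately have "((\<lambda>h. (P h (A t g) - A t g) /\<^sub>R h) \<longlongrightarrow> A t (generator P g)) (at_right 0)"
    by (rule Lim_transform_eventually)
  then show "A t g \<in> generator_domain P" "generator P (A t g) = A t (generator P g)"
    by (rule generatorI)+
qed

text \<open>The transform of \<open>t \<mapsto> A t g\<close> is \<open>\<Phi> l / l\<close> times the resolvent of the generator at \<open>\<Phi> l\<close>.\<close>
lemma laplace_functional_A:
  assumes \<psi>: "bounded_linear (\<psi> :: 'b \<Rightarrow> real)" and l: "0 < l"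
  shows "laplace l (causal (\<lambda>t. \<psi> (A t g))) = \<Phi> l / l * resolvent_functional (\<Phi> l) \<psi> g"
proof -
  obtain B where B: "\<And>s. 0 \<le> s \<Longrightarrow> \<bar>\<psi> (P s g)\<bar> \<le> B * norm g"
    using functional_P_bound[OF \<psi>] by auto
  show ?thesis
    unfolding functional_A[OF \<psi>] resolvent_functional_def
    by (rule laplace_expectation_T[OF l continuous_functional_P[OF \<psi>] B])
qed

end

section \<open>The time fractional equation\<close>

context time_changed_semigroup
begin

lemma levy_tail_integrable_reflected:
  "integrable (restrict_space lborel {0<..<t}) (\<lambda>s. w (t - s))"
proof -
  have "integrable lborel (\<lambda>s. exp (- 1 * s) * w s)"
    using laplace_levy_tail(1)[of 1] by (simp add: laplace_integrable_def)
  from lborel_integrable_real_affine[OF this, of "-1" t]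
  have I: "integrable lborel (\<lambda>s. exp (- 1 * (t - s)) * w (t - s))" by simp
  have wm: "(\<lambda>s. w (t - s)) \<in> borel_measurable lborel"
    using measurable_compose[OF _ levy_tail_measurable, of "\<lambda>s. t - s" borel] by simp
  have "integrable lborel (\<lambda>s. indicator {0<..<t} s *\<^sub>R w (t - s))"
  proof (rule Bochner_Integration.integrable_bound)
    show "integrable lborel (\<lambda>s. exp t * (exp (- 1 * (t - s)) * w (t - s)))"
      using I by (rule integrable_mult_right)
    show "AE s in lborel. norm (indicator {0<..<t} s *\<^sub>R w (t - s)) \<le> norm (exp t * (exp (- 1 * (t - s)) * w (t - s)))"
    proof (rule AE_I2)
      fix s
      have "1 * w (t - s) \<le> exp s * w (t - s)" if "0 < s"
        using that by (intro mult_right_mono levy_tail_nonneg) auto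
      moreover have "exp t * (exp (- 1 * (t - s)) * w (t - s)) = exp s * w (t - s)"
        by (simp add: exp_diff field_simps)
      ultimately show "norm (indicator {0<..<t} s *\<^sub>R w (t - s)) \<le> norm (exp t * (exp (- 1 * (t - s)) * w (t - s)))"
        using levy_tail_nonneg[of "t - s"] by (simp only:) (auto simp: indicator_def)
    qed
  qed (use wm in \<open>intro borel_measurable_scaleR borel_measurable_indicator; simp\<close>)
  then show ?thesis
    by (subst integrable_restrict_space) (auto simp: mult.commute)
qed

lemma has_banach_integral_frac_integral:
  fixes v :: "real \<Rightarrow> 'b"
  assumes v: "continuous_on {0..} v" and B: "\<And>s. 0 \<le> s \<Longrightarrow> norm (v s) \<le> B"
  shows "has_banach_integral (restrict_space lborel {0<..<t}) (frac_integrand w f v t) (frac_integral w f v t)"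
proof -
  let ?M = "restrict_space lborel {0<..<t}"
  have "continuous_on UNIV (\<lambda>s. v (max 0 s) - f)"
    by (intro continuous_intros continuous_on_compose2[OF v]) auto
  moreover have "norm (v (max 0 s) - f) \<le> B + norm f" for s
    using norm_triangle_ineq4[of "v (max 0 s)" f] B[of "max 0 s"] by simp
  ultimately have "banach_integrable ?M (\<lambda>s. w (t - s) *\<^sub>R (v (max 0 s) - f))"
    by (intro banach_integrable_scaleR_continuous[where T = "\<lambda>s. s"] levy_tail_integrable_reflected)
       (auto intro: measurable_restrict_space1)
  then obtain y where "has_banach_integral ?M (\<lambda>s. w (t - s) *\<^sub>R (v (max 0 s) - f)) y"
    unfolding banach_integrable_def by blast
  then have "has_banach_integral ?M (frac_integrand w f v t) y"
    by (subst has_banach_integral_cong[where g = "\<lambda>s. w (t - s) *\<^sub>R (v (max 0 s) - f)"])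
       (auto simp: frac_integrand_def space_restrict_space)
  then show ?thesis unfolding frac_integral_def by (simp add: banach_integral_eq)
qed

lemma functional_frac_integral:
  fixes v :: "real \<Rightarrow> 'b"
  assumes v: "continuous_on {0..} v" and B: "\<And>s. 0 \<le> s \<Longrightarrow> norm (v s) \<le> B"
    and \<psi>: "bounded_linear (\<psi> :: 'b \<Rightarrow> real)"
  shows "\<psi> (frac_integral w f v t) = fun_convolution w (causal (\<lambda>s. \<psi> (v s) - \<psi> f)) t"
proof -
  interpret \<psi>: bounded_linear \<psi> by fact
  have "\<psi> (frac_integral w f v t) = (\<integral>s. \<psi> (frac_integrand w f v t s) \<partial>restrict_space lborel {0<..<t})"
    using has_banach_integral_real(2)[OF has_banach_integral_bounded_linear[OF \<psi>
        has_banach_integral_frac_integral[OF v B]]] by simp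
  also have "\<dots> = (\<integral>s. indicator {0<..<t} s *\<^sub>R \<psi> (frac_integrand w f v t s) \<partial>lborel)"
    by (rule integral_restrict_space) simp
  also have "\<dots> = (\<integral>s. w (t - s) * causal (\<lambda>s. \<psi> (v s) - \<psi> f) s \<partial>lborel)"
  proof (rule integral_cong_AE)
    have c: "continuous_on {0..} (\<lambda>s. \<psi> (v s) - \<psi> f)"
      by (intro continuous_intros \<psi>.continuous_on v)
    show m: "(\<lambda>s. w (t - s) * causal (\<lambda>s. \<psi> (v s) - \<psi> f) s) \<in> borel_measurable lborel"
      by (intro borel_measurable_times)
         (use causal_measurable[OF c] measurable_compose[OF _ levy_tail_measurable, of "\<lambda>s. t - s"] in auto)
    have eq: "indicator {0<..<t} s *\<^sub>R \<psi> (frac_integrand w f v t s) =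
        indicator {0<..<t} s * (w (t - s) * causal (\<lambda>s. \<psi> (v s) - \<psi> f) s)" for s
      by (auto simp: indicator_def frac_integrand_def \<psi>.scaleR \<psi>.diff)
    show "(\<lambda>s. indicator {0<..<t} s *\<^sub>R \<psi> (frac_integrand w f v t s)) \<in> borel_measurable lborel"
      unfolding eq using m by measurable
    show "AE s in lborel. indicator {0<..<t} s *\<^sub>R \<psi> (frac_integrand w f v t s) =
        w (t - s) * causal (\<lambda>s. \<psi> (v s) - \<psi> f) s"
      using AE_lborel_singleton[of 0]
    proof eventually_elim
      case (elim s)
      then show ?case
        unfolding eq by (cases "s < 0") (auto simp: indicator_def levy_tail_nonpos)
    qed
  qed
  finally show ?thesis by (simp add: fun_convolution_def)
qed

text \<open>The quantity whose time derivative appears in the equation, for a scalar function \<open>z\<close> in place of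
  \<open>u - f\<close>.\<close>
definition frac_potential :: "(real \<Rightarrow> real) \<Rightarrow> real \<Rightarrow> real" where
  "frac_potential z t = \<kappa> * z t + fun_convolution w (causal z) t"

lemma fun_convolution_levy_tail_nonpos:
  assumes "t \<le> 0" shows "fun_convolution w (causal z) t = 0"
proof -
  have "w (t - s) * causal z s = 0" for s
    using assms by (cases "s < 0") (auto simp: levy_tail_nonpos)
  then show ?thesis by (simp only: fun_convolution_def integral_zero)
qed

lemma causal_fun_convolution_levy_tail:
  "causal (fun_convolution w (causal z)) = fun_convolution w (causal z)"
  by (auto simp: causal_def indicator_def fun_eq_iff fun_convolution_levy_tail_nonpos)

context
  fixes z :: "real \<Rightarrow> real" and B :: real
  assumes z: "continuous_on {0..} z" and z0: "z 0 = 0" and B: "\<And>t. 0 \<le> t \<Longrightarrow> \<bar>z t\<bar> \<le> B"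
begin

lemma continuous_frac_potential: "continuous_on {0..} (frac_potential z)"
  unfolding frac_potential_def
  by (intro continuous_intros z continuous_on_subset[OF continuous_convolution[OF laplace_levy_tail(1)]] z0)
     (auto simp: levy_tail_nonpos intro: B)

lemma frac_potential_zero: "frac_potential z 0 = 0"
  by (simp add: frac_potential_def z0 fun_convolution_levy_tail_nonpos)

text \<open>The transform of \<open>w\<close> is \<open>\<Phi> l / l - \<kappa>\<close>, so the drift term completes it to the factor \<open>\<Phi> l / l\<close>.\<close>
lemma laplace_frac_potential:
  assumes l: "0 < l"
  shows "laplace_integrable l (causal (frac_potential z))"
    and "laplace l (causal (frac_potential z)) = \<Phi> l / l * laplace l (causal z)"
proof -
  have eq: "causal (frac_potential z) = (\<lambda>t. \<kappa> * causal z t + 1 * fun_convolution w (causal z) t)"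
    using causal_fun_convolution_levy_tail[of z]
    by (auto simp: frac_potential_def causal_def fun_eq_iff algebra_simps)
  have zi: "laplace_integrable l (causal z)" by (rule laplace_integrable_bounded[OF l z B])
  note c = laplace_convolution[OF laplace_levy_tail(1)[OF l] zi]
  show "laplace_integrable l (causal (frac_potential z))"
    unfolding eq by (rule laplace_lincomb(1)[OF zi c(1)])
  show "laplace l (causal (frac_potential z)) = \<Phi> l / l * laplace l (causal z)"
    unfolding eq laplace_lincomb(2)[OF zi c(1)] c(2) laplace_levy_tail(2)[OF l]
    using l by (simp add: field_simps)
qed

end

lemma functional_bound:
  assumes "bounded_linear (\<psi> :: 'b \<Rightarrow> real)" "\<And>s. 0 \<le> s \<Longrightarrow> norm (v s) \<le> B"
  shows "\<exists>C. \<forall>s\<ge>0. \<bar>\<psi> (v s)\<bar> \<le> C"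
proof -
  obtain C where C: "0 < C" "\<And>x. norm (\<psi> x) \<le> norm x * C"
    using bounded_linear.pos_bounded[OF assms(1)] by blast
  have "\<bar>\<psi> (v s)\<bar> \<le> B * C" if "0 \<le> s" for s
    using C(2)[of "v s"] mult_right_mono[OF assms(2)[OF that] less_imp_le[OF C(1)]] by simp
  then show ?thesis by blast
qed

text \<open>Tested with \<open>\<psi>\<close> and Laplace transformed, the identity reads
  \<open>(\<Phi> l / l) ((\<Phi> l / l) R g - g / l) = (1 / l) (\<Phi> l / l) R (L g)\<close> with \<open>R\<close> the resolvent at \<open>\<Phi> l\<close>,
  which is the resolvent identity.\<close>
lemma integrated_equation_A:
  assumes g: "g \<in> generator_domain P" and t: "0 \<le> t"
  shows "\<kappa> *\<^sub>R (A t g - g) + frac_integral w g (\<lambda>t. A t g) t = integral {0..t} (\<lambda>s. A s (generator P g))"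
proof (rule functionals_eqI)
  fix \<psi> :: "'b \<Rightarrow> real" assume \<psi>: "bounded_linear \<psi>"
  interpret \<psi>: bounded_linear \<psi> by fact
  let ?L = "generator P g"
  let ?z = "\<lambda>t. \<psi> (A t g) - \<psi> g" and ?r = "\<lambda>t. \<psi> (A t ?L)"
  have uc: "continuous_on {0..} (\<lambda>t. \<psi> (A t h))" for h by (intro \<psi>.continuous_on continuous_A)
  obtain C where C: "\<And>t. 0 \<le> t \<Longrightarrow> \<bar>\<psi> (A t g)\<bar> \<le> C"
    using functional_bound[OF \<psi>, of "\<lambda>t. A t g"] norm_A by blast
  obtain C' where C': "\<And>t. 0 \<le> t \<Longrightarrow> \<bar>?r t\<bar> \<le> C'"
    using functional_bound[OF \<psi>, of "\<lambda>t. A t ?L"] norm_A by blast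
  have zc: "continuous_on {0..} ?z" by (intro continuous_intros uc)
  have z0: "?z 0 = 0" by (simp add: A_zero)
  have zb: "\<bar>?z t\<bar> \<le> C + \<bar>\<psi> g\<bar>" if "0 \<le> t" for t using C[OF that] by simp
  have rc: "continuous_on {0..} ?r" by (rule uc)
  have "frac_potential ?z t = integral {0..t} ?r"
  proof (rule laplace_unique[OF continuous_frac_potential[OF zc z0 zb] _ _ _ _ t])
    show "continuous_on {0..} (\<lambda>t. integral {0..t} ?r)"
      by (rule continuous_on_integral_atLeast[OF rc])
    fix l :: real assume l: "0 < l"
    have ri: "laplace_integrable l (causal ?r)"
      by (rule laplace_integrable_bounded[OF l rc C'])
    show "laplace_integrable l (causal (frac_potential ?z))"
      by (rule laplace_frac_potential(1)[OF zc z0 zb l])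
    show "laplace_integrable l (causal (\<lambda>t. integral {0..t} ?r))"
      by (rule laplace_integral(1)[OF l rc ri])
    show "laplace l (causal (frac_potential ?z)) = laplace l (causal (\<lambda>t. integral {0..t} ?r))"
    proof -
      have fp: "laplace l (causal (frac_potential ?z)) = \<Phi> l / l * laplace l (causal ?z)"
        by (rule laplace_frac_potential(2)[OF zc z0 zb l])
      have sh: "laplace l (causal ?z) = laplace l (causal (\<lambda>t. \<psi> (A t g))) - \<psi> g / l"
        by (rule laplace_shift[OF l uc C])
      show ?thesis
        unfolding fp sh laplace_integral(2)[OF l rc ri] laplace_functional_A[OF \<psi> l]
          resolvent_functional_generator[OF \<psi> \<Phi>_pos[OF l] g]
        using l by (simp add: field_simps)
    qed
  qed
  moreover have "\<psi> (integral {0..t} (\<lambda>s. A s ?L)) = integral {0..t} ?r"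
  proof -
    have "(\<lambda>s. A s ?L) integrable_on {0..t}"
      by (intro integrable_continuous_real continuous_on_subset[OF continuous_A]) auto
    from integral_linear[OF this \<psi>] show ?thesis by (simp add: o_def)
  qed
  moreover have "\<psi> (frac_integral w g (\<lambda>t. A t g) t) = fun_convolution w (causal ?z) t"
    by (rule functional_frac_integral[OF continuous_A norm_A \<psi>])
  ultimately show "\<psi> (\<kappa> *\<^sub>R (A t g - g) + frac_integral w g (\<lambda>t. A t g) t) =
      \<psi> (integral {0..t} (\<lambda>s. A s ?L))"
    by (simp add: frac_potential_def \<psi>.add \<psi>.diff \<psi>.scaleR)
qed

lemma strong_solution_A:
  assumes g: "g \<in> generator_domain P"
  shows "strong_solution \<kappa> w P g (\<lambda>t. A t g)"
  unfolding strong_solution_def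
proof (intro conjI allI impI)
  let ?L = "generator P g"
  note gen = generator_A[OF g]
  show "A 0 g = g" by (rule A_zero)
  show "bounded ((\<lambda>t. A t g) ` {0<..})" using norm_A by (auto simp: bounded_iff)
  show "A t g \<in> generator_domain P" for t by (rule gen(1))
  show "bounded ((\<lambda>t. generator P (A t g)) ` {0..})"
    unfolding gen(2) using norm_A by (auto simp: bounded_iff)
  show "continuous_on {0..} (\<lambda>t. A t g)" by (rule continuous_A)
  show "continuous_on {0..} (\<lambda>t. generator P (A t g))" unfolding gen(2) by (rule continuous_A)
  fix t :: real assume t: "0 < t"
  show "banach_integrable (restrict_space lborel {0<..<t}) (frac_integrand w g (\<lambda>t. A t g) t)"
    using has_banach_integral_frac_integral[OF continuous_A norm_A] unfolding banach_integrable_def by blast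
  let ?F = "\<lambda>t. integral {0..t} (\<lambda>s. A s ?L)"
  have "(?F has_vector_derivative A t ?L) (at t within {0..t + 1})"
    using t by (intro integral_has_vector_derivative continuous_on_subset[OF continuous_A]) auto
  then have "(?F has_vector_derivative A t ?L) (at t)"
    using t by (simp add: at_within_interior[of t "{0..t+1}"])
  then have "((\<lambda>x. (?F x - ?F t) /\<^sub>R (x - t)) \<longlongrightarrow> A t ?L) (at t)"
    by (simp only: has_vector_derivative_iff_difference_quotient)
  then have "((\<lambda>d. (?F (t + d) - ?F t) /\<^sub>R d) \<longlongrightarrow> A t ?L) (at 0)"
    by (simp add: LIM_offset_zero_iff)
  moreover have "\<forall>\<^sub>F d in at 0. (?F (t + d) - ?F t) /\<^sub>R d =
     (1 / d) *\<^sub>R (\<kappa> *\<^sub>R (A (t + d) g - A t g) + frac_integral w g (\<lambda>t. A t g) (t + d) - frac_integral w g (\<lambda>t. A t g) t)"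
  proof -
    have "\<forall>\<^sub>F d in at 0. - t < d"
      using t by (intro order_tendstoD(1)[OF tendsto_ident_at]) auto
    then show ?thesis
    proof eventually_elim
      case (elim d)
      have "?F (t + d) - ?F t = \<kappa> *\<^sub>R (A (t + d) g - A t g) + frac_integral w g (\<lambda>t. A t g) (t + d) - frac_integral w g (\<lambda>t. A t g) t"
        using integrated_equation_A[OF g, of t] integrated_equation_A[OF g, of "t + d"] t elim
        by (simp add: algebra_simps)
      then show ?case by (simp add: inverse_eq_divide)
    qed
  qed
  ultimately show "((\<lambda>d. (1 / d) *\<^sub>R (\<kappa> *\<^sub>R (A (t + d) g - A t g) +
      frac_integral w g (\<lambda>t. A t g) (t + d) - frac_integral w g (\<lambda>t. A t g) t)) \<longlongrightarrow> generator P (A t g)) (at 0)"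
    unfolding gen(2) by (rule Lim_transform_eventually)
qed

text \<open>Every strong solution has the Laplace transform of \<open>A t g\<close>.  The transformed equation relates the
  transforms of \<open>\<eta> (v t)\<close> and \<open>\<eta> (L (v t))\<close> for each bounded functional \<open>\<eta>\<close>; the resolvent functional turns the
  second one into the first one and \<open>\<psi> (v t)\<close>.\<close>
lemma strong_solution_laplace:
  assumes v: "strong_solution \<kappa> w P g v" and \<psi>: "bounded_linear (\<psi> :: 'b \<Rightarrow> real)" and l: "0 < l"
  shows "laplace l (causal (\<lambda>t. \<psi> (v t))) = \<Phi> l / l * resolvent_functional (\<Phi> l) \<psi> g"
proof -
  have v0: "v 0 = g" and vbd: "bounded (v ` {0<..})"
    and vdom: "\<And>t. 0 \<le> t \<Longrightarrow> v t \<in> generator_domain P"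
    and Lbd: "bounded ((\<lambda>t. generator P (v t)) ` {0..})"
    and vc: "continuous_on {0..} v" and Lc: "continuous_on {0..} (\<lambda>t. generator P (v t))"
    and lim: "\<And>t. 0 < t \<Longrightarrow> ((\<lambda>\<delta>. (1 / \<delta>) *\<^sub>R (\<kappa> *\<^sub>R (v (t + \<delta>) - v t) +
                 frac_integral w g v (t + \<delta>) - frac_integral w g v t))
          \<longlongrightarrow> generator P (v t)) (at 0)"
    using v unfolding strong_solution_def by blast+
  obtain B1 where B1: "\<And>t. 0 < t \<Longrightarrow> norm (v t) \<le> B1" using vbd by (auto simp: bounded_iff)
  have B: "norm (v t) \<le> max B1 (norm g)" if "0 \<le> t" for t
    using B1[of t] v0 that by (cases "t = 0") auto
  obtain B2 where B2: "\<And>t. 0 \<le> t \<Longrightarrow> norm (generator P (v t)) \<le> B2" using Lbd by (auto simp: bounded_iff)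
  have key: "\<Phi> l * (laplace l (causal (\<lambda>t. \<eta> (v t))) - \<eta> g / l) = laplace l (causal (\<lambda>t. \<eta> (generator P (v t))))"
    if \<eta>: "bounded_linear \<eta>" for \<eta> :: "'b \<Rightarrow> real"
  proof -
    interpret \<eta>: bounded_linear \<eta> by fact
    let ?z = "\<lambda>t. \<eta> (v t) - \<eta> g" and ?r = "\<lambda>t. \<eta> (generator P (v t))"
    have uc: "continuous_on {0..} (\<lambda>t. \<eta> (v t))" and rc: "continuous_on {0..} ?r"
      by (intro \<eta>.continuous_on vc Lc)+
    obtain C where C: "\<And>t. 0 \<le> t \<Longrightarrow> \<bar>\<eta> (v t)\<bar> \<le> C"
    using functional_bound[OF \<eta>, of "v", OF B] by force
    obtain C' where C': "\<And>t. 0 \<le> t \<Longrightarrow> \<bar>?r t\<bar> \<le> C'"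
    using functional_bound[OF \<eta>, of "\<lambda>t. generator P (v t)", OF B2] by force
    have zc: "continuous_on {0..} ?z" by (intro continuous_intros uc)
    have z0: "?z 0 = 0" by (simp add: v0)
    have zb: "\<bar>?z t\<bar> \<le> C + \<bar>\<eta> g\<bar>" if "0 \<le> t" for t using C[OF that] by simp
    have ri: "laplace_integrable l (causal ?r)" by (rule laplace_integrable_bounded[OF l rc C'])
    have fp: "frac_potential ?z t = \<eta> (\<kappa> *\<^sub>R (v t - g) + frac_integral w g v t)" for t
      by (simp add: frac_potential_def functional_frac_integral[OF vc B \<eta>] \<eta>.add \<eta>.diff \<eta>.scaleR)
    have "integral {0..t} ?r = frac_potential ?z t" if t: "0 \<le> t" for t
    proof -
      have "(?r has_integral (frac_potential ?z t - frac_potential ?z 0)) {0..t}"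
      proof (rule fundamental_theorem_of_calculus_interior[OF t])
        show "continuous_on {0..t} (frac_potential ?z)"
          by (rule continuous_on_subset[OF continuous_frac_potential[OF zc z0 zb]]) auto
        fix x assume "x \<in> {0<..<t}"
        then have x: "0 < x" by simp
        have "(frac_potential ?z (x + d) - frac_potential ?z x) / d =
            \<eta> ((1 / d) *\<^sub>R (\<kappa> *\<^sub>R (v (x + d) - v x) + frac_integral w g v (x + d) - frac_integral w g v x))" for d
          unfolding fp by (simp add: \<eta>.scaleR \<eta>.diff \<eta>.add diff_divide_distrib add_divide_distrib algebra_simps)
        with \<eta>.tendsto[OF lim[OF x]]
        have "((\<lambda>d. (frac_potential ?z (x + d) - frac_potential ?z x) / d) \<longlongrightarrow> ?r x) (at 0)"
          by (simp only:)
        then have "DERIV (frac_potential ?z) x :> ?r x" by (simp add: DERIV_def)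
        then show "(frac_potential ?z has_vector_derivative ?r x) (at x)"
          by (simp add: has_real_derivative_iff_has_vector_derivative)
      qed
      then show ?thesis using frac_potential_zero[OF zc z0 zb] by (simp add: integral_unique)
    qed
    then have "causal (\<lambda>t. integral {0..t} ?r) = causal (frac_potential ?z)"
      by (auto simp: causal_def indicator_def fun_eq_iff)
    moreover have "laplace l (causal (frac_potential ?z)) = \<Phi> l / l * laplace l (causal ?z)"
      by (rule laplace_frac_potential(2)[OF zc z0 zb l])
    moreover have "laplace l (causal ?z) = laplace l (causal (\<lambda>t. \<eta> (v t))) - \<eta> g / l"
      by (rule laplace_shift[OF l uc C])
    ultimately show ?thesis
      using laplace_integral(2)[OF l rc ri] l by (simp add: field_simps)
  qed
  have c: "0 < \<Phi> l" by (rule \<Phi>_pos[OF l])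
  \<comment> \<open>Testing with the resolvent functional eliminates the generator.\<close>
  let ?\<rho> = "resolvent_functional (\<Phi> l) \<psi>"
  have \<rho>: "bounded_linear ?\<rho>" by (rule bounded_linear_resolvent_functional[OF \<psi> c])
  obtain C1 where C1: "\<And>t. 0 \<le> t \<Longrightarrow> \<bar>\<psi> (v t)\<bar> \<le> C1"
    using functional_bound[OF \<psi>, of v, OF B] by force
  obtain C2 where C2: "\<And>t. 0 \<le> t \<Longrightarrow> \<bar>?\<rho> (v t)\<bar> \<le> C2"
    using functional_bound[OF \<rho>, of v, OF B] by force
  have i: "laplace_integrable l (causal (\<lambda>t. \<psi> (v t)))" "laplace_integrable l (causal (\<lambda>t. ?\<rho> (v t)))"
    by (rule laplace_integrable_bounded[OF l bounded_linear.continuous_on[OF \<psi> vc] C1]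
             laplace_integrable_bounded[OF l bounded_linear.continuous_on[OF \<rho> vc] C2]; assumption)+
  have "causal (\<lambda>t. ?\<rho> (generator P (v t))) =
      (\<lambda>t. \<Phi> l * causal (\<lambda>t. ?\<rho> (v t)) t + (-1) * causal (\<lambda>t. \<psi> (v t)) t)"
    using resolvent_functional_generator[OF \<psi> c vdom] by (auto simp: causal_def indicator_def fun_eq_iff)
  then have "laplace l (causal (\<lambda>t. ?\<rho> (generator P (v t)))) =
      \<Phi> l * laplace l (causal (\<lambda>t. ?\<rho> (v t))) - laplace l (causal (\<lambda>t. \<psi> (v t)))"
    using laplace_lincomb(2)[OF i(2,1), of "\<Phi> l" "-1"] by simp
  then show ?thesis using key[OF \<rho>] by (simp add: algebra_simps)
qed

lemma strong_solution_unique: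
  assumes v: "strong_solution \<kappa> w P g v" and u: "strong_solution \<kappa> w P g u" and t: "0 \<le> t"
  shows "v t = u t"
proof (rule functionals_eqI)
  fix \<psi> :: "'b \<Rightarrow> real" assume \<psi>: "bounded_linear \<psi>"
  have *: "continuous_on {0..} (\<lambda>t. \<psi> (x t))" "\<exists>C. \<forall>t\<ge>0. \<bar>\<psi> (x t)\<bar> \<le> C"
    if x: "strong_solution \<kappa> w P g x" for x
  proof -
    have "x 0 = g" "bounded (x ` {0<..})" and c: "continuous_on {0..} x"
      using x by (auto simp: strong_solution_def)
    then obtain B where "\<And>t. 0 < t \<Longrightarrow> norm (x t) \<le> B" by (auto simp: bounded_iff)
    then have "norm (x t) \<le> max B (norm g)" if "0 \<le> t" for t
      using \<open>x 0 = g\<close> that by (cases "t = 0") (auto simp: le_max_iff_disj)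
    then show "\<exists>C. \<forall>t\<ge>0. \<bar>\<psi> (x t)\<bar> \<le> C" by (rule functional_bound[OF \<psi>])
    show "continuous_on {0..} (\<lambda>t. \<psi> (x t))" by (rule bounded_linear.continuous_on[OF \<psi> c])
  qed
  obtain C1 C2 where C: "\<And>t. 0 \<le> t \<Longrightarrow> \<bar>\<psi> (v t)\<bar> \<le> C1" "\<And>t. 0 \<le> t \<Longrightarrow> \<bar>\<psi> (u t)\<bar> \<le> C2"
    using *(2)[OF v] *(2)[OF u] by auto
  show "\<psi> (v t) = \<psi> (u t)"
    using laplace_unique[OF *(1)[OF v] *(1)[OF u] laplace_integrable_bounded[OF _ *(1)[OF v] C(1)]
      laplace_integrable_bounded[OF _ *(1)[OF u] C(2)] _ t]
      strong_solution_laplace[OF v \<psi>] strong_solution_laplace[OF u \<psi>] by simp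
qed

end

section \<open>Banach spaces of functions\<close>

lemma AE_zero_if_set_integrals_zero:
  fixes q :: "'a \<Rightarrow> real"
  assumes q: "integrable M q" and zero: "\<And>A. A \<in> sets M \<Longrightarrow> (\<integral>x. indicator A x * q x \<partial>M) = 0"
  shows "AE x in M. q x = 0"
proof -
  have [measurable]: "q \<in> borel_measurable M" using q by auto
  have pos: "AE x in M. \<not> 0 < r x"
    if r[measurable]: "integrable M r" and z: "(\<integral>x. indicator {x \<in> space M. 0 < r x} x * r x \<partial>M) = 0" for r :: "'a \<Rightarrow> real"
  proof -
    have [measurable]: "r \<in> borel_measurable M" using r by auto
    let ?f = "\<lambda>x. indicator {x \<in> space M. 0 < r x} x * r x"
    have "integrable M ?f"
      using integrable_mult_indicator[of "{x \<in> space M. 0 < r x}" M r] r by simp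
    then have "AE x in M. ?f x = 0"
      using z by (subst (asm) integral_nonneg_eq_0_iff_AE) (auto simp: indicator_def)
    then show ?thesis
      using AE_space by eventually_elim (auto simp: indicator_def split: if_splits)
  qed
  have "AE x in M. \<not> 0 < q x" by (rule pos[OF q]) (rule zero, measurable)
  moreover have "AE x in M. \<not> 0 < - q x"
    by (rule pos) (use q zero[of "{x \<in> space M. 0 < - q x}"] in auto)
  ultimately show ?thesis by eventually_elim simp
qed

locale function_space =
  fixes \<N> :: "'e::topological_space measure set" and V :: "('e \<Rightarrow> real) set"
    and cls :: "('e \<Rightarrow> real) \<Rightarrow> 'b::banach"
  assumes bfs: "banach_function_space \<N> V cls"
begin

lemma finite_measure_\<nu>: "\<nu> \<in> \<N> \<Longrightarrow> finite_measure \<nu>"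
  and sets_\<nu>: "\<nu> \<in> \<N> \<Longrightarrow> sets \<nu> = sets borel"
  and V_measurable: "f \<in> V \<Longrightarrow> f \<in> borel_measurable borel"
  and V_add: "f \<in> V \<Longrightarrow> g \<in> V \<Longrightarrow> (\<lambda>x. f x + g x) \<in> V"
  and cls_add: "f \<in> V \<Longrightarrow> g \<in> V \<Longrightarrow> cls (\<lambda>x. f x + g x) = cls f + cls g"
  and V_scale: "f \<in> V \<Longrightarrow> (\<lambda>x. c * f x) \<in> V"
  and cls_scale: "f \<in> V \<Longrightarrow> cls (\<lambda>x. c * f x) = c *\<^sub>R cls f"
  and cls_surj: "\<exists>f\<in>V. cls f = y"
  and cls_eq_iff: "f \<in> V \<Longrightarrow> g \<in> borel_measurable borel \<Longrightarrow>
        (g \<in> V \<and> cls g = cls f) \<longleftrightarrow> (\<forall>\<nu>\<in>\<N>. AE x in \<nu>. g x = f x)"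
  and integral_bound: "\<nu> \<in> \<N> \<Longrightarrow> \<exists>C. \<forall>f\<in>V. integrable \<nu> f \<and> (\<integral>x. \<bar>f x\<bar> \<partial>\<nu>) \<le> C * norm (cls f)"
proof -
  note B = bfs[unfolded banach_function_space_def]
  note B1 = B[THEN conjunct1] and B2 = B[THEN conjunct2, THEN conjunct1]
  note B' = B[THEN conjunct2, THEN conjunct2]
  note B3 = B'[THEN conjunct1] and B4 = B'[THEN conjunct2, THEN conjunct1]
  note B'' = B'[THEN conjunct2, THEN conjunct2]
  note B5 = B''[THEN conjunct1] and B6 = B''[THEN conjunct2, THEN conjunct1] and B7 = B''[THEN conjunct2, THEN conjunct2]
  show "\<nu> \<in> \<N> \<Longrightarrow> finite_measure \<nu>" "\<nu> \<in> \<N> \<Longrightarrow> sets \<nu> = sets borel" using B1 by auto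
  show "f \<in> V \<Longrightarrow> f \<in> borel_measurable borel" using B2 by auto
  show "f \<in> V \<Longrightarrow> g \<in> V \<Longrightarrow> (\<lambda>x. f x + g x) \<in> V"
    "f \<in> V \<Longrightarrow> g \<in> V \<Longrightarrow> cls (\<lambda>x. f x + g x) = cls f + cls g" using B3 by auto
  show "f \<in> V \<Longrightarrow> (\<lambda>x. c * f x) \<in> V" "f \<in> V \<Longrightarrow> cls (\<lambda>x. c * f x) = c *\<^sub>R cls f" using B4 by auto
  show "\<exists>f\<in>V. cls f = y" using B5 by (metis UNIV_I imageE)
  show "f \<in> V \<Longrightarrow> g \<in> borel_measurable borel \<Longrightarrow>
        (g \<in> V \<and> cls g = cls f) \<longleftrightarrow> (\<forall>\<nu>\<in>\<N>. AE x in \<nu>. g x = f x)" by (rule B6[rule_format])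
  show "\<nu> \<in> \<N> \<Longrightarrow> \<exists>C. \<forall>f\<in>V. integrable \<nu> f \<and> (\<integral>x. \<bar>f x\<bar> \<partial>\<nu>) \<le> C * norm (cls f)"
    by (rule B7[rule_format])
qed

lemma V_integrable: "\<nu> \<in> \<N> \<Longrightarrow> f \<in> V \<Longrightarrow> integrable \<nu> f"
  using integral_bound by blast

text \<open>A representative of an element of the Banach space; any two agree almost everywhere for each \<open>\<nu> \<in> \<N>\<close>.\<close>
definition rep :: "'b \<Rightarrow> 'e \<Rightarrow> real" where "rep y = (SOME f. f \<in> V \<and> cls f = y)"

lemma rep: "rep y \<in> V" "cls (rep y) = y"
  using someI_ex[of "\<lambda>f. f \<in> V \<and> cls f = y"] cls_surj[of y] unfolding rep_def by auto

lemma AE_eq_of_cls_eq: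
  "f \<in> V \<Longrightarrow> g \<in> V \<Longrightarrow> cls f = cls g \<Longrightarrow> \<nu> \<in> \<N> \<Longrightarrow> AE x in \<nu>. f x = g x"
  using cls_eq_iff[of g f] V_measurable by blast

definition set_functional :: "'e measure \<Rightarrow> 'e set \<Rightarrow> 'b \<Rightarrow> real" where
  "set_functional \<nu> A y = (\<integral>x. indicator A x * rep y x \<partial>\<nu>)"

lemma indicator_times_measurable:
  assumes "\<nu> \<in> \<N>" "A \<in> sets borel" "f \<in> borel_measurable borel"
  shows "(\<lambda>x. indicator A x * f x :: real) \<in> borel_measurable \<nu>"
  using assms sets_\<nu>[OF assms(1)] by (simp cong: measurable_cong_sets)

lemma set_functional_cls:
  assumes "\<nu> \<in> \<N>" "A \<in> sets borel" "f \<in> V"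
  shows "set_functional \<nu> A (cls f) = (\<integral>x. indicator A x * f x \<partial>\<nu>)"
  unfolding set_functional_def
proof (rule integral_cong_AE)
  show "AE x in \<nu>. indicator A x * rep (cls f) x = indicator A x * f x"
    using AE_eq_of_cls_eq[OF rep(1) assms(3) rep(2) assms(1)] by eventually_elim simp
qed (use assms rep V_measurable in \<open>auto intro!: indicator_times_measurable\<close>)

lemma integrable_indicator_V:
  assumes "\<nu> \<in> \<N>" "A \<in> sets borel" "f \<in> V"
  shows "integrable \<nu> (\<lambda>x. indicator A x * f x)"
  using integrable_mult_indicator[of A \<nu> f] V_integrable[of \<nu> f] assms sets_\<nu> by simp

lemma bounded_linear_set_functional:
  assumes \<nu>: "\<nu> \<in> \<N>" and A: "A \<in> sets borel"
  shows "bounded_linear (set_functional \<nu> A)"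
proof -
  obtain C where C: "\<And>f. f \<in> V \<Longrightarrow> (\<integral>x. \<bar>f x\<bar> \<partial>\<nu>) \<le> C * norm (cls f)"
    using integral_bound[OF \<nu>] by blast
  show ?thesis
  proof (rule bounded_linear_intro)
    fix y z :: 'b and r :: real
    show "set_functional \<nu> A (y + z) = set_functional \<nu> A y + set_functional \<nu> A z"
      using set_functional_cls[OF \<nu> A V_add[OF rep(1)[of y] rep(1)[of z]]]
        integrable_indicator_V[OF \<nu> A rep(1)]
      by (simp add: cls_add rep distrib_left) (simp add: set_functional_def)
    show "set_functional \<nu> A (r *\<^sub>R y) = r *\<^sub>R set_functional \<nu> A y"
      using set_functional_cls[OF \<nu> A V_scale[OF rep(1)[of y], of r]]
      by (simp add: cls_scale rep mult.left_commute) (simp add: set_functional_def)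
    have "\<bar>set_functional \<nu> A y\<bar> \<le> (\<integral>x. \<bar>rep y x\<bar> \<partial>\<nu>)"
      unfolding set_functional_def
    proof (rule order_trans[OF Bochner_Integration.integral_abs_bound], rule integral_mono)
      show "integrable \<nu> (\<lambda>x. \<bar>indicator A x * rep y x\<bar>)"
        using integrable_indicator_V[OF \<nu> A rep(1)] by (rule integrable_abs)
      show "integrable \<nu> (\<lambda>x. \<bar>rep y x\<bar>)" using V_integrable[OF \<nu> rep(1)] by (rule integrable_abs)
    qed (auto simp: indicator_def)
    also have "\<dots> \<le> C * norm y" using C[OF rep(1)[of y]] by (simp add: rep)
    finally show "norm (set_functional \<nu> A y) \<le> norm y * C" by (simp add: mult.commute)
  qed
qed

lemma set_functionals_separate:
  assumes zero: "\<And>\<psi>::'b \<Rightarrow> real. bounded_linear \<psi> \<Longrightarrow> \<psi> y = 0"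
  shows "y = 0"
proof -
  have z: "(\<lambda>x. 0 * rep y x) \<in> V" "cls (\<lambda>x. 0 * rep y x) = 0"
    using V_scale[OF rep(1), of 0 y] cls_scale[OF rep(1), of 0 y] by auto
  have "AE x in \<nu>. rep y x = 0" if \<nu>: "\<nu> \<in> \<N>" for \<nu>
  proof (rule AE_zero_if_set_integrals_zero[OF V_integrable[OF \<nu> rep(1)]])
    fix A assume "A \<in> sets \<nu>"
    then show "(\<integral>x. indicator A x * rep y x \<partial>\<nu>) = 0"
      using zero[OF bounded_linear_set_functional[OF \<nu>, of A]] sets_\<nu>[OF \<nu>]
      by (simp add: set_functional_def)
  qed
  then have "cls (rep y) = cls (\<lambda>x. 0 * rep y x)"
    using cls_eq_iff[OF z(1) V_measurable[OF rep(1)], of y] by simp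
  then show "y = 0" using z rep by simp
qed

end

section \<open>Expectations under a probability kernel\<close>

lemma integral_measurable_kernel:
  fixes f :: "'a \<Rightarrow> 'c \<Rightarrow> real"
  assumes f[measurable]: "(\<lambda>(x, y). f x y) \<in> borel_measurable (M \<Otimes>\<^sub>M N)"
    and L: "L \<in> measurable M (subprob_algebra N)"
  shows "(\<lambda>x. \<integral>y. f x y \<partial>L x) \<in> borel_measurable M"
proof -
  have n: "(\<lambda>x. \<integral>\<^sup>+y. ennreal (g x y) \<partial>L x) \<in> borel_measurable M"
    if "(\<lambda>(x, y). g x y) \<in> borel_measurable (M \<Otimes>\<^sub>M N)" for g :: "'a \<Rightarrow> 'c \<Rightarrow> real"
    using that by (intro nn_integral_measurable_subprob_algebra2[OF _ L]) (simp add: case_prod_beta)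
  have [measurable]: "(\<lambda>x. \<integral>\<^sup>+y. ennreal (f x y) \<partial>L x) \<in> borel_measurable M"
    "(\<lambda>x. \<integral>\<^sup>+y. ennreal (- f x y) \<partial>L x) \<in> borel_measurable M"
    "(\<lambda>x. \<integral>\<^sup>+y. ennreal \<bar>f x y\<bar> \<partial>L x) \<in> borel_measurable M"
    using f by (intro n; simp add: case_prod_beta)+
  \<comment> \<open>The Lebesgue integral of a nonintegrable function is 0, which accounts for the last case.\<close>
  let ?g = "\<lambda>x. if (\<integral>\<^sup>+y. ennreal \<bar>f x y\<bar> \<partial>L x) < \<infinity>
      then enn2real (\<integral>\<^sup>+y. ennreal (f x y) \<partial>L x) - enn2real (\<integral>\<^sup>+y. ennreal (- f x y) \<partial>L x) else 0"
  have eq: "(\<integral>y. f x y \<partial>L x) = ?g x" if x: "x \<in> space M" for x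
  proof -
    have "f x \<in> borel_measurable (L x)"
      using measurable_compose[OF measurable_Pair1'[OF x] f] sets_kernel[OF L x]
      by (simp cong: measurable_cong_sets)
    then show ?thesis
      by (auto simp: real_lebesgue_integral_def integrable_iff_bounded not_integrable_integral_eq)
  qed
  have "?g \<in> borel_measurable M" by measurable
  moreover have "(\<lambda>x. \<integral>y. f x y \<partial>L x) \<in> borel_measurable M \<longleftrightarrow> ?g \<in> borel_measurable M"
    by (rule measurable_cong) (rule eq)
  ultimately show ?thesis by blast
qed

section \<open>Markov processes at an independent random time\<close>

locale subordinate_markov =
  levy_measure \<kappa> \<mu> + function_space \<N> V cls + bounded_semigroup P
  for \<kappa> :: real and \<mu> :: "real measure"
    and \<N> :: "'e::t2_space measure set" and V :: "('e \<Rightarrow> real) set" and cls :: "('e \<Rightarrow> real) \<Rightarrow> 'b::banach"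
    and P :: "real \<Rightarrow> 'b \<Rightarrow>\<^sub>L 'b" +
  fixes M :: "'w measure" and F :: "ennreal \<Rightarrow> 'w measure" and Px :: "'e \<Rightarrow> 'w measure"
    and X :: "real \<Rightarrow> 'w \<Rightarrow> 'e" and S :: "real \<Rightarrow> 'w \<Rightarrow> real"
  assumes markov: "strong_markov_process M F Px X"
    and subordinators: "\<And>x. subordinator (Px x) \<kappa> \<mu> S"
    and independent: "\<And>x. independent_of_process (Px x) F S"
    and transition: "transition_semigroup \<N> V cls Px X P"
begin

sublocale Px: driving_subordinator \<kappa> \<mu> "Px x" S for x
  by unfold_locales (rule subordinators)

sublocale Px: time_changed_semigroup \<kappa> \<mu> "Px x" S P for x
  by unfold_locales (rule set_functionals_separate)

abbreviation T :: "real \<Rightarrow> 'w \<Rightarrow> real" where "T \<equiv> inverse_time S"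

text \<open>The starting point is immaterial: the law of \<open>T t\<close> is the same under all \<open>Px x\<close>.\<close>
definition law :: "real \<Rightarrow> real measure" where "law t = distr (Px undefined) borel (T t)"

lemma filtration_F: "filtration (space M) F"
  and subalgebra_F: "subalgebra M (F t)"
  and Px_measurable: "Px \<in> borel \<rightarrow>\<^sub>M prob_algebra M"
  and progressive: "0 \<le> s \<Longrightarrow> (\<lambda>(s, \<omega>). X s \<omega>) \<in> restrict_space borel {0..s} \<Otimes>\<^sub>M F (ennreal s) \<rightarrow>\<^sub>M borel"
  using markov unfolding strong_markov_process_def by simp_all

lemma Px_kernel: "Px \<in> borel \<rightarrow>\<^sub>M subprob_algebra M"
  using Px_measurable by (rule measurable_prob_algebraD)

lemma sets_Px: "sets (Px x) = sets M"
  by (rule sets_kernel[OF Px_kernel]) simp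

lemma space_Px: "space (Px x) = space M"
  by (rule sets_eq_imp_space_eq[OF sets_Px])

lemma space_F: "space (F t) = space M"
  using subalgebra_F by (simp add: subalgebra_def)

lemma id_F_measurable: "(\<lambda>\<omega>. \<omega>) \<in> M \<rightarrow>\<^sub>M F t"
  using subalgebra_F[of t] by (auto simp: subalgebra_def intro!: measurableI)

text \<open>Progressive measurability gives joint measurability on each time interval \<open>{0..n}\<close>; the truncated
  time \<open>min (max 0 s) n\<close> agrees with \<open>max 0 s\<close> once \<open>n\<close> is at least \<open>s\<close>.\<close>
lemma X_joint_measurable: "(\<lambda>p. X (max 0 (fst p)) (snd p)) \<in> borel \<Otimes>\<^sub>M F \<infinity> \<rightarrow>\<^sub>M borel"
proof -
  let ?c = "\<lambda>(n::nat) p. X (min (max 0 (fst p)) (real n)) (snd p)"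
  have c: "?c n \<in> borel \<Otimes>\<^sub>M F \<infinity> \<rightarrow>\<^sub>M borel" for n
  proof -
    have sub: "sets (F (ennreal (real n))) \<subseteq> sets (F \<infinity>)"
      by (rule filtration.sets_F_mono[OF filtration_F]) simp
    have "(\<lambda>\<omega>. \<omega>) \<in> F \<infinity> \<rightarrow>\<^sub>M F (ennreal (real n))"
      using sub by (intro measurableI) (auto simp: space_F sets.Int_space_eq2)
    then have "snd \<in> borel \<Otimes>\<^sub>M F \<infinity> \<rightarrow>\<^sub>M F (ennreal (real n))"
      using measurable_compose[OF measurable_snd] by fastforce
    moreover have "(\<lambda>p. min (max 0 (fst p)) (real n)) \<in> borel \<Otimes>\<^sub>M F \<infinity> \<rightarrow>\<^sub>M restrict_space borel {0..real n}"
      by (rule measurable_restrict_space2) auto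
    ultimately have "(\<lambda>p. (min (max 0 (fst p)) (real n), snd p)) \<in>
        borel \<Otimes>\<^sub>M F \<infinity> \<rightarrow>\<^sub>M restrict_space borel {0..real n} \<Otimes>\<^sub>M F (ennreal (real n))"
      by (intro measurable_Pair)
    from measurable_compose[OF this progressive] show ?thesis by simp
  qed
  have "(\<lambda>p. ?c (nat \<lceil>fst p\<rceil>) p) \<in> borel \<Otimes>\<^sub>M F \<infinity> \<rightarrow>\<^sub>M borel"
    by (rule measurable_compose_countable[OF c]) measurable
  moreover have "min (max 0 s) (real (nat \<lceil>s\<rceil>)) = max 0 s" for s :: real
    by linarith
  ultimately show ?thesis by simp
qed

lemma law_eq: "0 \<le> t \<Longrightarrow> distr (Px x) borel (T t) = law t"
  unfolding law_def by (rule inverse_time_law_unique[OF Px.driving_subordinator_axioms Px.driving_subordinator_axioms])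

lemma prob_space_law: "prob_space (law t)"
  unfolding law_def by (rule Px.prob_space_distr) (rule Px.T_measurable)

lemma sets_law [simp]: "sets (law t) = sets borel" by (simp add: law_def)

lemma AE_law_nonneg: "AE s in law t. 0 \<le> s"
  unfolding law_def by (subst AE_distr_iff) (auto intro: Px.T_measurable)

lemma T_measurable_generated:
  "T t \<in> borel_measurable (sigma (space (Px x)) {S t -` B \<inter> space (Px x) | t B. 0 \<le> t \<and> B \<in> sets borel})"
    (is "_ \<in> borel_measurable ?G")
proof -
  have sp: "space ?G = space (Px x)" by (rule space_measure_of) auto
  have st: "sets ?G = sigma_sets (space (Px x)) {S t -` B \<inter> space (Px x) | t B. 0 \<le> t \<and> B \<in> sets borel}"
    by (rule sets_measure_of) auto
  have "(\<lambda>(t, \<omega>). T t \<omega>) \<in> borel_measurable (borel \<Otimes>\<^sub>M ?G)"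
  proof (rule inverse_time_measurable)
    fix s :: real assume s: "0 \<le> s"
    show "S s \<in> borel_measurable ?G"
    proof (rule measurableI)
      fix B assume "B \<in> sets (borel :: real measure)"
      then show "S s -` B \<inter> space ?G \<in> sets ?G"
        unfolding sp st using s by (intro sigma_sets.Basic) auto
    qed simp
  qed (auto simp: sp intro: Px.S_right_continuous)
  from measurable_compose[OF measurable_Pair1' this, of t] show ?thesis by simp
qed

lemma distr_id_measurable: "(\<lambda>\<omega>. \<omega>) \<in> Px x \<rightarrow>\<^sub>M F \<infinity>"
  using id_F_measurable by (simp add: measurable_cong_sets[OF sets_Px refl])

lemma prob_space_restr: "prob_space (distr (Px x) (F \<infinity>) (\<lambda>\<omega>. \<omega>))"
  by (rule Px.prob_space_distr[OF distr_id_measurable])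

lemma graph_T_measurable: "(\<lambda>\<omega>. (\<omega>, T t \<omega>)) \<in> Px x \<rightarrow>\<^sub>M F \<infinity> \<Otimes>\<^sub>M borel"
  by (rule measurable_Pair[OF distr_id_measurable Px.T_measurable])

text \<open>Independence of \<open>X\<close> and \<open>S\<close> in the form used for Fubini's theorem.  The first coordinate is the sample point
  itself, observed through \<open>F \<infinity>\<close>.\<close>
lemma joint_law:
  assumes t: "0 \<le> t"
  shows "distr (Px x) (F \<infinity> \<Otimes>\<^sub>M borel) (\<lambda>\<omega>. (\<omega>, T t \<omega>)) = distr (Px x) (F \<infinity>) (\<lambda>\<omega>. \<omega>) \<Otimes>\<^sub>M law t"
proof -
  let ?N = "Px x"
  let ?g = "{S t -` B \<inter> space ?N | t B. 0 \<le> t \<and> B \<in> sets borel}"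
  have st: "sets (sigma (space ?N) ?g) = sigma_sets (space ?N) ?g" by (rule sets_measure_of) auto
  have spg: "space (sigma (space ?N) ?g) = space ?N" by (rule space_measure_of) auto
  have ind: "Px.indep_set x (sets (F \<infinity>)) (sigma_sets (space ?N) ?g)"
    using independent[of x] by (simp add: independent_of_process_def)
  interpret R: prob_space "distr ?N (F \<infinity>) (\<lambda>\<omega>. \<omega>)" by (rule prob_space_restr)
  interpret L: prob_space "law t" by (rule prob_space_law)
  show ?thesis
  proof (rule pair_measure_eqI[symmetric])
    fix A B assume "A \<in> sets (distr ?N (F \<infinity>) (\<lambda>\<omega>. \<omega>))" "B \<in> sets (law t)"
    then have A: "A \<in> sets (F \<infinity>)" and B: "B \<in> sets borel" by auto
    let ?B = "T t -` B \<inter> space ?N"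
    have "?B \<in> sigma_sets (space ?N) ?g"
      using measurable_sets[OF T_measurable_generated[of t x] B] unfolding st spg .
    from Px.indep_setD[OF ind A this]
    have prod: "Px.prob x (A \<inter> ?B) = Px.prob x A * Px.prob x ?B" .
    have As: "A \<inter> space ?N = A"
      using sets.sets_into_space[OF A] space_F[of \<infinity>] space_Px[of x] by auto
    have "emeasure (distr ?N (F \<infinity>) (\<lambda>\<omega>. \<omega>)) A = ennreal (Px.prob x A)"
      using emeasure_distr[OF distr_id_measurable A] As by (simp add: Px.emeasure_eq_measure)
    moreover have "emeasure (law t) B = ennreal (Px.prob x ?B)"
      unfolding law_eq[OF t, of x, symmetric]
      using emeasure_distr[OF Px.T_measurable B] by (simp add: Px.emeasure_eq_measure)
    moreover have "emeasure (distr ?N (F \<infinity> \<Otimes>\<^sub>M borel) (\<lambda>\<omega>. (\<omega>, T t \<omega>))) (A \<times> B) = ennreal (Px.prob x (A \<inter> ?B))"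
    proof -
      have "(\<lambda>\<omega>. (\<omega>, T t \<omega>)) -` (A \<times> B) \<inter> space ?N = A \<inter> ?B" using As by auto
      then show ?thesis
        using emeasure_distr[OF graph_T_measurable, of "A \<times> B"] A B by (simp add: Px.emeasure_eq_measure)
    qed
    ultimately show "emeasure (distr ?N (F \<infinity>) (\<lambda>\<omega>. \<omega>)) A * emeasure (law t) B =
        emeasure (distr ?N (F \<infinity> \<Otimes>\<^sub>M borel) (\<lambda>\<omega>. (\<omega>, T t \<omega>))) (A \<times> B)"
      by (simp add: prod ennreal_mult)
  next
    show "sigma_finite_measure (distr ?N (F \<infinity>) (\<lambda>\<omega>. \<omega>))" by (rule R.sigma_finite_measure_axioms)
    show "sigma_finite_measure (law t)" by (rule L.sigma_finite_measure_axioms)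
    show "sets (distr ?N (F \<infinity>) (\<lambda>\<omega>. \<omega>) \<Otimes>\<^sub>M law t) = sets (distr ?N (F \<infinity> \<Otimes>\<^sub>M borel) (\<lambda>\<omega>. (\<omega>, T t \<omega>)))"
      unfolding sets_distr by (intro sets_pair_measure_cong) auto
  qed
qed

lemma nn_expectation_T:
  assumes t: "0 \<le> t" and H: "(\<lambda>(s, \<omega>). H s \<omega>) \<in> borel_measurable (borel \<Otimes>\<^sub>M F \<infinity>)"
  shows "(\<integral>\<^sup>+\<omega>. H (T t \<omega>) \<omega> \<partial>Px x) = (\<integral>\<^sup>+s. \<integral>\<^sup>+\<omega>. H s \<omega> \<partial>Px x \<partial>law t)"
proof -
  let ?R = "distr (Px x) (F \<infinity>) (\<lambda>\<omega>. \<omega>)"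
  interpret R: prob_space ?R by (rule prob_space_restr)
  interpret L: prob_space "law t" by (rule prob_space_law)
  interpret RL: pair_sigma_finite ?R "law t" ..
  have Hs: "(\<lambda>p. H (snd p) (fst p)) \<in> borel_measurable (F \<infinity> \<Otimes>\<^sub>M borel)"
    using measurable_compose[OF measurable_pair_swap' H] by (simp add: case_prod_unfold)
  have Hs': "(\<lambda>(\<omega>, s). H s \<omega>) \<in> borel_measurable (?R \<Otimes>\<^sub>M law t)"
    using Hs by (simp add: case_prod_unfold cong: measurable_cong_sets sets_pair_measure_cong)
  have "(\<integral>\<^sup>+\<omega>. H (T t \<omega>) \<omega> \<partial>Px x) = (\<integral>\<^sup>+p. H (snd p) (fst p) \<partial>distr (Px x) (F \<infinity> \<Otimes>\<^sub>M borel) (\<lambda>\<omega>. (\<omega>, T t \<omega>)))"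
    by (subst nn_integral_distr[OF graph_T_measurable]) (use Hs in auto)
  also have "\<dots> = (\<integral>\<^sup>+s. \<integral>\<^sup>+\<omega>. H s \<omega> \<partial>?R \<partial>law t)"
    unfolding joint_law[OF t] using RL.nn_integral_snd[OF Hs'] by (simp add: case_prod_unfold)
  also have "\<dots> = (\<integral>\<^sup>+s. \<integral>\<^sup>+\<omega>. H s \<omega> \<partial>Px x \<partial>law t)"
  proof (rule nn_integral_cong)
    fix s
    have "(\<lambda>\<omega>. H s \<omega>) \<in> borel_measurable (F \<infinity>)"
      using measurable_compose[OF measurable_Pair1' H, of s] by simp
    then show "(\<integral>\<^sup>+\<omega>. H s \<omega> \<partial>?R) = (\<integral>\<^sup>+\<omega>. H s \<omega> \<partial>Px x)"
      by (intro nn_integral_distr distr_id_measurable) simp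
  qed
  finally show ?thesis .
qed

lemma expectation_T:
  fixes H :: "real \<Rightarrow> 'w \<Rightarrow> real"
  assumes t: "0 \<le> t" and H: "(\<lambda>(s, \<omega>). H s \<omega>) \<in> borel_measurable (borel \<Otimes>\<^sub>M F \<infinity>)"
    and i: "integrable (Px x) (\<lambda>\<omega>. H (T t \<omega>) \<omega>)"
  shows "(\<integral>\<omega>. H (T t \<omega>) \<omega> \<partial>Px x) = (\<integral>s. \<integral>\<omega>. H s \<omega> \<partial>Px x \<partial>law t)"
proof -
  let ?R = "distr (Px x) (F \<infinity>) (\<lambda>\<omega>. \<omega>)"
  interpret R: prob_space ?R by (rule prob_space_restr)
  interpret L: prob_space "law t" by (rule prob_space_law)
  interpret RL: pair_sigma_finite ?R "law t" ..
  have Hs: "(\<lambda>p. H (snd p) (fst p)) \<in> borel_measurable (F \<infinity> \<Otimes>\<^sub>M borel)"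
    using measurable_compose[OF measurable_pair_swap' H] by (simp add: case_prod_unfold)
  have "integrable (distr (Px x) (F \<infinity> \<Otimes>\<^sub>M borel) (\<lambda>\<omega>. (\<omega>, T t \<omega>))) (\<lambda>p. H (snd p) (fst p))"
    using i by (subst integrable_distr_eq[OF graph_T_measurable Hs]) simp
  then have i': "integrable (?R \<Otimes>\<^sub>M law t) (\<lambda>(\<omega>, s). H s \<omega>)"
    unfolding joint_law[OF t] by (simp add: case_prod_unfold)
  have "(\<integral>\<omega>. H (T t \<omega>) \<omega> \<partial>Px x) = (\<integral>p. H (snd p) (fst p) \<partial>distr (Px x) (F \<infinity> \<Otimes>\<^sub>M borel) (\<lambda>\<omega>. (\<omega>, T t \<omega>)))"
    by (subst integral_distr[OF graph_T_measurable Hs]) simp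
  also have "\<dots> = (\<integral>s. \<integral>\<omega>. H s \<omega> \<partial>?R \<partial>law t)"
    unfolding joint_law[OF t] using RL.integral_snd[OF i'] by (simp add: case_prod_unfold)
  also have "\<dots> = (\<integral>s. \<integral>\<omega>. H s \<omega> \<partial>Px x \<partial>law t)"
  proof (rule Bochner_Integration.integral_cong[OF refl])
    fix s
    have "(\<lambda>\<omega>. H s \<omega>) \<in> borel_measurable (F \<infinity>)"
      using measurable_compose[OF measurable_Pair1' H, of s] by simp
    then show "(\<integral>\<omega>. H s \<omega> \<partial>?R) = (\<integral>\<omega>. H s \<omega> \<partial>Px x)"
      by (intro integral_distr distr_id_measurable)
  qed
  finally show ?thesis .
qed

text \<open>Freezing the process at negative times makes joint measurability a statement on the whole line.\<close>
definition Y :: "('e \<Rightarrow> real) \<Rightarrow> real \<Rightarrow> 'w \<Rightarrow> real" where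
  "Y f s \<omega> = f (X (max 0 s) \<omega>)"

lemma Y_T [simp]: "Y f (T t \<omega>) \<omega> = f (X (T t \<omega>) \<omega>)" by (simp add: Y_def)

lemma Y_measurable:
  assumes "f \<in> borel_measurable borel"
  shows "(\<lambda>(s, \<omega>). Y f s \<omega>) \<in> borel_measurable (borel \<Otimes>\<^sub>M F \<infinity>)"
  using measurable_compose[OF X_joint_measurable assms] by (simp add: Y_def case_prod_unfold)

lemma Y_measurable_M:
  assumes "f \<in> borel_measurable borel"
  shows "(\<lambda>(s, \<omega>). Y f s \<omega>) \<in> borel_measurable (borel \<Otimes>\<^sub>M M)"
proof -
  have "(\<lambda>p. (fst p, snd p)) \<in> borel \<Otimes>\<^sub>M M \<rightarrow>\<^sub>M borel \<Otimes>\<^sub>M F \<infinity>"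
    by (intro measurable_Pair measurable_fst measurable_compose[OF measurable_snd id_F_measurable])
  from measurable_compose[OF this Y_measurable[OF assms]] show ?thesis by (simp add: case_prod_unfold)
qed

lemma mean_measurable:
  assumes "f \<in> borel_measurable borel"
  shows "(\<lambda>p. \<integral>\<omega>. Y f (snd p) \<omega> \<partial>Px (fst p)) \<in> borel_measurable (borel \<Otimes>\<^sub>M borel)"
proof (rule integral_measurable_kernel)
  have "(\<lambda>q. (snd (fst q), snd q)) \<in> (borel \<Otimes>\<^sub>M borel) \<Otimes>\<^sub>M M \<rightarrow>\<^sub>M borel \<Otimes>\<^sub>M M" by measurable
  from measurable_compose[OF this Y_measurable_M[OF assms]]
  show "(\<lambda>(p, \<omega>). Y f (snd p) \<omega>) \<in> borel_measurable ((borel \<Otimes>\<^sub>M borel) \<Otimes>\<^sub>M M)"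
    by (simp add: case_prod_unfold)
  show "(\<lambda>p. Px (fst p)) \<in> borel \<Otimes>\<^sub>M borel \<rightarrow>\<^sub>M subprob_algebra M"
    by (rule measurable_compose[OF measurable_fst Px_kernel])
qed

lemma nn_mean_measurable:
  assumes "f \<in> borel_measurable borel"
  shows "(\<lambda>p. \<integral>\<^sup>+\<omega>. ennreal \<bar>Y f (snd p) \<omega>\<bar> \<partial>Px (fst p)) \<in> borel_measurable (borel \<Otimes>\<^sub>M borel)"
proof (rule nn_integral_measurable_subprob_algebra2)
  have "(\<lambda>q. (snd (fst q), snd q)) \<in> (borel \<Otimes>\<^sub>M borel) \<Otimes>\<^sub>M M \<rightarrow>\<^sub>M borel \<Otimes>\<^sub>M M" by measurable
  from measurable_compose[OF this Y_measurable_M[OF assms]]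
  have [measurable]: "(\<lambda>q. Y f (snd (fst q)) (snd q)) \<in> borel_measurable ((borel \<Otimes>\<^sub>M borel) \<Otimes>\<^sub>M M)"
    by (simp add: case_prod_unfold)
  show "(\<lambda>(p, \<omega>). ennreal \<bar>Y f (snd p) \<omega>\<bar>) \<in> borel_measurable ((borel \<Otimes>\<^sub>M borel) \<Otimes>\<^sub>M M)"
    unfolding case_prod_unfold by measurable
  show "(\<lambda>p. Px (fst p)) \<in> borel \<Otimes>\<^sub>M borel \<rightarrow>\<^sub>M subprob_algebra M"
    by (rule measurable_compose[OF measurable_fst Px_kernel])
qed

lemma f_X_T_measurable:
  fixes f :: "'e \<Rightarrow> real"
  assumes "f \<in> borel_measurable borel"
  shows "(\<lambda>\<omega>. f (X (T t \<omega>) \<omega>)) \<in> borel_measurable (Px x)"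
proof -
  have "(\<lambda>\<omega>. (T t \<omega>, \<omega>)) \<in> Px x \<rightarrow>\<^sub>M borel \<Otimes>\<^sub>M F \<infinity>"
    by (rule measurable_Pair[OF Px.T_measurable distr_id_measurable])
  from measurable_compose[OF this Y_measurable[OF assms]] show ?thesis by simp
qed

definition abs_mean :: "('e \<Rightarrow> real) \<Rightarrow> real \<Rightarrow> 'e \<Rightarrow> ennreal" where
  "abs_mean f t x = (\<integral>\<^sup>+\<omega>. ennreal \<bar>f (X (T t \<omega>) \<omega>)\<bar> \<partial>Px x)"

lemma abs_mean_eq:
  assumes f: "f \<in> borel_measurable borel" and t: "0 \<le> t"
  shows "abs_mean f t x = (\<integral>\<^sup>+s. \<integral>\<^sup>+\<omega>. ennreal \<bar>Y f s \<omega>\<bar> \<partial>Px x \<partial>law t)"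
proof -
  have "(\<lambda>(s, \<omega>). ennreal \<bar>Y f s \<omega>\<bar>) \<in> borel_measurable (borel \<Otimes>\<^sub>M F \<infinity>)"
    using Y_measurable[OF f] by (simp add: case_prod_unfold)
  from nn_expectation_T[OF t this, of x] show ?thesis by (simp add: abs_mean_def)
qed

lemma abs_mean_measurable:
  assumes f: "f \<in> borel_measurable borel" and t: "0 \<le> t"
  shows "abs_mean f t \<in> borel_measurable borel"
proof -
  interpret L: prob_space "law t" by (rule prob_space_law)
  have "(\<lambda>p. \<integral>\<^sup>+\<omega>. ennreal \<bar>Y f (snd p) \<omega>\<bar> \<partial>Px (fst p)) \<in> borel_measurable (borel \<Otimes>\<^sub>M law t)"
    using nn_mean_measurable[OF f] by (simp cong: measurable_cong_sets sets_pair_measure_cong)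
  from L.borel_measurable_nn_integral_fst[OF this]
  show ?thesis by (simp add: abs_mean_eq[OF f t, abs_def])
qed

lemma integrable_iff_abs_mean:
  fixes f :: "'e \<Rightarrow> real"
  assumes "f \<in> borel_measurable borel"
  shows "integrable (Px x) (\<lambda>\<omega>. f (X (T t \<omega>) \<omega>)) \<longleftrightarrow> abs_mean f t x < \<infinity>"
  using f_X_T_measurable[OF assms] by (simp add: integrable_iff_bounded abs_mean_def)

lemma transition_at:
  assumes "0 \<le> s" "f \<in> V"
  shows "\<nu> \<in> \<N> \<Longrightarrow> AE x in \<nu>. integrable (Px x) (\<lambda>\<omega>. f (X s \<omega>))"
    and "(\<lambda>x. \<integral>\<omega>. f (X s \<omega>) \<partial>Px x) \<in> V"
    and "P s (cls f) = cls (\<lambda>x. \<integral>\<omega>. f (X s \<omega>) \<partial>Px x)"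
  using transition assms unfolding transition_semigroup_def by auto

text \<open>By Tonelli's theorem the \<open>\<nu>\<close>-integral of \<open>\<E>\<^sub>x[g (X (T t))]\<close> is the mixture over the law of \<open>T t\<close> of the
  \<open>\<nu>\<close>-integrals of \<open>P s g\<close>, and these are bounded by a multiple of \<open>K * norm (cls g)\<close>.\<close>
lemma AE_integrable_dominated:
  assumes f: "f \<in> V" and g: "g \<in> V" and fg: "\<And>y. \<bar>f y\<bar> \<le> g y" and t: "0 \<le> t" and \<nu>: "\<nu> \<in> \<N>"
  shows "AE x in \<nu>. integrable (Px x) (\<lambda>\<omega>. f (X (T t \<omega>) \<omega>))"
proof -
  interpret \<nu>: finite_measure \<nu> by (rule finite_measure_\<nu>[OF \<nu>])
  interpret L: prob_space "law t" by (rule prob_space_law)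
  interpret pair_sigma_finite \<nu> "law t" ..
  note fm = V_measurable[OF f] and gm = V_measurable[OF g]
  have g0: "0 \<le> g y" for y using fg[of y] abs_ge_zero order_trans by blast
  obtain C where C: "\<And>f. f \<in> V \<Longrightarrow> (\<integral>x. \<bar>f x\<bar> \<partial>\<nu>) \<le> C * norm (cls f)"
    using integral_bound[OF \<nu>] by blast
  have bound: "(\<integral>\<^sup>+x. \<integral>\<^sup>+\<omega>. ennreal \<bar>Y g s \<omega>\<bar> \<partial>Px x \<partial>\<nu>) \<le> ennreal (\<bar>C\<bar> * (K * norm (cls g)))" if s: "0 \<le> s" for s
  proof -
    let ?h = "\<lambda>x. \<integral>\<omega>. g (X s \<omega>) \<partial>Px x"
    note h = transition_at[OF s g]
    have "(\<integral>\<^sup>+x. \<integral>\<^sup>+\<omega>. ennreal \<bar>Y g s \<omega>\<bar> \<partial>Px x \<partial>\<nu>) = (\<integral>\<^sup>+x. ennreal \<bar>?h x\<bar> \<partial>\<nu>)"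
    proof (rule nn_integral_cong_AE)
      show "AE x in \<nu>. (\<integral>\<^sup>+\<omega>. ennreal \<bar>Y g s \<omega>\<bar> \<partial>Px x) = ennreal \<bar>?h x\<bar>"
        using h(1)[OF \<nu>]
      proof eventually_elim
        case (elim x)
        have "0 \<le> ?h x" using g0 by simp
        then show ?case
          using nn_integral_eq_integral[OF elim] g0 s by (simp add: Y_def)
      qed
    qed
    also have "\<dots> = ennreal (\<integral>x. \<bar>?h x\<bar> \<partial>\<nu>)"
      using V_integrable[OF \<nu> h(2)] by (intro nn_integral_eq_integral) auto
    also have "\<dots> \<le> ennreal (\<bar>C\<bar> * (K * norm (cls g)))"
    proof (rule ennreal_leI)
      have "(\<integral>x. \<bar>?h x\<bar> \<partial>\<nu>) \<le> C * norm (P s (cls g))" using C[OF h(2)] h(3) by simp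
      also have "\<dots> \<le> \<bar>C\<bar> * norm (P s (cls g))" by (intro mult_right_mono) auto
      also have "\<dots> \<le> \<bar>C\<bar> * (K * norm (cls g))" by (intro mult_left_mono norm_P s) auto
      finally show "(\<integral>x. \<bar>?h x\<bar> \<partial>\<nu>) \<le> \<bar>C\<bar> * (K * norm (cls g))" .
    qed
    finally show ?thesis .
  qed
  have m: "(\<lambda>(x, s). \<integral>\<^sup>+\<omega>. ennreal \<bar>Y g s \<omega>\<bar> \<partial>Px x) \<in> borel_measurable (\<nu> \<Otimes>\<^sub>M law t)"
    using nn_mean_measurable[OF gm] sets_\<nu>[OF \<nu>] by (simp add: case_prod_unfold cong: measurable_cong_sets sets_pair_measure_cong)
  have "(\<integral>\<^sup>+x. abs_mean f t x \<partial>\<nu>) \<le> (\<integral>\<^sup>+x. abs_mean g t x \<partial>\<nu>)"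
    unfolding abs_mean_def using fg g0 by (intro nn_integral_mono ennreal_leI) simp
  also have "\<dots> = (\<integral>\<^sup>+s. \<integral>\<^sup>+x. \<integral>\<^sup>+\<omega>. ennreal \<bar>Y g s \<omega>\<bar> \<partial>Px x \<partial>\<nu> \<partial>law t)"
    unfolding abs_mean_eq[OF gm t] by (rule Fubini'[OF m, symmetric])
  also have "\<dots> \<le> (\<integral>\<^sup>+s. ennreal (\<bar>C\<bar> * (K * norm (cls g))) \<partial>law t)"
  proof (rule nn_integral_mono_AE)
    show "AE s in law t. (\<integral>\<^sup>+x. \<integral>\<^sup>+\<omega>. ennreal \<bar>Y g s \<omega>\<bar> \<partial>Px x \<partial>\<nu>) \<le> ennreal (\<bar>C\<bar> * (K * norm (cls g)))"
      using AE_law_nonneg[of t] by eventually_elim (rule bound)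
  qed
  also have "\<dots> < \<infinity>" by (simp add: L.emeasure_space_1)
  finally have "(\<integral>\<^sup>+x. abs_mean f t x \<partial>\<nu>) \<noteq> \<infinity>" by simp
  moreover have "abs_mean f t \<in> borel_measurable \<nu>"
    using abs_mean_measurable[OF fm t] sets_\<nu>[OF \<nu>] by (simp cong: measurable_cong_sets)
  ultimately have "AE x in \<nu>. abs_mean f t x \<noteq> \<infinity>" by (intro nn_integral_PInf_AE)
  then show ?thesis
    by eventually_elim (simp add: integrable_iff_abs_mean[OF fm] less_top)
qed

text \<open>Like the law of \<open>T t\<close>, the mixture is independent of the starting point.\<close>
definition u :: "real \<Rightarrow> 'b \<Rightarrow> 'b" where "u t y = Px.A undefined t y"

lemma A_eq_u: "0 \<le> t \<Longrightarrow> Px.A x t y = u t y"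
  unfolding u_def
proof (rule Px.functionals_eqI)
  fix \<psi> :: "'b \<Rightarrow> real" assume t: "0 \<le> t" and \<psi>: "bounded_linear \<psi>"
  have m: "causal (\<lambda>s. \<psi> (P s y)) \<in> borel_measurable borel"
    by (rule causal_measurable[OF continuous_functional_P[OF \<psi>]])
  have "(\<integral>\<omega>. \<psi> (P (T t \<omega>) y) \<partial>Px x) = (\<integral>s. causal (\<lambda>s. \<psi> (P s y)) s \<partial>law t)" for x
    unfolding law_eq[OF t, of x, symmetric] by (subst integral_distr[OF Px.T_measurable m]) simp
  then show "\<psi> (Px.A x t y) = \<psi> (Px.A undefined t y)"
    unfolding Px.functional_A[OF \<psi>] by simp
qed

lemma functional_u:
  assumes t: "0 \<le> t" and \<psi>: "bounded_linear \<psi>"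
  shows "\<psi> (u t y) = (\<integral>s. causal (\<lambda>s. \<psi> (P s y)) s \<partial>law t)"
proof -
  have m: "causal (\<lambda>s. \<psi> (P s y)) \<in> borel_measurable borel"
    by (rule causal_measurable[OF continuous_functional_P[OF \<psi>]])
  show ?thesis
    unfolding law_def u_def Px.functional_A[OF \<psi>]
    by (subst integral_distr[OF Px.T_measurable m]) simp
qed

text \<open>Without a dominating function in \<open>V\<close> the integrals over \<open>s\<close> and \<open>x\<close> cannot be exchanged globally.  On the
  set \<open>D n\<close>, where \<open>\<E>\<^sub>x\<bar>f (X (T t))\<bar> \<le> n\<close>, the double integral converges absolutely because \<open>\<nu>\<close> is finite;
  there the two functions have equal integrals over all Borel sets.  The sets \<open>D n\<close> exhaust the points
  where \<open>f (X (T t))\<close> is integrable.\<close>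
lemma AE_rep_u:
  assumes f: "f \<in> V" and t: "0 \<le> t" and \<nu>: "\<nu> \<in> \<N>"
  shows "AE x in \<nu>. integrable (Px x) (\<lambda>\<omega>. f (X (T t \<omega>) \<omega>)) \<longrightarrow>
     rep (u t (cls f)) x = (\<integral>\<omega>. f (X (T t \<omega>) \<omega>) \<partial>Px x)"
proof -
  interpret \<nu>: finite_measure \<nu> by (rule finite_measure_\<nu>[OF \<nu>])
  interpret L: prob_space "law t" by (rule prob_space_law)
  interpret pair_sigma_finite \<nu> "law t" ..
  note fm = V_measurable[OF f] and s\<nu> = sets_\<nu>[OF \<nu>]
  define m where "m x s = (\<integral>\<omega>. Y f s \<omega> \<partial>Px x)" for x s
  define q where "q x = (\<integral>s. m x s \<partial>law t)" for x
  define D where "D n = {x. abs_mean f t x \<le> ennreal (real n)}" for n :: nat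
  have mm: "(\<lambda>(x, s). m x s) \<in> borel_measurable (\<nu> \<Otimes>\<^sub>M law t)"
    using mean_measurable[OF fm] s\<nu>
    by (simp add: m_def case_prod_unfold cong: measurable_cong_sets sets_pair_measure_cong)
  have qm: "q \<in> borel_measurable \<nu>"
    unfolding q_def[abs_def] using L.borel_measurable_lebesgue_integral[of m] mm by simp
  have Dm: "D n \<in> sets borel" for n
    using measurable_sets[OF abs_mean_measurable[OF fm t], of "{.. ennreal (real n)}"]
    by (simp add: D_def vimage_def)
  have q_eq: "q x = (\<integral>\<omega>. f (X (T t \<omega>) \<omega>) \<partial>Px x)" if "x \<in> D n" for x n
  proof -
    have "integrable (Px x) (\<lambda>\<omega>. Y f (T t \<omega>) \<omega>)"
      using that integrable_iff_abs_mean[OF fm] by (simp add: D_def order_le_less_trans)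
    from expectation_T[OF t Y_measurable[OF fm] this] show ?thesis by (simp add: q_def m_def)
  qed
  have nn_m: "(\<integral>\<^sup>+s. ennreal \<bar>m x s\<bar> \<partial>law t) \<le> abs_mean f t x" for x
    unfolding abs_mean_eq[OF fm t]
  proof (rule nn_integral_mono)
    fix s
    show "ennreal \<bar>m x s\<bar> \<le> (\<integral>\<^sup>+\<omega>. ennreal \<bar>Y f s \<omega>\<bar> \<partial>Px x)"
    proof (cases "integrable (Px x) (Y f s)")
      case True
      then show ?thesis using integral_norm_bound_ennreal[OF True] by (simp add: m_def)
    next
      case False
      then show ?thesis by (simp add: m_def not_integrable_integral_eq)
    qed
  qed
  let ?h = "rep (u t (cls f))"
  have int: "integrable (\<nu> \<Otimes>\<^sub>M law t) (\<lambda>(x, s). indicator (A \<inter> D n) x * m x s)" if A: "A \<in> sets borel" for A n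
  proof (rule integrableI_bounded)
    have AD: "A \<inter> D n \<in> sets \<nu>" using A Dm s\<nu> by auto
    have [measurable]: "(\<lambda>p. m (fst p) (snd p)) \<in> borel_measurable (\<nu> \<Otimes>\<^sub>M law t)"
      using mm by (simp add: case_prod_unfold)
    have im: "(\<lambda>p. indicator (A \<inter> D n) (fst p) :: real) \<in> borel_measurable (\<nu> \<Otimes>\<^sub>M law t)"
      using AD by (intro measurable_compose[OF measurable_fst] borel_measurable_indicator)
    show meas: "(\<lambda>(x, s). indicator (A \<inter> D n) x * m x s) \<in> borel_measurable (\<nu> \<Otimes>\<^sub>M law t)"
      unfolding case_prod_unfold using im by measurable
    have "(\<integral>\<^sup>+p. ennreal (norm (case p of (x, s) \<Rightarrow> indicator (A \<inter> D n) x * m x s)) \<partial>(\<nu> \<Otimes>\<^sub>M law t))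
       = (\<integral>\<^sup>+x. \<integral>\<^sup>+s. ennreal (norm (indicator (A \<inter> D n) x * m x s)) \<partial>law t \<partial>\<nu>)"
      using L.nn_integral_fst[of "\<lambda>p. ennreal (norm (case p of (x, s) \<Rightarrow> indicator (A \<inter> D n) x * m x s))" \<nu>] meas
      by (simp add: case_prod_unfold)
    also have "\<dots> \<le> (\<integral>\<^sup>+x. ennreal (real n) \<partial>\<nu>)"
    proof (rule nn_integral_mono)
      fix x
      show "(\<integral>\<^sup>+s. ennreal (norm (indicator (A \<inter> D n) x * m x s)) \<partial>law t) \<le> ennreal (real n)"
      proof (cases "x \<in> A \<inter> D n")
        case True
        then show ?thesis using nn_m[of x] by (auto simp: D_def intro: order_trans)
      next
        case False
        then show ?thesis by simp
      qed
    qed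
    also have "\<dots> < \<infinity>"
    proof -
      have "emeasure \<nu> (space \<nu>) < top" by (simp add: less_top[symmetric])
      then show ?thesis by (simp add: ennreal_mult_less_top)
    qed
    finally show "(\<integral>\<^sup>+p. ennreal (norm (case p of (x, s) \<Rightarrow> indicator (A \<inter> D n) x * m x s)) \<partial>(\<nu> \<Otimes>\<^sub>M law t)) < \<infinity>" .
  qed
  have eq: "(\<integral>x. indicator (A \<inter> D n) x * ?h x \<partial>\<nu>) = (\<integral>x. indicator (A \<inter> D n) x * q x \<partial>\<nu>)" if A: "A \<in> sets borel" for A n
  proof -
    have AD: "A \<inter> D n \<in> sets borel" using A Dm by auto
    have "(\<integral>x. indicator (A \<inter> D n) x * ?h x \<partial>\<nu>) = set_functional \<nu> (A \<inter> D n) (u t (cls f))"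
      by (simp add: set_functional_def)
    also have "\<dots> = (\<integral>s. causal (\<lambda>s. set_functional \<nu> (A \<inter> D n) (P s (cls f))) s \<partial>law t)"
      by (rule functional_u[OF t bounded_linear_set_functional[OF \<nu> AD]])
    also have "\<dots> = (\<integral>s. (\<integral>x. indicator (A \<inter> D n) x * m x s \<partial>\<nu>) \<partial>law t)"
    proof (rule integral_cong_AE)
      show "(\<lambda>s. \<integral>x. indicator (A \<inter> D n) x * m x s \<partial>\<nu>) \<in> borel_measurable (law t)"
        using integrable_snd[OF int[OF A]] by auto
      show "causal (\<lambda>s. set_functional \<nu> (A \<inter> D n) (P s (cls f))) \<in> borel_measurable (law t)"
        using causal_measurable[OF continuous_functional_P[OF bounded_linear_set_functional[OF \<nu> AD]]]
        by (simp cong: measurable_cong_sets)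
      show "AE s in law t. causal (\<lambda>s. set_functional \<nu> (A \<inter> D n) (P s (cls f))) s = (\<integral>x. indicator (A \<inter> D n) x * m x s \<partial>\<nu>)"
        using AE_law_nonneg
      proof eventually_elim
        case (elim s)
        then show ?case
          using set_functional_cls[OF \<nu> AD transition_at(2)[OF elim f]] transition_at(3)[OF elim f]
          by (simp add: m_def Y_def)
      qed
    qed
    also have "\<dots> = (\<integral>x. (\<integral>s. indicator (A \<inter> D n) x * m x s \<partial>law t) \<partial>\<nu>)"
      by (rule Fubini_integral[OF int[OF A]])
    also have "\<dots> = (\<integral>x. indicator (A \<inter> D n) x * q x \<partial>\<nu>)" by (simp add: q_def)
    finally show ?thesis .
  qed
  have "AE x in \<nu>. x \<in> D n \<longrightarrow> ?h x = q x" for n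
  proof -
    have i1: "integrable \<nu> (\<lambda>x. indicator (D n) x * ?h x)"
      by (rule integrable_indicator_V[OF \<nu> Dm rep(1)])
    have "integrable \<nu> (\<lambda>x. \<integral>s. indicator (UNIV \<inter> D n) x * m x s \<partial>law t)"
      using integrable_fst[OF int[of UNIV n]] by simp
    then have i2: "integrable \<nu> (\<lambda>x. indicator (D n) x * q x)" by (simp add: q_def)
    have "AE x in \<nu>. indicator (D n) x * ?h x - indicator (D n) x * q x = 0"
    proof (rule AE_zero_if_set_integrals_zero)
      show "integrable \<nu> (\<lambda>x. indicator (D n) x * ?h x - indicator (D n) x * q x)" using i1 i2 by simp
      fix A assume A\<nu>: "A \<in> sets \<nu>"
      then have A: "A \<in> sets borel" using s\<nu> by simp
      have "integrable \<nu> (\<lambda>x. indicator A x * (indicator (D n) x * ?h x))" "integrable \<nu> (\<lambda>x. indicator A x * (indicator (D n) x * q x))"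
        using integrable_mult_indicator[OF A\<nu> i1] integrable_mult_indicator[OF A\<nu> i2] by simp_all
      then show "(\<integral>x. indicator A x * (indicator (D n) x * ?h x - indicator (D n) x * q x) \<partial>\<nu>) = 0"
        using eq[OF A, of n] by (simp add: right_diff_distrib indicator_inter_arith mult.assoc)
    qed
    then show ?thesis by eventually_elim (auto simp: indicator_def)
  qed
  then have "AE x in \<nu>. \<forall>n. x \<in> D n \<longrightarrow> ?h x = q x"
    by (subst AE_all_countable) blast
  then show ?thesis
  proof eventually_elim
    case (elim x)
    show ?case
    proof
      assume "integrable (Px x) (\<lambda>\<omega>. f (X (T t \<omega>) \<omega>))"
      then have "abs_mean f t x < \<infinity>" by (simp add: integrable_iff_abs_mean[OF fm])
      then obtain n :: nat where "abs_mean f t x \<le> ennreal (real n)"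
        by (metis ennreal_Ex_less_of_nat ennreal_of_nat_eq_real_of_nat infinity_ennreal_def less_imp_le)
      then have xD: "x \<in> D n" by (simp add: D_def)
      then have "?h x = q x" using elim by blast
      then show "?h x = (\<integral>\<omega>. f (X (T t \<omega>) \<omega>) \<partial>Px x)" using q_eq[OF xD] by simp
    qed
  qed
qed

end

section \<open>The theorem\<close>

theorem theorem1p1:
  fixes \<kappa> :: real and \<mu> :: "real measure"
    and M :: "'w measure" and F :: "ennreal \<Rightarrow> 'w measure"
    and Px :: "'e::t2_space \<Rightarrow> 'w measure"
    and X :: "real \<Rightarrow> 'w \<Rightarrow> 'e" and S :: "real \<Rightarrow> 'w \<Rightarrow> real"
    and \<N> :: "'e measure set" and V :: "('e \<Rightarrow> real) set" and cls :: "('e \<Rightarrow> real) \<Rightarrow> 'b::banach"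
    and P :: "real \<Rightarrow> 'b \<Rightarrow>\<^sub>L 'b" and f :: "'e \<Rightarrow> real"
  assumes "0 \<le> \<kappa>"
    and "sets \<mu> = sets (restrict_space borel {0<..})"
    and "emeasure \<mu> {0<..} = \<infinity>"
    and "(\<integral>\<^sup>+x. ennreal (min 1 x) \<partial>\<mu>) < \<infinity>"
    and "locally_compact_space (euclidean :: 'e topology)"
    and "separable_space (euclidean :: 'e topology)"
    and "strong_markov_process M F Px X"
    and "\<And>x. subordinator (Px x) \<kappa> \<mu> S"
    and "\<And>x. independent_of_process (Px x) F S"
    and "banach_function_space \<N> V cls"
    and "strongly_continuous_semigroup P" and "uniformly_bounded P"
    and "transition_semigroup \<N> V cls Px X P"
    and "f \<in> V" and "cls f \<in> generator_domain P"
  shows "\<exists>u :: real \<Rightarrow> 'b.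
     (\<forall>t\<ge>0. \<forall>x. has_banach_integral (Px x) (\<lambda>\<omega>. P (inverse_time S t \<omega>) (cls f)) (u t)) \<and>
     (\<forall>t\<ge>0. \<exists>h\<in>V. cls h = u t \<and>
        (\<forall>\<nu>\<in>\<N>. AE x in \<nu>. integrable (Px x) (\<lambda>\<omega>. f (X (inverse_time S t \<omega>) \<omega>)) \<longrightarrow>
           h x = (\<integral>\<omega>. f (X (inverse_time S t \<omega>) \<omega>) \<partial>Px x))) \<and>
     ((\<exists>g\<in>V. \<forall>y. \<bar>f y\<bar> \<le> g y) \<longrightarrow>
        (\<forall>t\<ge>0. \<forall>\<nu>\<in>\<N>. AE x in \<nu>. integrable (Px x) (\<lambda>\<omega>. f (X (inverse_time S t \<omega>) \<omega>)))) \<and>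
     strong_solution \<kappa> (levy_tail \<mu>) P (cls f) u \<and>
     (\<forall>v. strong_solution \<kappa> (levy_tail \<mu>) P (cls f) v \<longrightarrow> (\<forall>t\<ge>0. v t = u t))"
proof -
  interpret subordinate_markov \<kappa> \<mu> \<N> V cls P M F Px X S
    by unfold_locales (fact assms)+
  have sol: "strong_solution \<kappa> (levy_tail \<mu>) P (cls f) (\<lambda>t. u t (cls f))"
    using Px.strong_solution_A[OF assms(15)] unfolding u_def .
  show ?thesis
  proof (intro exI[of _ "\<lambda>t. u t (cls f)"] conjI allI impI ballI)
    show "has_banach_integral (Px x) (\<lambda>\<omega>. P (inverse_time S t \<omega>) (cls f)) (u t (cls f))" if "0 \<le> t" for t x
      using Px.has_banach_integral_A[of x t "cls f"] unfolding A_eq_u[OF that] .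
    show "\<exists>h\<in>V. cls h = u t (cls f) \<and>
        (\<forall>\<nu>\<in>\<N>. AE x in \<nu>. integrable (Px x) (\<lambda>\<omega>. f (X (inverse_time S t \<omega>) \<omega>)) \<longrightarrow>
           h x = (\<integral>\<omega>. f (X (inverse_time S t \<omega>) \<omega>) \<partial>Px x))" if "0 \<le> t" for t
      using rep AE_rep_u[OF assms(14) that] by blast
    show "AE x in \<nu>. integrable (Px x) (\<lambda>\<omega>. f (X (inverse_time S t \<omega>) \<omega>))"
      if "\<exists>g\<in>V. \<forall>y. \<bar>f y\<bar> \<le> g y" "0 \<le> t" "\<nu> \<in> \<N>" for t \<nu>
      using that AE_integrable_dominated[OF assms(14)] by blast
    show "strong_solution \<kappa> (levy_tail \<mu>) P (cls f) (\<lambda>t. u t (cls f))" by (rule sol)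
    show "v t = u t (cls f)" if "strong_solution \<kappa> (levy_tail \<mu>) P (cls f) v" "0 \<le> t" for v t
      by (rule Px.strong_solution_unique[OF that(1) sol that(2)])
  qed
qed

end
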